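(* Let $\sigma$ be the even, antilinear superalgebra-morphism of $\mathrm{Hol}(SL(n,m,\mathbb{C}))$ determined on the generators by $$\sigma(x_{ij})=(-1)^{(|i|+|j|)|j|}\,S(x_{ji}),\qquad i,j=1,\dots,n+m .$$ Then $(\mathrm{Hol}(SL(n,m,\mathbb{C})),\sigma)$ is a graded real form of $SL(n,m,\mathbb{C})$, i.e. for all $x,y$ and all $\lambda,\mu\in\mathbb{C}$: (1) $(\sigma\otimes\sigma)\Delta(x)=\Delta(\sigma(x))$; (2) $\epsilon(\sigma(x))=\overline{\epsilon(x)}$; (3) $\sigma(\lambda x+\mu y)=\bar\lambda\sigma(x)+\bar\mu\sigma(y)$; (4) $\sigma(xy)=\sigma(x)\sigma(y)$; (5b) $S\circ\sigma\circ S\circ\sigma(x)=(-1)^{|x|}x$ for homogeneous $x$; (6b) $\sigma(\sigma(x))=(-1)^{|x|}x$ for homogeneous $x$.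
   Context: Fix integers $n,m\ge 0$. For an index $i\in\{1,\dots,n+m\}$ set $|i|=0$ if $i\le n$ and $|i|=1$ if $i>n$. Let $\mathbb{C}[x_{ij}]$ ($i,j=1,\dots,n+m$) be the supercommutative complex superalgebra of formal power series in generators $x_{ij}$ of parity $|x_{ij}|=|i|+|j| \pmod 2$, with $x_{ij}x_{kl}=(-1)^{(|i|+|j|)(|k|+|l|)}x_{kl}x_{ij}$. It is a superbialgebra with coproduct and counit given on generators by $\Delta(x_{ij})=1\otimes x_{ij}+x_{ij}\otimes 1+\sum_{k=1}^{n+m}x_{ik}\otimes x_{kj}$ (equivalently $\Delta(y_{ij})=\sum_k y_{ik}\otimes y_{kj}$ with $y_{ij}=\delta_{ij}+x_{ij}$), $\epsilon(x_{ij})=0$, extended as (super)algebra morphisms. $\mathrm{Hol}(SL(n,m,\mathbb{C}))$ is the quotient of $\mathbb{C}[x_{ij}]$ by the ideal generated by $\mathrm{sdet}(\delta+x)-1$, where for a supermatrix $\begin{pmatrix}A&B\\C&D\end{pmatrix}$ (blocks of sizes $n,m$) $\mathrm{sdet}=\det(A-BD^{-1}C)/\det(D)$. Its antipode $S$ is the superalgebra-antimorphism ($S(ab)=(-1)^{|a||b|}S(b)S(a)$) given by $S(x_{ij})=-\delta_{ij}+((\delta+x)^{-1})_{ij}$, where the supermatrix inverse is $\begin{pmatrix}A&B\\C&D\end{pmatrix}^{-1}=\begin{pmatrix}(A-BD^{-1}C)^{-1}&-A^{-1}B(D-CA^{-1}B)^{-1}\\-D^{-1}C(A-BD^{-1}C)^{-1}&(D-CA^{-1}B)^{-1}\end{pmatrix}$.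 A graded real form of a complex Lie supergroup (Hopf superalgebra) $\mathcal H$ is a pair $(\mathcal H,\sigma)$ with $\sigma:\mathcal H\to\mathcal H$ an even map satisfying (1),(2),(3),(4),(5b),(6b) above. *)

theory Defs
  imports Complex_Main "HOL-Library.Product_Lexorder" "HOL-Combinatorics.Permutations"
begin

text \<open>
Model of the supercommutative formal power series superalgebra.
Generators are indexed by triples (k,i,j): k is the tensor copy index
(k = 0 for Hol itself; k = 0,1 for the completed tensor square Hol (x) Hol,
which is the power series algebra in the disjoint union of the two sets of
generators, with left factor = copy 0 and right factor = copy 1).
A monomial is a finitely supported exponent function; odd generators have
exponent at most 1. The basis monomial for m is the ordered product of the
generators in increasing (lexicographic) order. A power series is a
coefficient function on monomials.
\<close>

type_synonym var = "nat \<times> nat \<times> nat"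
type_synonym mono = "var \<Rightarrow> nat"
type_synonym ps = "mono \<Rightarrow> complex"
type_synonym psmat = "nat \<Rightarrow> nat \<Rightarrow> ps"

definition idx_odd :: "nat \<Rightarrow> nat \<Rightarrow> bool" where
  "idx_odd n i = (n < i)"

definition var_odd :: "nat \<Rightarrow> var \<Rightarrow> bool" where
  "var_odd n v = (case v of (k, i, j) \<Rightarrow> idx_odd n i \<noteq> idx_odd n j)"

definition supp :: "mono \<Rightarrow> var set" where
  "supp m = {v. m v \<noteq> 0}"

definition valid_mono :: "nat \<Rightarrow> mono \<Rightarrow> bool" where
  "valid_mono n m = (finite (supp m) \<and> (\<forall>v. var_odd n v \<longrightarrow> m v \<le> 1))"

definition mono_odd :: "nat \<Rightarrow> mono \<Rightarrow> bool" where
  "mono_odd n m = odd (card {v \<in> supp m. var_odd n v})"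

definition mono_deg :: "mono \<Rightarrow> nat" where
  "mono_deg m = (\<Sum>v\<in>supp m. m v)"

text \<open>Sign arising from reordering (ordered monomial m1)(ordered monomial m2).\<close>
definition mono_sign :: "nat \<Rightarrow> mono \<Rightarrow> mono \<Rightarrow> complex" where
  "mono_sign n m1 m2 = (-1) ^ card {(a, b). var_odd n a \<and> var_odd n b \<and>
      a \<in> supp m1 \<and> b \<in> supp m2 \<and> b < a}"

definition ps_zero :: ps where "ps_zero = (\<lambda>m. 0)"
definition ps_one :: ps where "ps_one = (\<lambda>m. if m = (\<lambda>v. 0) then 1 else 0)"
definition ps_var :: "var \<Rightarrow> ps" where
  "ps_var v = (\<lambda>m. if m = (\<lambda>u. if u = v then 1 else 0) then 1 else 0)"
definition ps_add :: "ps \<Rightarrow> ps \<Rightarrow> ps" where "ps_add F G = (\<lambda>m. F m + G m)"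
definition ps_smult :: "complex \<Rightarrow> ps \<Rightarrow> ps" where "ps_smult c F = (\<lambda>m. c * F m)"
definition ps_sub :: "ps \<Rightarrow> ps \<Rightarrow> ps" where "ps_sub F G = (\<lambda>m. F m - G m)"
definition ps_sum :: "'a set \<Rightarrow> ('a \<Rightarrow> ps) \<Rightarrow> ps" where
  "ps_sum K f = (\<lambda>m. \<Sum>k\<in>K. f k m)"
definition ps_conj :: "ps \<Rightarrow> ps" where "ps_conj F = (\<lambda>m. cnj (F m))"

definition ps_mult :: "nat \<Rightarrow> ps \<Rightarrow> ps \<Rightarrow> ps" where
  "ps_mult n F G = (\<lambda>m. if valid_mono n m then
      (\<Sum>(m1, m2)\<in>{(m1, m2). \<forall>v. m1 v + m2 v = m v}.
          mono_sign n m1 m2 * F m1 * G m2)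
    else 0)"

primrec ps_pow :: "nat \<Rightarrow> ps \<Rightarrow> nat \<Rightarrow> ps" where
  "ps_pow n F 0 = ps_one"
| "ps_pow n F (Suc k) = ps_mult n F (ps_pow n F k)"

definition ps_wf :: "nat \<Rightarrow> ps \<Rightarrow> bool" where
  "ps_wf n F = (\<forall>m. \<not> valid_mono n m \<longrightarrow> F m = 0)"

definition ps_on :: "nat \<Rightarrow> var set \<Rightarrow> ps \<Rightarrow> bool" where
  "ps_on n V F = (ps_wf n F \<and> (\<forall>m. F m \<noteq> 0 \<longrightarrow> supp m \<subseteq> V))"

definition ps_homog :: "nat \<Rightarrow> bool \<Rightarrow> ps \<Rightarrow> bool" where
  "ps_homog n p F = (\<forall>m. F m \<noteq> 0 \<longrightarrow> mono_odd n m = p)"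

definition ps_monopow :: "nat \<Rightarrow> (var \<Rightarrow> ps) \<Rightarrow> mono \<Rightarrow> ps" where
  "ps_monopow n g m = foldr (\<lambda>v acc. ps_mult n (ps_pow n (g v) (m v)) acc)
      (sorted_list_of_set (supp m)) ps_one"

text \<open>Continuous algebra morphism sending the generators in V to g v
  (the g v have zero constant term, so coefficients are finite sums).\<close>
definition ps_subst :: "nat \<Rightarrow> var set \<Rightarrow> (var \<Rightarrow> ps) \<Rightarrow> ps \<Rightarrow> ps" where
  "ps_subst n V g F = (\<lambda>w. \<Sum>m\<in>{m. valid_mono n m \<and> supp m \<subseteq> V \<and> mono_deg m \<le> mono_deg w}.
      F m * ps_monopow n g m w)"

definition Vs :: "nat \<Rightarrow> nat \<Rightarrow> var set" where
  "Vs N c = {(k, i, j). k < c \<and> i \<in> {1..N} \<and> j \<in> {1..N}}"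

definition mat_mult_on :: "nat \<Rightarrow> nat set \<Rightarrow> psmat \<Rightarrow> psmat \<Rightarrow> psmat" where
  "mat_mult_on n K P Q = (\<lambda>i j. ps_sum K (\<lambda>k. ps_mult n (P i k) (Q k j)))"

definition mat_id_on :: "nat set \<Rightarrow> psmat" where
  "mat_id_on K = (\<lambda>i j. if i \<in> K \<and> j \<in> K \<and> i = j then ps_one else ps_zero)"

definition mat_inv_on :: "nat \<Rightarrow> nat set \<Rightarrow> psmat \<Rightarrow> psmat" where
  "mat_inv_on n K M = (THE Z. (\<forall>i j. ps_wf n (Z i j)) \<and>
      (\<forall>i j. (i \<notin> K \<or> j \<notin> K) \<longrightarrow> Z i j = ps_zero) \<and>
      (\<forall>i\<in>K. \<forall>j\<in>K. mat_mult_on n K M Z i j = mat_id_on K i j) \<and>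
      (\<forall>i\<in>K. \<forall>j\<in>K. mat_mult_on n K Z M i j = mat_id_on K i j))"

definition ps_inv :: "nat \<Rightarrow> ps \<Rightarrow> ps" where
  "ps_inv n F = (THE G. ps_wf n G \<and> ps_mult n F G = ps_one)"

text \<open>Determinant of the K x K block (entries even, hence commuting).\<close>
definition det_on :: "nat \<Rightarrow> nat set \<Rightarrow> psmat \<Rightarrow> ps" where
  "det_on n K M = ps_sum {p. p permutes K} (\<lambda>p. ps_smult (of_int (sign p))
      (foldr (\<lambda>i acc. ps_mult n (M i (p i)) acc) (sorted_list_of_set K) ps_one))"

text \<open>Superdeterminant: det(A - B D^-1 C) / det D.\<close>
definition schur :: "nat \<Rightarrow> nat \<Rightarrow> psmat \<Rightarrow> psmat" where
  "schur n m M = (\<lambda>i j. ps_sub (M i j)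
      (mat_mult_on n {n+1..n+m} (mat_mult_on n {n+1..n+m} M (mat_inv_on n {n+1..n+m} M)) M i j))"

definition sdet :: "nat \<Rightarrow> nat \<Rightarrow> psmat \<Rightarrow> ps" where
  "sdet n m M = ps_mult n (det_on n {1..n} (schur n m M)) (ps_inv n (det_on n {n+1..n+m} M))"

definition Ymat :: "nat \<Rightarrow> nat \<Rightarrow> psmat" where
  "Ymat n k = (\<lambda>i j. ps_add (if i = j then ps_one else ps_zero) (ps_var (k, i, j)))"

definition sdet_rel :: "nat \<Rightarrow> nat \<Rightarrow> nat \<Rightarrow> ps" where
  "sdet_rel n m k = ps_sub (sdet n m (Ymat n k)) ps_one"

text \<open>Representatives of Hol(SL(n,m,C)) and the defining ideal; and of the
  (completed) tensor square with its ideal.\<close>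
definition hol_elts :: "nat \<Rightarrow> nat \<Rightarrow> ps set" where
  "hol_elts n m = {F. ps_on n (Vs (n+m) 1) F}"

definition hol_ideal :: "nat \<Rightarrow> nat \<Rightarrow> ps set" where
  "hol_ideal n m = {ps_mult n a (sdet_rel n m 0) | a. ps_wf n a}"

definition tens_ideal :: "nat \<Rightarrow> nat \<Rightarrow> ps set" where
  "tens_ideal n m = {ps_add (ps_mult n a (sdet_rel n m 0)) (ps_mult n b (sdet_rel n m 1)) | a b.
      ps_wf n a \<and> ps_wf n b}"

definition S_gen :: "nat \<Rightarrow> nat \<Rightarrow> nat \<Rightarrow> nat \<Rightarrow> nat \<Rightarrow> ps" where
  "S_gen n m k i j = ps_sub (mat_inv_on n {1..n+m} (Ymat n k) i j) (if i = j then ps_one else ps_zero)"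

definition antipode :: "nat \<Rightarrow> nat \<Rightarrow> ps \<Rightarrow> ps" where
  "antipode n m F = ps_subst n (Vs (n+m) 1) (\<lambda>(k, i, j). S_gen n m k i j) F"

definition coprod :: "nat \<Rightarrow> nat \<Rightarrow> ps \<Rightarrow> ps" where
  "coprod n m F = ps_subst n (Vs (n+m) 1)
     (\<lambda>(k, i, j). ps_add (ps_add (ps_var (0, i, j)) (ps_var (1, i, j)))
        (ps_sum {1..n+m} (\<lambda>l. ps_mult n (ps_var (0, i, l)) (ps_var (1, l, j))))) F"

definition counit :: "ps \<Rightarrow> complex" where
  "counit F = F (\<lambda>v. 0)"

text \<open>sigma(x_ij) = (-1)^((|i|+|j|)|j|) S(x_ji), copy k.\<close>
definition sigma_gen :: "nat \<Rightarrow> nat \<Rightarrow> nat \<Rightarrow> nat \<Rightarrow> nat \<Rightarrow> ps" where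
  "sigma_gen n m k i j = ps_smult (if \<not> idx_odd n i \<and> idx_odd n j then -1 else 1) (S_gen n m k j i)"

definition sigma :: "nat \<Rightarrow> nat \<Rightarrow> ps \<Rightarrow> ps" where
  "sigma n m F = ps_subst n (Vs (n+m) 1) (\<lambda>(k, i, j). sigma_gen n m k i j) (ps_conj F)"

definition sigma2 :: "nat \<Rightarrow> nat \<Rightarrow> ps \<Rightarrow> ps" where
  "sigma2 n m F = ps_subst n (Vs (n+m) 2) (\<lambda>(k, i, j). sigma_gen n m k i j) (ps_conj F)"

end

theory Submission
  imports Defs "Jordan_Normal_Form.Determinant"
begin

text \<open>
  All structure maps are continuous substitutions into supercommutative power series, hence algebra
  homomorphisms, and a homomorphism maps the inverse \<open>Z\<close> of the generic supermatrix \<open>Y = \<delta> + x\<close> to the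
  inverse of the image of \<open>Y\<close>. Now \<open>\<sigma>(Y)\<close> is the supertranspose of \<open>Z\<close>, whose inverse is the supertranspose
  of \<open>Y\<close>; likewise \<open>S(Z) = Y\<close> and \<open>\<Delta>(Z) = Z' Z\<close>. Comparing values on generators therefore gives the
  compatibility with \<open>\<Delta>\<close> and the two graded involution laws already as identities of power series.
  The ideal is preserved because \<open>\<sigma>(sdet Y) = (sdet Y)\<^sup>-\<^sup>1\<close>, which reduces to
  \<open>det (1 - U V) det (1 - V U) = 1\<close> for odd matrices \<open>U\<close>, \<open>V\<close>.
\<close>

text \<open>The antipode is a super antimorphism, but in a supercommutative algebra
  \<open>S(ab) = (-1)^(|a||b|) S(b) S(a) = S(a) S(b)\<close>, so it is a substitution like the other
  maps. Since \<open>sigma\<close> is antilinear, homomorphisms are taken to be ring homomorphisms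
  without a scalar rule; this suffices because the scalars in determinants and supertransposes are 1
  and -1 only. The sign \<open>(-1)^|x|\<close> in the involution laws arises because
  supertransposition is not an involution: done twice, it multiplies odd entries by -1. The obstacle
  is noncommutativity: determinants make sense for even blocks only, and all other matrix identities
  live in a noncommutative ring. For odd \<open>U\<close> and \<open>V\<close> the traces of
  \<open>U V\<close> and \<open>V U\<close> are opposite, so Sylvester's
  \<open>det (1 - U V) = det (1 - V U)\<close> turns into the statement that the two determinants
  are inverse to each other. The Berezinian occurs only for a supermatrix and its inverse, where the
  block equations of \<open>Y Z = Z Y = 1\<close> lead to this identity.\<close>

declare split_paired_All [simp del] split_paired_Ex [simp del]

section \<open>Monomials, their decompositions and the reordering sign\<close>

definition splits :: "mono \<Rightarrow> (mono \<times> mono) set" where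
  "splits w = {(m1, m2). \<forall>v. m1 v + m2 v = w v}"

definition odd_supp :: "nat \<Rightarrow> mono \<Rightarrow> var set" where
  "odd_supp n m = {v \<in> supp m. var_odd n v}"

lemma splits_iff: "(a, b) \<in> splits w \<longleftrightarrow> w = (\<lambda>v. a v + b v)"
  by (auto simp: splits_def fun_eq_iff)

lemma supp_add: "supp (\<lambda>v. a v + b v :: nat) = supp a \<union> supp b"
  by (auto simp: supp_def)

lemma finite_monos_bounded:
  assumes "finite A"
  shows "finite {m :: mono. supp m \<subseteq> A \<and> (\<forall>v. m v \<le> k)}"
proof (rule finite_subset)
  show "{m :: mono. supp m \<subseteq> A \<and> (\<forall>v. m v \<le> k)}
      \<subseteq> {f. \<forall>x. (x \<in> A \<longrightarrow> f x \<in> {..k}) \<and> (x \<notin> A \<longrightarrow> f x = 0)}"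
    by (auto simp: supp_def)
qed (intro finite_set_of_finite_funs assms, simp)

lemma mono_deg_ge:
  assumes "finite (supp m)"
  shows "m v \<le> mono_deg m"
proof (cases "v \<in> supp m")
  case True
  then show ?thesis using assms unfolding mono_deg_def
    by (intro member_le_sum) auto
qed (auto simp: supp_def)

lemma finite_splits:
  assumes "finite (supp w)"
  shows "finite (splits w)"
proof -
  let ?M = "{m :: mono. supp m \<subseteq> supp w \<and> (\<forall>v. m v \<le> mono_deg w)}"
  have "a \<in> ?M \<and> b \<in> ?M" if "(a, b) \<in> splits w" for a b
  proof -
    have w: "w = (\<lambda>v. a v + b v)" using that by (simp add: splits_iff)
    have "a v + b v \<le> mono_deg w" for v
      using mono_deg_ge[OF assms, of v] by (simp add: w)
    then show ?thesis
      by (auto simp: supp_def w intro: add_leD1 add_leD2)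
  qed
  then have "splits w \<subseteq> ?M \<times> ?M" by (intro subrelI SigmaI) blast+
  then show ?thesis
    using finite_monos_bounded[OF assms] by (meson finite_SigmaI finite_subset)
qed

lemma mono_deg_superset:
  assumes "finite A" "supp m \<subseteq> A"
  shows "mono_deg m = (\<Sum>v\<in>A. m v)"
  unfolding mono_deg_def by (intro sum.mono_neutral_left) (use assms in \<open>auto simp: supp_def\<close>)

lemma mono_deg_add:
  assumes "finite (supp a)" "finite (supp b)"
  shows "mono_deg (\<lambda>v. a v + b v) = mono_deg a + mono_deg b"
proof -
  have f: "finite (supp a \<union> supp b)" using assms by simp
  show ?thesis
    using mono_deg_superset[OF f, of a] mono_deg_superset[OF f, of b]
      mono_deg_superset[OF f, of "\<lambda>v. a v + b v"]
    by (simp add: supp_add sum.distrib)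
qed

lemma mono_deg_0_iff: "finite (supp m) \<Longrightarrow> mono_deg m = 0 \<longleftrightarrow> m = (\<lambda>v. 0)"
  by (auto simp: mono_deg_def supp_def fun_eq_iff)

lemma mono_deg_zero [simp]: "mono_deg (\<lambda>v. 0) = 0"
  by (simp add: mono_deg_def)

lemma supp_zero [simp]: "supp (\<lambda>v. 0) = {}"
  by (simp add: supp_def)

lemma valid_mono_zero [simp]: "valid_mono n (\<lambda>v. 0)"
  by (simp add: valid_mono_def)

lemma valid_mono_addD:
  assumes "valid_mono n (\<lambda>v. a v + b v)"
  shows "valid_mono n a" "valid_mono n b"
  using assms unfolding valid_mono_def supp_add by (meson add_leD1 add_leD2 finite_Un)+

lemma splits_valid:
  assumes "valid_mono n w" "(a, b) \<in> splits w"
  shows "valid_mono n a" "valid_mono n b"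
  using assms valid_mono_addD[of n a b] by (simp_all add: splits_iff)

lemma splits_deg:
  assumes "valid_mono n w" "(a, b) \<in> splits w"
  shows "mono_deg w = mono_deg a + mono_deg b"
  using splits_valid[OF assms] assms(2)
  by (simp add: splits_iff mono_deg_add valid_mono_def)

lemma finite_odd_supp: "valid_mono n m \<Longrightarrow> finite (odd_supp n m)"
  by (simp add: odd_supp_def valid_mono_def)

lemma odd_supp_disjoint:
  assumes "valid_mono n (\<lambda>v. a v + b v)"
  shows "odd_supp n a \<inter> odd_supp n b = {}"
proof -
  have "False" if "v \<in> odd_supp n a" "v \<in> odd_supp n b" for v
  proof -
    have "a v + b v \<le> 1" using assms that by (auto simp: valid_mono_def odd_supp_def)
    then show False using that by (auto simp: odd_supp_def supp_def)
  qed
  then show ?thesis by blast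
qed

lemma odd_supp_add: "odd_supp n (\<lambda>v. a v + b v) = odd_supp n a \<union> odd_supp n b"
  by (auto simp: odd_supp_def supp_add)

text \<open>The pairs of odd generators that have to cross when the product of two ordered monomials
  is sorted; \<open>mono_sign\<close> sees only the parity of their number.\<close>

definition inv_pairs :: "nat \<Rightarrow> mono \<Rightarrow> mono \<Rightarrow> (var \<times> var) set" where
  "inv_pairs n a b = {(x, y) \<in> odd_supp n a \<times> odd_supp n b. y < x}"

lemma mono_sign_eq: "mono_sign n a b = (-1) ^ card (inv_pairs n a b)"
  unfolding mono_sign_def inv_pairs_def odd_supp_def
  by (rule arg_cong[where f = "\<lambda>A. (-1) ^ card A"]) auto

lemma finite_inv_pairs:
  "valid_mono n a \<Longrightarrow> valid_mono n b \<Longrightarrow> finite (inv_pairs n a b)"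
  unfolding inv_pairs_def
  by (rule finite_subset[of _ "odd_supp n a \<times> odd_supp n b"]) (auto simp: finite_odd_supp)

text \<open>The odd supports of \<open>a\<close> and \<open>b\<close> are disjoint, because an odd
  generator has exponent at most 1 in the sum; so the inversions against \<open>c\<close> add up.
  Together with the mirrored lemma this makes the sign multiplicative in both arguments, which is
  what associativity rests on.\<close>

lemma mono_sign_add_left:
  assumes "valid_mono n (\<lambda>v. a v + b v)" "valid_mono n c"
  shows "mono_sign n (\<lambda>v. a v + b v) c = mono_sign n a c * mono_sign n b c"
proof -
  have "inv_pairs n (\<lambda>v. a v + b v) c = inv_pairs n a c \<union> inv_pairs n b c"
    by (auto simp: inv_pairs_def odd_supp_add)
  moreover have "inv_pairs n a c \<inter> inv_pairs n b c = {}"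
    using odd_supp_disjoint[OF assms(1)] by (auto simp: inv_pairs_def)
  ultimately show ?thesis
    using valid_mono_addD[OF assms(1)] assms(2)
    by (simp add: mono_sign_eq card_Un_disjoint finite_inv_pairs power_add)
qed

lemma mono_sign_add_right:
  assumes "valid_mono n (\<lambda>v. a v + b v)" "valid_mono n c"
  shows "mono_sign n c (\<lambda>v. a v + b v) = mono_sign n c a * mono_sign n c b"
proof -
  have "inv_pairs n c (\<lambda>v. a v + b v) = inv_pairs n c a \<union> inv_pairs n c b"
    by (auto simp: inv_pairs_def odd_supp_add)
  moreover have "inv_pairs n c a \<inter> inv_pairs n c b = {}"
    using odd_supp_disjoint[OF assms(1)] by (auto simp: inv_pairs_def)
  ultimately show ?thesis
    using valid_mono_addD[OF assms(1)] assms(2)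
    by (simp add: mono_sign_eq card_Un_disjoint finite_inv_pairs power_add)
qed

lemma mono_odd_eq: "mono_odd n m \<longleftrightarrow> odd (card (odd_supp n m))"
  by (simp add: mono_odd_def odd_supp_def)

lemma mono_odd_add:
  assumes "valid_mono n (\<lambda>v. a v + b v)"
  shows "mono_odd n (\<lambda>v. a v + b v) \<longleftrightarrow> mono_odd n a \<noteq> mono_odd n b"
  using odd_supp_disjoint[OF assms] valid_mono_addD[OF assms]
  by (simp add: mono_odd_eq odd_supp_add card_Un_disjoint finite_odd_supp)

text \<open>With disjoint odd supports, every pair in
  \<open>odd_supp n a \<times> odd_supp n b\<close> is an inversion for exactly one of the two
  orders, so the two counts add up to the product of the cardinalities.\<close>

lemma mono_sign_swap:
  assumes "valid_mono n (\<lambda>v. a v + b v)"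
  shows "mono_sign n b a = (if mono_odd n a \<and> mono_odd n b then -1 else 1) * mono_sign n a b"
proof -
  note valid_mono_addD[OF assms, simp]
  let ?s = "prod.swap ` inv_pairs n b a"
  have "inv_pairs n a b \<union> ?s = odd_supp n a \<times> odd_supp n b"
    using odd_supp_disjoint[OF assms] by (force simp: inv_pairs_def image_iff)
  moreover have "inv_pairs n a b \<inter> ?s = {}"
    by (auto simp: inv_pairs_def)
  ultimately have "card (inv_pairs n a b) + card ?s = card (odd_supp n a) * card (odd_supp n b)"
    by (subst card_Un_disjoint[symmetric])
       (simp_all add: card_cartesian_product finite_inv_pairs)
  moreover have "card ?s = card (inv_pairs n b a)"
    by (intro card_image) simp
  ultimately have "even (card (inv_pairs n a b) + card (inv_pairs n b a))
      \<longleftrightarrow> even (card (odd_supp n a) * card (odd_supp n b))"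
    by simp
  then show ?thesis
    unfolding mono_sign_eq mono_odd_eq
    by (cases "even (card (inv_pairs n a b))"; cases "even (card (inv_pairs n b a))") simp_all
qed

lemma mono_sign_zero [simp]: "mono_sign n (\<lambda>v. 0) b = 1" "mono_sign n a (\<lambda>v. 0) = 1"
  by (simp_all add: mono_sign_def)

subsection \<open>Ring structure\<close>

lemma ps_mult_valid:
  "valid_mono n w \<Longrightarrow> ps_mult n F G w = (\<Sum>(a, b)\<in>splits w. mono_sign n a b * F a * G b)"
  by (simp add: ps_mult_def splits_def)

lemma ps_mult_wf [simp]: "ps_wf n (ps_mult n F G)"
  by (simp add: ps_wf_def ps_mult_def)

lemma ps_eqI:
  assumes "ps_wf n F" "ps_wf n G" "\<And>w. valid_mono n w \<Longrightarrow> F w = G w"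
  shows "F = G"
  using assms by (metis ext ps_wf_def)

lemma ps_wf_basic [simp]:
  "ps_wf n ps_zero" "ps_wf n ps_one"
  by (auto simp: ps_wf_def ps_zero_def ps_one_def)

lemma ps_wf_var [simp]: "ps_wf n (ps_var v)"
  by (auto simp: ps_wf_def ps_var_def valid_mono_def supp_def)

lemma ps_wf_closed [simp]:
  "ps_wf n F \<Longrightarrow> ps_wf n G \<Longrightarrow> ps_wf n (ps_add F G)"
  "ps_wf n F \<Longrightarrow> ps_wf n G \<Longrightarrow> ps_wf n (ps_sub F G)"
  "ps_wf n F \<Longrightarrow> ps_wf n (ps_smult c F)"
  "ps_wf n F \<Longrightarrow> ps_wf n (ps_conj F)"
  by (auto simp: ps_wf_def ps_add_def ps_sub_def ps_smult_def ps_conj_def)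

lemma ps_wf_sum [simp]: "(\<And>k. k \<in> K \<Longrightarrow> ps_wf n (f k)) \<Longrightarrow> ps_wf n (ps_sum K f)"
  by (auto simp: ps_wf_def ps_sum_def)

text \<open>Two bracketings of the same enumeration of triples with sum \<open>w\<close>.\<close>

lemma sum_splits_assoc:
  fixes f :: "mono \<Rightarrow> mono \<Rightarrow> mono \<Rightarrow> 'c :: comm_monoid_add"
  assumes "finite (supp w)"
  shows "(\<Sum>(p, c)\<in>splits w. \<Sum>(a, b)\<in>splits p. f a b c)
       = (\<Sum>(a, q)\<in>splits w. \<Sum>(b, c)\<in>splits q. f a b c)"
proof -
  have fin: "finite (splits (fst x))" "finite (splits (snd x))" if "x \<in> splits w" for x
    using that assms by (cases x; force simp: splits_iff supp_add intro!: finite_splits)+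
  have "(\<Sum>(p, c)\<in>splits w. \<Sum>(a, b)\<in>splits p. f a b c)
      = (\<Sum>x\<in>splits w. \<Sum>y\<in>splits (fst x). f (fst y) (snd y) (snd x))"
    by (simp add: case_prod_beta)
  also have "\<dots> = (\<Sum>(x, y)\<in>Sigma (splits w) (\<lambda>x. splits (fst x)). f (fst y) (snd y) (snd x))"
    by (rule sum.Sigma) (use assms fin in \<open>auto intro: finite_splits\<close>)
  also have "\<dots> = (\<Sum>(x, y)\<in>Sigma (splits w) (\<lambda>x. splits (snd x)). f (fst x) (fst y) (snd y))"
    by (rule sum.reindex_bij_witness[where
          j = "\<lambda>((p, c), (a, b)). ((a, \<lambda>v. b v + c v), (b, c))" and
          i = "\<lambda>((a, q), (b, c)). ((\<lambda>v. a v + b v, c), (a, b))"])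
       (auto simp: splits_iff add.assoc)
  also have "\<dots> = (\<Sum>x\<in>splits w. \<Sum>y\<in>splits (snd x). f (fst x) (fst y) (snd y))"
    by (rule sum.Sigma[symmetric]) (use assms fin in \<open>auto intro: finite_splits\<close>)
  finally show ?thesis by (simp add: case_prod_beta)
qed

lemma ps_mult_assoc: "ps_mult n (ps_mult n F G) H = ps_mult n F (ps_mult n G H)"
proof (rule ps_eqI[where n = n])
  fix w assume w: "valid_mono n w"
  define f where "f a b c = mono_sign n a b * mono_sign n a c * mono_sign n b c * F a * G b * H c" for a b c
  have 1: "mono_sign n p c * ps_mult n F G p * H c = (\<Sum>(a, b)\<in>splits p. f a b c)"
    if "(p, c) \<in> splits w" for p c
  proof -
    note v = splits_valid[OF w that]
    have "mono_sign n p c * (mono_sign n a b * F a * G b) * H c = f a b c" if "(a, b) \<in> splits p" for a b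
      using mono_sign_add_left[of n a b c] v that by (simp add: splits_iff f_def)
    then show ?thesis unfolding ps_mult_valid[OF v(1)] sum_distrib_left sum_distrib_right
      by (intro sum.cong refl) (simp add: case_prod_beta)
  qed
  have 2: "mono_sign n a q * F a * ps_mult n G H q = (\<Sum>(b, c)\<in>splits q. f a b c)"
    if "(a, q) \<in> splits w" for a q
  proof -
    note v = splits_valid[OF w that]
    have "mono_sign n a q * F a * (mono_sign n b c * G b * H c) = f a b c" if "(b, c) \<in> splits q" for b c
      using mono_sign_add_right[of n b c a] v that by (simp add: splits_iff f_def)
    then show ?thesis unfolding ps_mult_valid[OF v(2)] sum_distrib_left
      by (intro sum.cong refl) (simp add: case_prod_beta)
  qed
  have "ps_mult n (ps_mult n F G) H w = (\<Sum>(p, c)\<in>splits w. \<Sum>(a, b)\<in>splits p. f a b c)"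
    unfolding ps_mult_valid[OF w] by (rule sum.cong) (use 1 in auto)
  also have "\<dots> = (\<Sum>(a, q)\<in>splits w. \<Sum>(b, c)\<in>splits q. f a b c)"
    using w by (intro sum_splits_assoc) (simp add: valid_mono_def)
  also have "\<dots> = ps_mult n F (ps_mult n G H) w"
    unfolding ps_mult_valid[OF w] by (rule sum.cong) (use 2 in auto)
  finally show "ps_mult n (ps_mult n F G) H w = ps_mult n F (ps_mult n G H) w" .
qed simp_all

lemma ps_mult_one_left: "ps_wf n F \<Longrightarrow> ps_mult n ps_one F = F"
proof (rule ps_eqI[where n = n])
  fix w assume w: "valid_mono n w"
  have "ps_mult n ps_one F w = (\<Sum>(a, b)\<in>{(\<lambda>v. 0, w)}. mono_sign n a b * ps_one a * F b)"
    unfolding ps_mult_valid[OF w]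
    by (rule sum.mono_neutral_right)
       (use w in \<open>auto simp: finite_splits valid_mono_def splits_iff ps_one_def split: if_splits\<close>)
  then show "ps_mult n ps_one F w = F w" by (simp add: ps_one_def)
qed simp_all

lemma ps_mult_one_right: "ps_wf n F \<Longrightarrow> ps_mult n F ps_one = F"
proof (rule ps_eqI[where n = n])
  fix w assume w: "valid_mono n w"
  have "ps_mult n F ps_one w = (\<Sum>(a, b)\<in>{(w, \<lambda>v. 0)}. mono_sign n a b * F a * ps_one b)"
    unfolding ps_mult_valid[OF w]
    by (rule sum.mono_neutral_right)
       (use w in \<open>auto simp: finite_splits valid_mono_def splits_iff ps_one_def split: if_splits\<close>)
  then show "ps_mult n F ps_one w = F w" by (simp add: ps_one_def)
qed simp_all

lemma ps_mult_alt: "ps_mult n F G = (\<lambda>w. if valid_mono n w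
    then \<Sum>x\<in>splits w. mono_sign n (fst x) (snd x) * F (fst x) * G (snd x) else 0)"
proof
  fix w show "ps_mult n F G w = (if valid_mono n w
    then \<Sum>x\<in>splits w. mono_sign n (fst x) (snd x) * F (fst x) * G (snd x) else 0)"
    by (cases "valid_mono n w") (simp add: ps_mult_valid case_prod_beta, simp add: ps_mult_def)
qed

lemma ps_mult_add_left: "ps_mult n (ps_add F G) H = ps_add (ps_mult n F H) (ps_mult n G H)"
  by (rule ext) (simp add: ps_mult_alt ps_add_def distrib_left distrib_right sum.distrib)

lemma ps_mult_add_right: "ps_mult n H (ps_add F G) = ps_add (ps_mult n H F) (ps_mult n H G)"
  by (rule ext) (simp add: ps_mult_alt ps_add_def distrib_left distrib_right sum.distrib)

lemma ps_mult_smult_left: "ps_mult n (ps_smult c F) G = ps_smult c (ps_mult n F G)"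
  by (rule ext) (simp add: ps_mult_alt ps_smult_def sum_distrib_left mult_ac)

lemma ps_mult_smult_right: "ps_mult n F (ps_smult c G) = ps_smult c (ps_mult n F G)"
  by (rule ext) (simp add: ps_mult_alt ps_smult_def sum_distrib_left mult_ac)

lemma ps_mult_const: "ps_mult n F G (\<lambda>v. 0) = F (\<lambda>v. 0) * G (\<lambda>v. 0)"
proof -
  have "splits (\<lambda>v. 0) = {(\<lambda>v. 0, \<lambda>v. 0)}" by (auto simp: splits_def fun_eq_iff)
  then show ?thesis by (simp add: ps_mult_valid)
qed

lemma ps_mult_swap:
  assumes "ps_homog n p F" "ps_homog n q G"
  shows "ps_mult n G F = ps_smult (if p \<and> q then -1 else 1) (ps_mult n F G)"
proof (rule ps_eqI[where n = n])
  fix w assume w: "valid_mono n w"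
  have "ps_mult n G F w = (\<Sum>(a, b)\<in>splits w. mono_sign n b a * F a * G b)"
    unfolding ps_mult_valid[OF w]
    by (rule sum.reindex_bij_witness[where i = prod.swap and j = prod.swap])
       (auto simp: splits_iff add.commute)
  also have "\<dots> = (\<Sum>(a, b)\<in>splits w. (if p \<and> q then -1 else 1) * (mono_sign n a b * F a * G b))"
  proof (intro sum.cong refl, clarify)
    fix a b assume ab: "(a, b) \<in> splits w"
    show "mono_sign n b a * F a * G b = (if p \<and> q then -1 else 1) * (mono_sign n a b * F a * G b)"
    proof (cases "F a = 0 \<or> G b = 0")
      case False
      then have "mono_odd n a = p" "mono_odd n b = q" using assms by (auto simp: ps_homog_def)
      then show ?thesis using mono_sign_swap[of n a b] ab w by (auto simp: splits_iff)
    qed auto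
  qed
  also have "\<dots> = ps_smult (if p \<and> q then -1 else 1) (ps_mult n F G) w"
    unfolding ps_smult_def ps_mult_valid[OF w] by (simp add: sum_distrib_left case_prod_beta)
  finally show "ps_mult n G F w = ps_smult (if p \<and> q then -1 else 1) (ps_mult n F G) w" .
qed simp_all

text \<open>Even series are central. This is no instance of \<open>ps_mult_swap\<close>, since
  \<open>G\<close> may mix parities.\<close>

lemma ps_mult_comm_even:
  assumes "ps_homog n False F"
  shows "ps_mult n F G = ps_mult n G F"
proof (rule ps_eqI[where n = n])
  fix w assume w: "valid_mono n w"
  have "ps_mult n G F w = (\<Sum>(a, b)\<in>splits w. mono_sign n b a * F a * G b)"
    unfolding ps_mult_valid[OF w]
    by (rule sum.reindex_bij_witness[where i = prod.swap and j = prod.swap])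
       (auto simp: splits_iff add.commute)
  also have "\<dots> = (\<Sum>(a, b)\<in>splits w. mono_sign n a b * F a * G b)"
  proof (intro sum.cong refl, clarify)
    fix a b assume ab: "(a, b) \<in> splits w"
    show "mono_sign n b a * F a * G b = mono_sign n a b * F a * G b"
    proof (cases "F a = 0")
      case False
      then have "mono_odd n a = False" using assms by (auto simp: ps_homog_def)
      then show ?thesis using mono_sign_swap[of n a b] ab w by (auto simp: splits_iff)
    qed auto
  qed
  finally show "ps_mult n F G w = ps_mult n G F w" unfolding ps_mult_valid[OF w] ..
qed simp_all

lemma ps_homog_mult:
  assumes "ps_homog n p F" "ps_homog n q G"
  shows "ps_homog n (p \<noteq> q) (ps_mult n F G)"
  unfolding ps_homog_def
proof (intro allI impI)
  fix w assume nz: "ps_mult n F G w \<noteq> 0"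
  then have w: "valid_mono n w" using ps_mult_wf ps_wf_def by blast
  from nz obtain x where "x \<in> splits w" "(case x of (a, b) \<Rightarrow> mono_sign n a b * F a * G b) \<noteq> 0"
    unfolding ps_mult_valid[OF w] by (rule sum.not_neutral_contains_not_neutral)
  then obtain a b where ab: "(a, b) \<in> splits w" "mono_sign n a b * F a * G b \<noteq> 0"
    by (cases x) auto
  then have "mono_odd n a = p" "mono_odd n b = q" using assms by (auto simp: ps_homog_def)
  then show "mono_odd n w = (p \<noteq> q)" using ab(1) w by (auto simp: splits_iff mono_odd_add)
qed

lemma ps_homog_basic [simp]:
  "ps_homog n p ps_zero" "ps_homog n False ps_one"
  by (auto simp: ps_homog_def ps_zero_def ps_one_def mono_odd_def)

lemma ps_homog_zeroD: "ps_homog n p F \<Longrightarrow> mono_odd n m \<noteq> p \<Longrightarrow> F m = 0"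
  unfolding ps_homog_def by blast

lemma ps_homogI: "(\<And>m. mono_odd n m \<noteq> p \<Longrightarrow> F m = 0) \<Longrightarrow> ps_homog n p F"
  unfolding ps_homog_def by blast

lemma odd_supp_single: "odd_supp n (\<lambda>u. if u = v then 1 else 0) = (if var_odd n v then {v} else {})"
  by (auto simp: odd_supp_def supp_def)

lemma ps_homog_var: "ps_homog n (var_odd n v) (ps_var v)"
proof (rule ps_homogI)
  fix m assume "mono_odd n m \<noteq> var_odd n v"
  then have "m \<noteq> (\<lambda>u. if u = v then 1 else 0)"
    unfolding mono_odd_eq using odd_supp_single[of n v] by auto
  then show "ps_var v m = 0" by (simp add: ps_var_def)
qed

lemma ps_homog_closed:
  "ps_homog n p F \<Longrightarrow> ps_homog n p G \<Longrightarrow> ps_homog n p (ps_add F G)"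
  "ps_homog n p F \<Longrightarrow> ps_homog n p G \<Longrightarrow> ps_homog n p (ps_sub F G)"
  "ps_homog n p F \<Longrightarrow> ps_homog n p (ps_smult c F)"
  "ps_homog n p F \<Longrightarrow> ps_homog n p (ps_conj F)"
  by (rule ps_homogI, simp add: ps_homog_zeroD ps_add_def ps_sub_def ps_smult_def ps_conj_def)+

lemma ps_homog_sum: "(\<And>k. k \<in> K \<Longrightarrow> ps_homog n p (f k)) \<Longrightarrow> ps_homog n p (ps_sum K f)"
  by (rule ps_homogI, unfold ps_sum_def, rule sum.neutral) (blast intro: ps_homog_zeroD)

text \<open>The product over all \<open>n\<close> of the algebras of well-formed series: a type cannot depend on the
  parameter \<open>n\<close> of \<open>ps_mult\<close>, but this one is a ring that contains each of them.\<close>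
typedef sps = "{F :: nat \<Rightarrow> ps. \<forall>n. ps_wf n (F n)}"
  morphisms sps_comp Abs_sps
  by (rule exI[of _ "\<lambda>n. ps_zero"]) simp

setup_lifting type_definition_sps

instantiation sps :: ring_1
begin

lift_definition zero_sps :: sps is "\<lambda>n. ps_zero" by simp
lift_definition one_sps :: sps is "\<lambda>n. ps_one" by simp
lift_definition plus_sps :: "sps \<Rightarrow> sps \<Rightarrow> sps" is "\<lambda>F G n. ps_add (F n) (G n)" by simp
lift_definition minus_sps :: "sps \<Rightarrow> sps \<Rightarrow> sps" is "\<lambda>F G n. ps_sub (F n) (G n)" by simp
lift_definition uminus_sps :: "sps \<Rightarrow> sps" is "\<lambda>F n. ps_smult (-1) (F n)" by simp
lift_definition times_sps :: "sps \<Rightarrow> sps \<Rightarrow> sps" is "\<lambda>F G n. ps_mult n (F n) (G n)" by simp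

instance
proof
  fix a b c :: sps
  show "a + b + c = a + (b + c)" by transfer (simp add: ps_add_def add.assoc)
  show "a + b = b + a" by transfer (simp add: ps_add_def add.commute)
  show "0 + a = a" by transfer (simp add: ps_add_def ps_zero_def)
  show "- a + a = 0" by transfer (simp add: ps_add_def ps_zero_def ps_smult_def)
  show "a - b = a + - b" by transfer (simp add: ps_add_def ps_sub_def ps_smult_def)
  show "a * b * c = a * (b * c)" by transfer (simp add: ps_mult_assoc)
  show "1 * a = a" by transfer (simp add: ps_mult_one_left)
  show "a * 1 = a" by transfer (simp add: ps_mult_one_right)
  show "(a + b) * c = a * c + b * c" by transfer (simp add: ps_mult_add_left)
  show "a * (b + c) = a * b + a * c" by transfer (simp add: ps_mult_add_right)
  show "(0 :: sps) \<noteq> 1" by transfer (auto simp: ps_zero_def ps_one_def fun_eq_iff)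
qed

end

lift_definition sps_homog :: "bool \<Rightarrow> sps \<Rightarrow> bool" is "\<lambda>p F. \<forall>n. ps_homog n p (F n)" .

lemma sps_homog_zero [simp]: "sps_homog p 0"
  by transfer simp

lemma sps_homog_one [simp]: "sps_homog False 1"
  by transfer simp

lemma sps_homog_add: "sps_homog p x \<Longrightarrow> sps_homog p y \<Longrightarrow> sps_homog p (x + y)"
  by transfer (simp add: ps_homog_closed)

lemma sps_homog_diff: "sps_homog p x \<Longrightarrow> sps_homog p y \<Longrightarrow> sps_homog p (x - y)"
  by transfer (simp add: ps_homog_closed)

lemma sps_homog_uminus: "sps_homog p x \<Longrightarrow> sps_homog p (- x)"
  by transfer (simp add: ps_homog_closed)

lemma sps_homog_mult: "sps_homog p x \<Longrightarrow> sps_homog q y \<Longrightarrow> sps_homog (p \<noteq> q) (x * y)"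
  by transfer (blast intro: ps_homog_mult)

lemma sps_homog_sum: "(\<And>k. k \<in> K \<Longrightarrow> sps_homog p (f k)) \<Longrightarrow> sps_homog p (sum f K)"
  by (induction K rule: infinite_finite_induct) (auto intro: sps_homog_add)

lemma sps_even_comm: "sps_homog False x \<Longrightarrow> x * y = y * x"
  by transfer (auto intro: ps_mult_comm_even)

lemma sps_eqI: "(\<And>k. sps_comp x k = sps_comp y k) \<Longrightarrow> x = y"
  by (simp add: sps_comp_inject[symmetric] fun_eq_iff)

lemma sps_odd_anticomm:
  assumes "sps_homog True x" "sps_homog True y"
  shows "x * y = - (y * x)"
proof (rule sps_eqI)
  fix k
  show "sps_comp (x * y) k = sps_comp (- (y * x)) k"
    using ps_mult_swap[of k True "sps_comp y k" True "sps_comp x k"] assms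
    by (simp add: times_sps.rep_eq uminus_sps.rep_eq sps_homog.rep_eq)
qed

text \<open>Anticommutation gives \<open>x * x = - (x * x)\<close>. The class \<open>ring_1\<close>
  does not allow cancelling 2, so the conclusion is drawn from the complex coefficients.\<close>

lemma sps_odd_square: "sps_homog True x \<Longrightarrow> x * x = 0"
proof -
  assume "sps_homog True x"
  then have "x * x = - (x * x)" by (intro sps_odd_anticomm)
  then show "x * x = 0"
  proof transfer
    fix x :: "nat \<Rightarrow> ps"
    assume e: "(\<lambda>n. ps_mult n (x n) (x n)) = (\<lambda>n. ps_smult (- 1) (ps_mult n (x n) (x n)))"
    show "(\<lambda>n. ps_mult n (x n) (x n)) = (\<lambda>n. ps_zero)"
    proof (intro ext)
      fix n w
      have "ps_mult n (x n) (x n) w = - ps_mult n (x n) (x n) w"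
        using fun_cong[OF fun_cong[OF e, of n], of w] by (simp add: ps_smult_def)
      then show "ps_mult n (x n) (x n) w = ps_zero w" by (simp add: ps_zero_def)
    qed
  qed
qed

text \<open>The components other than \<open>n\<close> receive the constant term, which keeps the embedding unital.\<close>
definition emb :: "nat \<Rightarrow> ps \<Rightarrow> sps" where
  "emb n F = Abs_sps (\<lambda>k. if k = n \<and> ps_wf n F then F else ps_smult (F (\<lambda>v. 0)) ps_one)"

lemma sps_comp_emb':
  "sps_comp (emb n F) k = (if k = n \<and> ps_wf n F then F else ps_smult (F (\<lambda>v. 0)) ps_one)"
proof -
  have "ps_wf k (if k = n \<and> ps_wf n F then F else ps_smult (F (\<lambda>v. 0)) ps_one)" for k
    by (cases "k = n \<and> ps_wf n F") auto
  then show ?thesis unfolding emb_def by (subst Abs_sps_inverse) blast+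
qed

lemma sps_comp_emb: "ps_wf n F \<Longrightarrow> sps_comp (emb n F) n = F"
  by (simp add: sps_comp_emb')

text \<open>Identities of series are proved in the ring \<open>sps\<close>, where the algebraic
  rewrite rules are available, and pulled back by this lemma.\<close>

lemma emb_inj:
  assumes "ps_wf n F" "ps_wf n G" "emb n F = emb n G"
  shows "F = G"
  using assms by (metis sps_comp_emb)

lemma ps_smult_one [simp]: "ps_smult 1 F = F"
  by (simp add: ps_smult_def)

lemma ps_smult_smult: "ps_smult a (ps_smult b F) = ps_smult (a * b) F"
  by (simp add: ps_smult_def mult.assoc)

lemma emb_zero [simp]: "emb n ps_zero = 0"
  by (rule sps_eqI) (simp add: sps_comp_emb' zero_sps.rep_eq ps_zero_def ps_smult_def)

lemma emb_one [simp]: "emb n ps_one = 1"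
  by (rule sps_eqI) (simp add: sps_comp_emb' one_sps.rep_eq, simp add: ps_one_def)

lemma emb_add: "ps_wf n F \<Longrightarrow> ps_wf n G \<Longrightarrow> emb n (ps_add F G) = emb n F + emb n G"
  by (rule sps_eqI)
     (simp add: sps_comp_emb' plus_sps.rep_eq, simp add: ps_add_def ps_smult_def distrib_right)

lemma emb_sub: "ps_wf n F \<Longrightarrow> ps_wf n G \<Longrightarrow> emb n (ps_sub F G) = emb n F - emb n G"
  by (rule sps_eqI)
     (simp add: sps_comp_emb' minus_sps.rep_eq, simp add: ps_sub_def ps_smult_def left_diff_distrib)

lemma emb_neg: "ps_wf n F \<Longrightarrow> emb n (ps_smult (-1) F) = - emb n F"
  by (rule sps_eqI)
     (simp add: sps_comp_emb' uminus_sps.rep_eq ps_smult_smult, simp add: ps_smult_def)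

lemma emb_sign: "ps_wf n F \<Longrightarrow> emb n (ps_smult ((-1) ^ k) F) = (-1) ^ k * emb n F"
  by (cases "even k") (simp_all add: emb_neg)

lemma emb_mult: "ps_wf n F \<Longrightarrow> ps_wf n G \<Longrightarrow> emb n (ps_mult n F G) = emb n F * emb n G"
  by (rule sps_eqI)
     (simp add: sps_comp_emb' times_sps.rep_eq ps_mult_const ps_mult_smult_left
       ps_mult_smult_right ps_smult_smult ps_mult_one_left mult.commute)

lemma emb_sum:
  assumes "\<And>k. k \<in> K \<Longrightarrow> ps_wf n (f k)"
  shows "emb n (ps_sum K f) = (\<Sum>k\<in>K. emb n (f k))"
  using assms
proof (induction K rule: infinite_finite_induct)
  case (insert k K)
  have "ps_sum (insert k K) f = ps_add (f k) (ps_sum K f)"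
    using insert by (simp add: ps_sum_def ps_add_def)
  then show ?case using insert by (simp add: emb_add)
qed (auto simp: ps_sum_def ps_zero_def[symmetric])

lemma emb_homog:
  assumes "ps_wf n F" "ps_homog n p F"
  shows "sps_homog p (emb n F)"
proof -
  have "\<not> mono_odd k (\<lambda>v. 0)" for k by (simp add: mono_odd_def)
  then have "ps_homog k p (ps_smult (F (\<lambda>v. 0)) ps_one)" for k
    using assms(2) by (cases p) (auto simp: ps_homog_def ps_smult_def ps_one_def)
  then show ?thesis using assms by (simp add: sps_homog.rep_eq sps_comp_emb')
qed

subsection \<open>Ordered products\<close>

text \<open>The counterpart of \<open>ps_monopow\<close> in an arbitrary ring. The list may exceed
  the support of \<open>m\<close>, since exponent 0 contributes the factor 1; so one list can serve
  all monomials.\<close>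

definition oprod :: "('v \<Rightarrow> 'a :: ring_1) \<Rightarrow> 'v list \<Rightarrow> ('v \<Rightarrow> nat) \<Rightarrow> 'a" where
  "oprod g L m = prod_list (map (\<lambda>v. g v ^ m v) L)"

lemma oprod_simps [simp]:
  "oprod g [] m = 1" "oprod g (v # L) m = g v ^ m v * oprod g L m"
  by (simp_all add: oprod_def)

definition odd_weight :: "('v \<Rightarrow> bool) \<Rightarrow> 'v list \<Rightarrow> ('v \<Rightarrow> nat) \<Rightarrow> nat" where
  "odd_weight od L m = sum_list (map (\<lambda>v. of_bool (od v) * m v) L)"

lemma odd_weight_simps [simp]:
  "odd_weight od [] m = 0"
  "odd_weight od (v # L) m = of_bool (od v) * m v + odd_weight od L m"
  by (simp_all add: odd_weight_def)

text \<open>Exponent of the sign that appears when the ordered products for \<open>a\<close> and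
  \<open>b\<close> are merged: the head's power from \<open>b\<close> crosses all odd factors of
  \<open>a\<close> in the tail. Factors are counted with multiplicity, so the formula is valid
  before odd exponents are known to be at most 1.\<close>

primrec list_inversions :: "('v \<Rightarrow> bool) \<Rightarrow> 'v list \<Rightarrow> ('v \<Rightarrow> nat) \<Rightarrow> ('v \<Rightarrow> nat) \<Rightarrow> nat" where
  "list_inversions od [] a b = 0"
| "list_inversions od (v # L) a b = of_bool (od v) * b v * odd_weight od L a + list_inversions od L a b"

lemma sign_central: "(-1) ^ k * (x :: 'a :: ring_1) = x * (-1) ^ k"
  by (cases "even k") simp_all

lemma sign_commuting_powers:
  fixes x y :: "'a :: ring_1"
  assumes "x * y = (-1) ^ k * (y * x)"
  shows "x ^ a * y ^ b = (-1) ^ (k * a * b) * (y ^ b * x ^ a)"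
proof -
  have 1: "x * y ^ b = (-1) ^ (k * b) * (y ^ b * x)" for b
  proof (induction b)
    case (Suc b)
    have "x * y ^ Suc b = (x * y) * y ^ b" by (simp add: mult.assoc)
    also have "\<dots> = (-1) ^ k * y * (x * y ^ b)" by (simp add: assms mult.assoc)
    also have "\<dots> = (-1) ^ k * (y * (-1) ^ (k * b)) * (y ^ b * x)" by (simp add: Suc mult.assoc)
    also have "\<dots> = (-1) ^ (k * Suc b) * (y ^ Suc b * x)"
      by (simp add: sign_central[of "k * b" y, symmetric] power_add mult.assoc)
    finally show ?case .
  qed simp
  show ?thesis
  proof (induction a)
    case (Suc a)
    have "x ^ Suc a * y ^ b = x * (x ^ a * y ^ b)" by (simp add: mult.assoc)
    also have "\<dots> = (x * (-1) ^ (k * a * b)) * (y ^ b * x ^ a)" by (simp add: Suc mult.assoc)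
    also have "\<dots> = (-1) ^ (k * a * b) * ((x * y ^ b) * x ^ a)"
      by (subst sign_central[of "k * a * b" x, symmetric]) (simp add: mult.assoc)
    also have "\<dots> = (-1) ^ (k * a * b) * (-1) ^ (k * b) * (y ^ b * x ^ Suc a)"
      by (simp add: 1 mult.assoc)
    also have "\<dots> = (-1) ^ (k * Suc a * b) * (y ^ b * x ^ Suc a)"
      by (simp only: power_add[symmetric]) (simp add: algebra_simps)
    finally show ?case .
  qed simp
qed

text \<open>The square condition is separate because anticommutation only yields that twice the
  square is 0, and \<open>'a\<close> may have 2-torsion.\<close>

locale supercommuting =
  fixes V :: "'v set" and od :: "'v \<Rightarrow> bool" and g :: "'v \<Rightarrow> 'a :: ring_1"
  assumes swap: "u \<in> V \<Longrightarrow> v \<in> V \<Longrightarrow> g u * g v = (-1) ^ (of_bool (od u) * of_bool (od v)) * (g v * g u)"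
    and odd_square: "v \<in> V \<Longrightarrow> od v \<Longrightarrow> g v * g v = 0"
begin

lemma oprod_power_commute:
  assumes "set L \<subseteq> V" "v \<in> V"
  shows "oprod g L m * g v ^ b
       = (-1) ^ (of_bool (od v) * b * odd_weight od L m) * (g v ^ b * oprod g L m)"
  using assms(1)
proof (induction L)
  case (Cons u L)
  let ?s = "\<lambda>k. (-1 :: 'a) ^ k"
  let ?k = "of_bool (od v) * b * odd_weight od L m"
  let ?l = "of_bool (od u) * of_bool (od v) * m u * b"
  have "oprod g (u # L) m * g v ^ b = g u ^ m u * (oprod g L m * g v ^ b)"
    by (simp add: mult.assoc)
  also have "\<dots> = (g u ^ m u * ?s ?k) * (g v ^ b * oprod g L m)"
    using Cons by (simp add: mult.assoc)
  also have "\<dots> = ?s ?k * ((g u ^ m u * g v ^ b) * oprod g L m)"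
    by (subst sign_central[of ?k "g u ^ m u", symmetric]) (simp add: mult.assoc)
  also have "g u ^ m u * g v ^ b = ?s ?l * (g v ^ b * g u ^ m u)"
    by (rule sign_commuting_powers) (use swap[of u v] Cons.prems assms(2) in simp)
  also have "?s ?k * (?s ?l * (g v ^ b * g u ^ m u) * oprod g L m)
      = ?s (?k + ?l) * (g v ^ b * oprod g (u # L) m)"
    by (simp add: power_add mult.assoc)
  also have "?k + ?l = of_bool (od v) * b * odd_weight od (u # L) m"
    by (simp add: algebra_simps)
  finally show ?case .
qed simp

text \<open>Induction on the list: the head's power in the second product moves left past the tail
  of the first, which costs one sign and leaves two products over the shorter list.\<close>

lemma oprod_mult:
  assumes "set L \<subseteq> V"
  shows "oprod g L a * oprod g L b = (-1) ^ list_inversions od L a b * oprod g L (\<lambda>v. a v + b v)"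
  using assms
proof (induction L)
  case (Cons v L)
  let ?s = "\<lambda>k. (-1 :: 'a) ^ k"
  let ?k = "of_bool (od v) * b v * odd_weight od L a"
  have "oprod g (v # L) a * oprod g (v # L) b
      = g v ^ a v * (oprod g L a * g v ^ b v) * oprod g L b"
    by (simp add: mult.assoc)
  also have "oprod g L a * g v ^ b v = ?s ?k * (g v ^ b v * oprod g L a)"
    using Cons.prems by (intro oprod_power_commute) auto
  also have "g v ^ a v * (?s ?k * (g v ^ b v * oprod g L a)) * oprod g L b
      = (g v ^ a v * ?s ?k) * g v ^ b v * (oprod g L a * oprod g L b)"
    by (simp add: mult.assoc)
  also have "g v ^ a v * ?s ?k = ?s ?k * g v ^ a v"
    by (rule sign_central[symmetric])
  also have "oprod g L a * oprod g L b = ?s (list_inversions od L a b) * oprod g L (\<lambda>v. a v + b v)"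
    using Cons by simp
  also have "?s ?k * g v ^ a v * g v ^ b v * (?s (list_inversions od L a b) * oprod g L (\<lambda>v. a v + b v))
      = ?s ?k * (g v ^ (a v + b v) * ?s (list_inversions od L a b)) * oprod g L (\<lambda>v. a v + b v)"
    by (simp add: power_add mult.assoc)
  also have "\<dots> = ?s (list_inversions od (v # L) a b) * oprod g (v # L) (\<lambda>v. a v + b v)"
    by (subst sign_central[of "list_inversions od L a b" "g v ^ (a v + b v)", symmetric])
       (simp add: power_add mult.assoc)
  finally show ?case .
qed simp

lemma oprod_eq_0:
  assumes "set L \<subseteq> V" "v \<in> set L" "od v" "m v > 1"
  shows "oprod g L m = 0"
  using assms
proof (induction L)
  case (Cons u L)
  show ?case
  proof (cases "u = v")
    case True
    then have "m u = Suc (Suc (m u - 2))" using Cons.prems(4) by simp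
    then have "g u ^ m u = (g u * g u) * g u ^ (m u - 2)" by (metis mult.assoc power_Suc)
    also have "g u * g u = 0" using Cons.prems True by (intro odd_square) auto
    finally show ?thesis by simp
  qed (use Cons in auto)
qed simp

end

lemma odd_weight_eq_card:
  assumes "distinct L" "\<And>v. v \<in> set L \<Longrightarrow> od v \<Longrightarrow> a v \<le> 1"
  shows "odd_weight od L a = card {v \<in> set L. od v \<and> a v \<noteq> 0}"
  using assms
proof (induction L)
  case (Cons v L)
  let ?A = "{v \<in> set L. od v \<and> a v \<noteq> 0}"
  have "{u \<in> set (v # L). od u \<and> a u \<noteq> 0} = (if od v \<and> a v \<noteq> 0 then insert v ?A else ?A)"
    by auto
  moreover have "od v \<Longrightarrow> a v = 0 \<or> a v = 1" using Cons.prems(2)[of v] by (simp add: le_Suc_eq)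
  moreover have "odd_weight od L a = card ?A" using Cons by simp
  ultimately show ?case using Cons.prems(1) by (auto simp: of_bool_def)
qed simp

text \<open>Links the recursive exponent to the count in \<open>mono_sign\<close>. In a strictly
  increasing list the head is the smaller member of its inversions and never the larger one, so the
  new inversions pair it with the odd factors of \<open>a\<close> in the tail.\<close>

lemma list_inversions_eq_card:
  fixes L :: "'v :: linorder list"
  assumes "sorted_wrt (<) L"
    and "\<And>v. v \<in> set L \<Longrightarrow> od v \<Longrightarrow> a v \<le> 1" "\<And>v. v \<in> set L \<Longrightarrow> od v \<Longrightarrow> b v \<le> 1"
  shows "list_inversions od L a b
       = card {(x, y). x \<in> {v \<in> set L. od v \<and> a v \<noteq> 0} \<and> y \<in> {v \<in> set L. od v \<and> b v \<noteq> 0} \<and> y < x}"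
  using assms
proof (induction L)
  case (Cons v L)
  let ?A = "\<lambda>L. {v \<in> set L. od v \<and> a v \<noteq> 0}" and ?B = "\<lambda>L. {v \<in> set L. od v \<and> b v \<noteq> 0}"
  let ?I = "\<lambda>L. {(x, y). x \<in> ?A L \<and> y \<in> ?B L \<and> y < x}"
  have lt: "\<And>u. u \<in> set L \<Longrightarrow> v < u" and dist: "distinct L" using Cons.prems(1)
    by (auto simp: strict_sorted_iff)
  have b: "od v \<Longrightarrow> b v = 0 \<or> b v = 1" using Cons.prems(3)[of v] by (simp add: le_Suc_eq)
  have I: "?I (v # L) = (if od v \<and> b v \<noteq> 0 then (\<lambda>x. (x, v)) ` ?A L else {}) \<union> ?I L" (is "_ = ?X \<union> _")
  proof -
    have nlt: "\<not> u < v" "u \<noteq> v" "v \<noteq> u" if "u \<in> set L" for u using lt[OF that] by auto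
    have "(x, y) \<in> ?I (v # L) \<longleftrightarrow> (x, y) \<in> ?X \<union> ?I L" for x y
      by (cases "x = v"; cases "y = v") (auto simp: image_iff nlt lt)
    then show ?thesis unfolding set_eq_iff split_paired_All by (intro allI)
  qed
  have "finite (?I L)" by (rule finite_subset[of _ "set L \<times> set L"]) auto
  moreover have "?X \<inter> ?I L = {}" using lt by auto
  ultimately have "card (?I (v # L)) = card ?X + card (?I L)"
    unfolding I by (intro card_Un_disjoint) auto
  moreover have "card ?X = of_bool (od v) * b v * odd_weight od L a"
  proof -
    have "card ((\<lambda>x. (x, v)) ` ?A L) = card (?A L)" by (intro card_image) (auto simp: inj_on_def)
    moreover have "odd_weight od L a = card (?A L)"
      by (rule odd_weight_eq_card[OF dist]) (use Cons.prems(2) in auto)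
    ultimately show ?thesis using b by auto
  qed
  moreover have "list_inversions od L a b = card (?I L)" using Cons by simp
  ultimately show ?case by simp
qed simp

subsection \<open>Homomorphisms and substitution\<close>

text \<open>Compatibility with scalars is left out on purpose: conjugation and \<open>sigma\<close>
  are antilinear and should be covered. Signs are still respected, by
  \<open>ps_hom_neg\<close>.\<close>

definition ps_hom :: "nat \<Rightarrow> (ps \<Rightarrow> ps) \<Rightarrow> bool" where
  "ps_hom n \<phi> \<longleftrightarrow> (\<forall>F. ps_wf n F \<longrightarrow> ps_wf n (\<phi> F)) \<and> \<phi> ps_one = ps_one
     \<and> (\<forall>F G. ps_wf n F \<longrightarrow> ps_wf n G \<longrightarrow> \<phi> (ps_add F G) = ps_add (\<phi> F) (\<phi> G))
     \<and> (\<forall>F G. ps_wf n F \<longrightarrow> ps_wf n G \<longrightarrow> \<phi> (ps_mult n F G) = ps_mult n (\<phi> F) (\<phi> G))"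

lemma ps_homD:
  assumes "ps_hom n \<phi>"
  shows "ps_wf n F \<Longrightarrow> ps_wf n (\<phi> F)" "\<phi> ps_one = ps_one"
    "ps_wf n F \<Longrightarrow> ps_wf n G \<Longrightarrow> \<phi> (ps_add F G) = ps_add (\<phi> F) (\<phi> G)"
    "ps_wf n F \<Longrightarrow> ps_wf n G \<Longrightarrow> \<phi> (ps_mult n F G) = ps_mult n (\<phi> F) (\<phi> G)"
  using assms unfolding ps_hom_def by blast+

lemma ps_hom_zero:
  assumes "ps_hom n \<phi>"
  shows "\<phi> ps_zero = ps_zero"
proof -
  have "ps_add ps_zero ps_zero = ps_zero" by (simp add: ps_add_def ps_zero_def)
  then have "\<phi> ps_zero = ps_add (\<phi> ps_zero) (\<phi> ps_zero)"
    using ps_homD(3)[OF assms, of ps_zero ps_zero] by simp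
  then have "\<phi> ps_zero w = \<phi> ps_zero w + \<phi> ps_zero w" for w
    unfolding ps_add_def by meson
  then show ?thesis by (simp add: ps_zero_def fun_eq_iff)
qed

lemma ps_hom_sub:
  assumes "ps_hom n \<phi>" "ps_wf n F" "ps_wf n G"
  shows "\<phi> (ps_sub F G) = ps_sub (\<phi> F) (\<phi> G)"
proof -
  have "F = ps_add (ps_sub F G) G" by (simp add: ps_add_def ps_sub_def)
  then have "\<phi> F = ps_add (\<phi> (ps_sub F G)) (\<phi> G)"
    using ps_homD(3)[OF assms(1), of "ps_sub F G" G] assms by simp
  then show ?thesis by (simp add: ps_add_def ps_sub_def)
qed

lemma ps_neg_eq: "ps_smult (-1) F = ps_sub ps_zero F"
  by (simp add: ps_smult_def ps_sub_def ps_zero_def)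

lemma ps_hom_neg:
  assumes "ps_hom n \<phi>" "ps_wf n F"
  shows "\<phi> (ps_smult (-1) F) = ps_smult (-1) (\<phi> F)"
  using assms by (simp add: ps_neg_eq ps_hom_sub ps_hom_zero)

lemma ps_sum_empty [simp]: "ps_sum {} f = ps_zero"
  by (simp add: ps_sum_def ps_zero_def)

lemma ps_sum_insert: "finite K \<Longrightarrow> k \<notin> K \<Longrightarrow> ps_sum (insert k K) f = ps_add (f k) (ps_sum K f)"
  by (simp add: ps_sum_def ps_add_def)

lemma ps_hom_sum:
  assumes "ps_hom n \<phi>" "finite K" "\<And>k. k \<in> K \<Longrightarrow> ps_wf n (f k)"
  shows "\<phi> (ps_sum K f) = ps_sum K (\<lambda>k. \<phi> (f k))"
  using assms(2,3)
proof (induction K rule: finite_induct)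
  case empty
  then show ?case by (simp add: ps_hom_zero[OF assms(1)])
next
  case (insert k K)
  then show ?case by (simp add: ps_sum_insert ps_homD(3)[OF assms(1)])
qed

lemma ps_wf_pow [simp]: "ps_wf n (ps_pow n F k)"
  by (cases k) simp_all

lemma ps_hom_pow:
  assumes "ps_hom n \<phi>" "ps_wf n F"
  shows "\<phi> (ps_pow n F k) = ps_pow n (\<phi> F) k"
  using assms(2) by (induction k) (simp_all add: ps_homD[OF assms(1)])

text \<open>\<open>ps_monopow\<close> along a free list, so that induction over the list becomes
  possible.\<close>

definition list_monopow :: "nat \<Rightarrow> (var \<Rightarrow> ps) \<Rightarrow> mono \<Rightarrow> var list \<Rightarrow> ps" where
  "list_monopow n g m L = foldr (\<lambda>v acc. ps_mult n (ps_pow n (g v) (m v)) acc) L ps_one"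

lemma list_monopow_simps [simp]:
  "list_monopow n g m [] = ps_one"
  "list_monopow n g m (v # L) = ps_mult n (ps_pow n (g v) (m v)) (list_monopow n g m L)"
  by (simp_all add: list_monopow_def)

lemma ps_monopow_list: "ps_monopow n g m = list_monopow n g m (sorted_list_of_set (supp m))"
  by (simp add: ps_monopow_def list_monopow_def)

lemma list_monopow_wf [simp]: "ps_wf n (list_monopow n g m L)"
  by (cases L) simp_all

lemma ps_monopow_wf [simp]: "ps_wf n (ps_monopow n g m)"
  by (simp add: ps_monopow_list)

lemma ps_hom_list_monopow:
  assumes "ps_hom n \<phi>" "\<And>v. v \<in> set L \<Longrightarrow> ps_wf n (g v)"
  shows "\<phi> (list_monopow n g m L) = list_monopow n (\<lambda>v. \<phi> (g v)) m L"
  using assms(2)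
  by (induction L) (simp_all add: ps_homD[OF assms(1)] ps_hom_pow[OF assms(1)])

lemma list_monopow_cong:
  "(\<And>v. v \<in> set L \<Longrightarrow> g v = h v) \<Longrightarrow> list_monopow n g m L = list_monopow n h m L"
  by (induction L) simp_all

lemma set_sorted_list_of_supp: "valid_mono n m \<Longrightarrow> set (sorted_list_of_set (supp m)) = supp m"
  by (simp add: valid_mono_def)

lemma ps_hom_monopow:
  assumes "ps_hom n \<phi>" "valid_mono n m" "\<And>v. v \<in> supp m \<Longrightarrow> ps_wf n (g v)"
  shows "\<phi> (ps_monopow n g m) = ps_monopow n (\<lambda>v. \<phi> (g v)) m"
  unfolding ps_monopow_list
  by (rule ps_hom_list_monopow[OF assms(1)]) (simp add: set_sorted_list_of_supp[OF assms(2)] assms(3))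

lemma ps_monopow_cong:
  assumes "valid_mono n m" "\<And>v. v \<in> supp m \<Longrightarrow> g v = h v"
  shows "ps_monopow n g m = ps_monopow n h m"
  unfolding ps_monopow_list
  by (rule list_monopow_cong) (simp add: set_sorted_list_of_supp[OF assms(1)] assms(2))

lemma ps_monopow_zero [simp]: "ps_monopow n g (\<lambda>v. 0) = ps_one"
  by (simp add: ps_monopow_list)

lemma emb_pow: "ps_wf n F \<Longrightarrow> emb n (ps_pow n F k) = emb n F ^ k"
  by (induction k) (simp_all add: emb_mult)

lemma emb_list_monopow:
  assumes "\<And>v. v \<in> set L \<Longrightarrow> ps_wf n (g v)"
  shows "emb n (list_monopow n g m L) = oprod (\<lambda>v. emb n (g v)) L m"
  using assms by (induction L) (simp_all add: emb_mult emb_pow)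

lemma oprod_filter: "oprod g (filter (\<lambda>v. m v \<noteq> 0) L) m = oprod g L m"
  by (induction L) simp_all

text \<open>Passing from the support of \<open>m\<close> to all of \<open>V\<close> inserts only
  factors with exponent 0. All monomials are thereby written along one common list, the form that
  \<open>oprod_mult\<close> requires.\<close>

lemma emb_monopow:
  assumes "finite V" "\<And>v. v \<in> V \<Longrightarrow> ps_wf n (g v)" "supp m \<subseteq> V"
  shows "emb n (ps_monopow n g m) = oprod (\<lambda>v. emb n (g v)) (sorted_list_of_set V) m"
proof -
  let ?L = "sorted_list_of_set V"
  have f: "finite (supp m)" using assms finite_subset by blast
  have "set (filter (\<lambda>v. m v \<noteq> 0) ?L) = supp m"
    using assms(1,3) by (auto simp: supp_def)
  moreover have "sorted_wrt (<) (filter (\<lambda>v. m v \<noteq> 0) ?L)"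
    by (intro sorted_wrt_filter) simp
  ultimately have "filter (\<lambda>v. m v \<noteq> 0) ?L = sorted_list_of_set (supp m)"
    using f by (metis sorted_list_of_set.idem_if_sorted_distinct strict_sorted_iff)
  then show ?thesis
    unfolding ps_monopow_list
    using emb_list_monopow[of "sorted_list_of_set (supp m)" n g m] assms(2,3) f oprod_filter[of "\<lambda>v. emb n (g v)" m ?L]
    by (simp add: subset_iff)
qed

text \<open>Finiteness of \<open>V\<close> leaves finitely many monomials in each degree, the
  vanishing constant terms make the substitution converge, and preserved parity makes the images
  supercommute.\<close>

definition subst_ok :: "nat \<Rightarrow> var set \<Rightarrow> (var \<Rightarrow> ps) \<Rightarrow> bool" where
  "subst_ok n V g \<longleftrightarrow> finite V \<and>
     (\<forall>v\<in>V. ps_wf n (g v) \<and> g v (\<lambda>u. 0) = 0 \<and> ps_homog n (var_odd n v) (g v))"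

lemma subst_okD:
  assumes "subst_ok n V g"
  shows "finite V" "v \<in> V \<Longrightarrow> ps_wf n (g v)" "v \<in> V \<Longrightarrow> g v (\<lambda>u. 0) = 0"
    "v \<in> V \<Longrightarrow> ps_homog n (var_odd n v) (g v)"
  using assms unfolding subst_ok_def by blast+

lemma sps_swap:
  assumes "sps_homog p x" "sps_homog q y"
  shows "x * y = (-1) ^ (of_bool p * of_bool q) * (y * x)"
proof (cases "p \<and> q")
  case True
  then show ?thesis using sps_odd_anticomm[of x y] assms by simp
next
  case False
  then show ?thesis using sps_even_comm[of x y] sps_even_comm[of y x] assms
    by (cases p; cases q) simp_all
qed

lemma supercommuting_subst:
  assumes "subst_ok n V g"
  shows "supercommuting V (var_odd n) (\<lambda>v. emb n (g v))"
proof
  fix u v assume "u \<in> V" "v \<in> V"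
  then show "emb n (g u) * emb n (g v)
      = (-1) ^ (of_bool (var_odd n u) * of_bool (var_odd n v)) * (emb n (g v) * emb n (g u))"
    by (intro sps_swap emb_homog subst_okD[OF assms])
next
  fix v assume "v \<in> V" "var_odd n v"
  then show "emb n (g v) * emb n (g v) = 0"
    using emb_homog[of n "g v" "var_odd n v"] subst_okD(2,4)[OF assms, of v]
    by (intro sps_odd_square) simp
qed

text \<open>Ordered products of the images multiply like the basis monomials. If the exponents add
  up to an inadmissible monomial, some odd generator occurs twice and its image squares to zero, in
  agreement with the cut-off in \<open>ps_mult\<close>.\<close>

lemma monopow_mult:
  assumes "subst_ok n V g" "valid_mono n a" "valid_mono n b" "supp a \<subseteq> V" "supp b \<subseteq> V"
  shows "ps_mult n (ps_monopow n g a) (ps_monopow n g b) = (if valid_mono n (\<lambda>v. a v + b v)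
    then ps_smult (mono_sign n a b) (ps_monopow n g (\<lambda>v. a v + b v)) else ps_zero)"
proof -
  interpret supercommuting V "var_odd n" "\<lambda>v. emb n (g v)"
    by (rule supercommuting_subst[OF assms(1)])
  let ?L = "sorted_list_of_set V" and ?c = "\<lambda>v. a v + b v"
  have fin: "finite V" and wf: "\<And>v. v \<in> V \<Longrightarrow> ps_wf n (g v)" using subst_okD[OF assms(1)] by blast+
  have sL: "set ?L = V" using fin by simp
  have c: "supp ?c \<subseteq> V" using assms(4,5) by (simp add: supp_add)
  have E: "emb n (ps_mult n (ps_monopow n g a) (ps_monopow n g b))
      = (-1) ^ list_inversions (var_odd n) ?L a b * oprod (\<lambda>v. emb n (g v)) ?L ?c"
    using oprod_mult[of ?L a b] sL
    by (simp add: emb_mult emb_monopow[OF fin wf] assms(4,5))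
  show ?thesis
  proof (cases "valid_mono n ?c")
    case True
    have "list_inversions (var_odd n) ?L a b = card {(x, y). x \<in> {v \<in> set ?L. var_odd n v \<and> a v \<noteq> 0}
        \<and> y \<in> {v \<in> set ?L. var_odd n v \<and> b v \<noteq> 0} \<and> y < x}"
      by (rule list_inversions_eq_card) (use assms(2,3) in \<open>auto simp: valid_mono_def\<close>)
    also have "{v \<in> set ?L. var_odd n v \<and> a v \<noteq> 0} = odd_supp n a"
      unfolding sL using assms(4) by (auto simp: odd_supp_def supp_def)
    also have "{v \<in> set ?L. var_odd n v \<and> b v \<noteq> 0} = odd_supp n b"
      unfolding sL using assms(5) by (auto simp: odd_supp_def supp_def)
    also have "{(x, y). x \<in> odd_supp n a \<and> y \<in> odd_supp n b \<and> y < x} = inv_pairs n a b"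
      unfolding inv_pairs_def by blast
    finally have "emb n (ps_mult n (ps_monopow n g a) (ps_monopow n g b))
        = emb n (ps_smult (mono_sign n a b) (ps_monopow n g ?c))"
      using E by (simp add: emb_sign mono_sign_eq emb_monopow[OF fin wf c])
    then have "ps_mult n (ps_monopow n g a) (ps_monopow n g b)
        = ps_smult (mono_sign n a b) (ps_monopow n g ?c)"
      by (rule emb_inj[rotated 2]) simp_all
    then show ?thesis using True by simp
  next
    case False
    then obtain v where "var_odd n v" "a v + b v > 1"
      using assms(2,3) unfolding valid_mono_def supp_add by (meson finite_Un not_le)
    moreover from this have "v \<in> V" using c by (auto simp: supp_def)
    ultimately have "oprod (\<lambda>v. emb n (g v)) ?L ?c = 0"
      by (intro oprod_eq_0[where v = v]) (simp_all add: sL)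
    then have "emb n (ps_mult n (ps_monopow n g a) (ps_monopow n g b)) = emb n ps_zero"
      using E by simp
    then have "ps_mult n (ps_monopow n g a) (ps_monopow n g b) = ps_zero"
      by (rule emb_inj[rotated 2]) simp_all
    then show ?thesis using False by simp
  qed
qed

section \<open>Order filtration, truncation and the homomorphism property of substitution\<close>

definition ord_ge :: "nat \<Rightarrow> ps \<Rightarrow> bool" where
  "ord_ge k F \<longleftrightarrow> (\<forall>w. mono_deg w < k \<longrightarrow> F w = 0)"

lemma ord_ge_0 [simp]: "ord_ge 0 F"
  by (simp add: ord_ge_def)

lemma ord_ge_mult:
  assumes "ord_ge k F" "ord_ge l G"
  shows "ord_ge (k + l) (ps_mult n F G)"
  unfolding ord_ge_def
proof (intro allI impI)
  fix w assume w: "mono_deg w < k + l"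
  show "ps_mult n F G w = 0"
  proof (cases "valid_mono n w")
    case True
    have "mono_sign n a b * F a * G b = 0" if "(a, b) \<in> splits w" for a b
    proof -
      have "mono_deg a < k \<or> mono_deg b < l" using splits_deg[OF True that] w by linarith
      then show ?thesis using assms unfolding ord_ge_def by auto
    qed
    then show ?thesis unfolding ps_mult_valid[OF True] by (intro sum.neutral) auto
  qed (simp add: ps_mult_def)
qed

lemma ord_ge_pow:
  assumes "ord_ge 1 F"
  shows "ord_ge k (ps_pow n F k)"
proof (induction k)
  case (Suc k)
  then show ?case using ord_ge_mult[OF assms Suc] by simp
qed simp

lemma ord_ge_list_monopow:
  assumes "\<And>v. v \<in> set L \<Longrightarrow> ord_ge 1 (g v)"
  shows "ord_ge (sum_list (map m L)) (list_monopow n g m L)"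
  using assms
proof (induction L)
  case (Cons v L)
  then have "ord_ge (m v + sum_list (map m L)) (list_monopow n g m (v # L))"
    unfolding list_monopow_simps by (intro ord_ge_mult ord_ge_pow) simp_all
  then show ?case by simp
qed simp

lemma ord_ge_1I:
  assumes "ps_wf n F" "F (\<lambda>v. 0) = 0"
  shows "ord_ge 1 F"
  unfolding ord_ge_def
proof (intro allI impI)
  fix w :: mono assume "mono_deg w < 1"
  then show "F w = 0"
    using assms mono_deg_0_iff[of w] by (cases "valid_mono n w") (auto simp: ps_wf_def valid_mono_def)
qed

text \<open>Each image has order at least 1, so a product of \<open>mono_deg m\<close> images starts
  in degree \<open>mono_deg m\<close>. This is why the truncated sum in \<open>ps_subst\<close> is
  the full one.\<close>

lemma monopow_eq_0:
  assumes "subst_ok n V g" "valid_mono n m" "supp m \<subseteq> V" "mono_deg w < mono_deg m"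
  shows "ps_monopow n g m w = 0"
proof -
  have f: "finite (supp m)" using assms(2) by (simp add: valid_mono_def)
  have "ord_ge (sum_list (map m (sorted_list_of_set (supp m)))) (ps_monopow n g m)"
    unfolding ps_monopow_list
  proof (rule ord_ge_list_monopow)
    fix v assume "v \<in> set (sorted_list_of_set (supp m))"
    then have "v \<in> V" using f assms(3) by auto
    then show "ord_ge 1 (g v)" using subst_okD[OF assms(1)] by (intro ord_ge_1I)
  qed
  moreover have "sum_list (map m (sorted_list_of_set (supp m))) = mono_deg m"
    using f by (simp add: mono_deg_def sum_list_distinct_conv_sum_set)
  ultimately show ?thesis using assms(4) by (simp add: ord_ge_def)
qed

definition monos_upto :: "nat \<Rightarrow> var set \<Rightarrow> nat \<Rightarrow> mono set" where
  "monos_upto n V d = {m. valid_mono n m \<and> supp m \<subseteq> V \<and> mono_deg m \<le> d}"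

lemma finite_monos_upto: "finite V \<Longrightarrow> finite (monos_upto n V d)"
  by (rule finite_subset[OF _ finite_monos_bounded[of V d]])
     (auto simp: monos_upto_def valid_mono_def intro: order_trans[OF mono_deg_ge])

text \<open>The cut-off can be raised to any common \<open>d\<close>, as the extra monomials
  contribute 0. One finite index set then serves all coefficients of degree up to
  \<open>d\<close>.\<close>

lemma ps_subst_eq:
  assumes "subst_ok n V g" "mono_deg w \<le> d"
  shows "ps_subst n V g F w = (\<Sum>m\<in>monos_upto n V d. F m * ps_monopow n g m w)"
  unfolding ps_subst_def monos_upto_def[symmetric]
proof (rule sum.mono_neutral_left)
  show "finite (monos_upto n V d)" using subst_okD(1)[OF assms(1)] by (rule finite_monos_upto)
  show "monos_upto n V (mono_deg w) \<subseteq> monos_upto n V d" using assms(2) by (auto simp: monos_upto_def)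
  show "\<forall>m\<in>monos_upto n V d - monos_upto n V (mono_deg w). F m * ps_monopow n g m w = 0"
    using monopow_eq_0[OF assms(1), of _ w] by (force simp: monos_upto_def not_le)
qed

lemma ps_subst_wf [simp]: "ps_wf n (ps_subst n V g F)"
  using ps_monopow_wf unfolding ps_wf_def ps_subst_def by simp

lemma ps_subst_add: "ps_subst n V g (ps_add F G) = ps_add (ps_subst n V g F) (ps_subst n V g G)"
  by (rule ext) (simp add: ps_subst_def ps_add_def distrib_right sum.distrib)

lemma ps_subst_smult: "ps_subst n V g (ps_smult c F) = ps_smult c (ps_subst n V g F)"
  by (rule ext) (simp add: ps_subst_def ps_smult_def sum_distrib_left mult.assoc)

lemma ps_subst_cong:
  assumes "\<And>v. v \<in> V \<Longrightarrow> g v = h v"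
  shows "ps_subst n V g F = ps_subst n V h F"
proof (rule ext)
  fix w
  have "ps_monopow n g m = ps_monopow n h m" if "valid_mono n m" "supp m \<subseteq> V" for m
    using that(1) by (rule ps_monopow_cong) (use that(2) assms in blast)
  then show "ps_subst n V g F w = ps_subst n V h F w"
    unfolding ps_subst_def by (intro sum.cong refl) simp
qed

text \<open>At a fixed coefficient all sums can be truncated at its degree. Exchanging them reduces
  the claim to products of two monomials, which \<open>monopow_mult\<close> evaluates; the pairs are
  then regrouped by their sum.\<close>

lemma ps_subst_mult:
  assumes ok: "subst_ok n V g"
  shows "ps_subst n V g (ps_mult n F G) = ps_mult n (ps_subst n V g F) (ps_subst n V g G)"
proof (rule ps_eqI[where n = n])
  fix w assume w: "valid_mono n w"
  define d where "d = mono_deg w"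
  let ?M = "monos_upto n V d" and ?mp = "ps_monopow n g"
  have fM: "finite ?M" using subst_okD(1)[OF ok] by (rule finite_monos_upto)
  have sub: "ps_subst n V g H u = (\<Sum>m\<in>?M. H m * ?mp m u)" if "mono_deg u \<le> d" for H u
    using ps_subst_eq[OF ok that] .
  have deg: "mono_deg (fst x) \<le> d" "mono_deg (snd x) \<le> d" if "x \<in> splits w" for x
    using splits_deg[OF w, of "fst x" "snd x"] that by (simp_all add: d_def)
  define t where "t a b = (if valid_mono n (\<lambda>v. a v + b v)
      then F a * G b * mono_sign n a b * ?mp (\<lambda>v. a v + b v) w else 0)" for a b
  have "ps_mult n (ps_subst n V g F) (ps_subst n V g G) w
      = (\<Sum>x\<in>splits w. mono_sign n (fst x) (snd x) * (\<Sum>a\<in>?M. F a * ?mp a (fst x)) * (\<Sum>b\<in>?M. G b * ?mp b (snd x)))"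
    unfolding ps_mult_alt using w by (simp add: sub deg)
  also have "\<dots> = (\<Sum>x\<in>splits w. \<Sum>a\<in>?M. \<Sum>b\<in>?M.
      F a * G b * (mono_sign n (fst x) (snd x) * ?mp a (fst x) * ?mp b (snd x)))"
    by (simp add: sum_distrib_left sum_distrib_right mult_ac)
  also have "\<dots> = (\<Sum>a\<in>?M. \<Sum>b\<in>?M. \<Sum>x\<in>splits w.
      F a * G b * (mono_sign n (fst x) (snd x) * ?mp a (fst x) * ?mp b (snd x)))"
    by (subst sum.swap) (intro sum.cong refl sum.swap)
  also have "\<dots> = (\<Sum>a\<in>?M. \<Sum>b\<in>?M. F a * G b * ps_mult n (?mp a) (?mp b) w)"
    unfolding ps_mult_alt using w by (simp add: sum_distrib_left)
  also have "\<dots> = (\<Sum>a\<in>?M. \<Sum>b\<in>?M. t a b)"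
  proof (intro sum.cong refl)
    fix a b assume "a \<in> ?M" "b \<in> ?M"
    then show "F a * G b * ps_mult n (?mp a) (?mp b) w = t a b"
      using monopow_mult[OF ok, of a b] by (simp add: t_def monos_upto_def ps_smult_def ps_zero_def)
  qed
  also have "\<dots> = (\<Sum>(a, b)\<in>?M \<times> ?M. t a b)"
    by (rule sum.cartesian_product)
  \<comment> \<open>Pairs whose sum leaves the index set contribute nothing: either the sum is
    inadmissible, or its degree exceeds \<open>d\<close> and the corresponding product of images has
    coefficient 0 at \<open>w\<close>.\<close>
  also have "\<dots> = (\<Sum>(a, b)\<in>{(a, b). (\<lambda>v. a v + b v) \<in> ?M}. t a b)"
  proof (rule sum.mono_neutral_right)
    show "finite (?M \<times> ?M)" using fM by simp
    have "a \<in> ?M \<and> b \<in> ?M" if c: "(\<lambda>v. a v + b v) \<in> ?M" for a b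
    proof -
      have v: "valid_mono n a" "valid_mono n b" using c valid_mono_addD[of n a b] by (simp_all add: monos_upto_def)
      moreover have "mono_deg (\<lambda>v. a v + b v) = mono_deg a + mono_deg b"
        using v by (intro mono_deg_add) (simp_all add: valid_mono_def)
      ultimately show ?thesis using c by (simp add: monos_upto_def supp_add)
    qed
    then show "{(a, b). (\<lambda>v. a v + b v) \<in> ?M} \<subseteq> ?M \<times> ?M" by (intro subrelI SigmaI) blast+
    have "t a b = 0" if "a \<in> ?M" "b \<in> ?M" "(\<lambda>v. a v + b v) \<notin> ?M" for a b
    proof (cases "valid_mono n (\<lambda>v. a v + b v)")
      case True
      then have "supp (\<lambda>v. a v + b v) \<subseteq> V" "d < mono_deg (\<lambda>v. a v + b v)"
        using that by (simp_all add: monos_upto_def supp_add)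
      then show ?thesis using monopow_eq_0[OF ok True, of w] by (simp add: t_def d_def)
    qed (simp add: t_def)
    then show "\<forall>x\<in>?M \<times> ?M - {(a, b). (\<lambda>v. a v + b v) \<in> ?M}. (case x of (a, b) \<Rightarrow> t a b) = 0"
      by (intro ballI) (simp add: case_prod_beta mem_Times_iff)
  qed
  also have "\<dots> = (\<Sum>(m, x)\<in>Sigma ?M splits. t (fst x) (snd x))"
    by (rule sum.reindex_bij_witness[where i = snd and j = "\<lambda>(a, b). (\<lambda>v. a v + b v, (a, b))"])
       (auto simp: splits_iff)
  also have "\<dots> = (\<Sum>m\<in>?M. \<Sum>x\<in>splits m. t (fst x) (snd x))"
    by (rule sum.Sigma[symmetric]) (use fM in \<open>simp_all add: monos_upto_def valid_mono_def finite_splits\<close>)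
  also have "\<dots> = (\<Sum>m\<in>?M. ps_mult n F G m * ?mp m w)"
  proof (intro sum.cong refl)
    fix m assume "m \<in> ?M"
    then have m: "valid_mono n m" by (simp add: monos_upto_def)
    have "t (fst x) (snd x) = mono_sign n (fst x) (snd x) * F (fst x) * G (snd x) * ?mp m w" if "x \<in> splits m" for x
    proof -
      have "m = (\<lambda>v. fst x v + snd x v)" using that splits_iff[of "fst x" "snd x" m] by simp
      then show ?thesis using m by (simp add: t_def)
    qed
    then show "(\<Sum>x\<in>splits m. t (fst x) (snd x)) = ps_mult n F G m * ?mp m w"
      unfolding ps_mult_alt using m by (simp add: sum_distrib_right)
  qed
  also have "\<dots> = ps_subst n V g (ps_mult n F G) w"
    by (simp add: sub d_def)
  finally show "ps_subst n V g (ps_mult n F G) w = ps_mult n (ps_subst n V g F) (ps_subst n V g G) w" ..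
qed simp_all

lemma ps_subst_const: 
  assumes "finite V"
  shows "ps_subst n V g F (\<lambda>v. 0) = F (\<lambda>v. 0)"
proof -
  have "monos_upto n V 0 = {\<lambda>v. 0}"
    using mono_deg_0_iff by (auto simp: monos_upto_def valid_mono_def)
  then show ?thesis unfolding ps_subst_def by (simp add: monos_upto_def ps_one_def)
qed

lemma ps_subst_one:
  assumes "subst_ok n V g"
  shows "ps_subst n V g ps_one = ps_one"
proof (rule ext)
  fix w
  have "ps_subst n V g ps_one w = (\<Sum>m\<in>monos_upto n V (mono_deg w). ps_one m * ps_monopow n g m w)"
    by (rule ps_subst_eq[OF assms]) simp
  also have "\<dots> = (\<Sum>m\<in>{\<lambda>v. 0}. ps_one m * ps_monopow n g m w)"
    by (rule sum.mono_neutral_right[OF finite_monos_upto[OF subst_okD(1)[OF assms]]])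
       (simp_all add: monos_upto_def ps_one_def)
  finally show "ps_subst n V g ps_one w = ps_one w" by (simp add: ps_one_def)
qed

lemma ps_hom_subst: "subst_ok n V g \<Longrightarrow> ps_hom n (ps_subst n V g)"
  by (simp add: ps_hom_def ps_subst_add ps_subst_mult ps_subst_one)

lemma supp_single: "supp (\<lambda>u. if u = v then 1 else 0) = {v}"
  by (simp add: supp_def)

lemma ps_subst_var:
  assumes "subst_ok n V g" "v \<in> V"
  shows "ps_subst n V g (ps_var v) = g v"
proof (rule ps_eqI[where n = n])
  let ?e = "\<lambda>u. if u = v then 1 else 0 :: nat"
  have e: "valid_mono n ?e" by (simp add: valid_mono_def supp_single)
  have deg: "mono_deg ?e = 1" by (simp add: mono_deg_def supp_single)
  have mp: "ps_monopow n g ?e = g v"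
    using subst_okD(2)[OF assms] by (simp add: ps_monopow_list supp_single ps_mult_one_right)
  fix w assume w: "valid_mono n w"
  \<comment> \<open>The bound is at least 1, so that the monomial of \<open>v\<close> lies in the
    index set even if \<open>w\<close> is constant.\<close>
  have "ps_subst n V g (ps_var v) w
      = (\<Sum>m\<in>monos_upto n V (max 1 (mono_deg w)). ps_var v m * ps_monopow n g m w)"
    by (rule ps_subst_eq[OF assms(1)]) simp
  also have "\<dots> = (\<Sum>m\<in>{?e}. ps_var v m * ps_monopow n g m w)"
    by (rule sum.mono_neutral_right[OF finite_monos_upto[OF subst_okD(1)[OF assms(1)]]])
       (use e deg assms(2) in \<open>simp_all add: monos_upto_def ps_var_def supp_single\<close>)
  also have "\<dots> = g v w" using mp by (simp add: ps_var_def)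
  finally show "ps_subst n V g (ps_var v) w = g v w" .
qed (simp_all add: subst_okD[OF assms(1)] assms(2))

text \<open>The same bound works on both levels: a coefficient of degree at most \<open>d\<close> of
  the inner result involves only monomials of degree at most \<open>d\<close>. After exchanging two
  finite sums, a homomorphism is applied to a single monomial.\<close>

lemma ps_subst_subst:
  assumes g: "subst_ok n V g" and h: "subst_ok n V' h"
  shows "ps_subst n V' h (ps_subst n V g F) = ps_subst n V (\<lambda>v. ps_subst n V' h (g v)) F"
proof (rule ext)
  fix w
  let ?d = "mono_deg w"
  have "ps_subst n V' h (ps_subst n V g F) w
      = (\<Sum>m\<in>monos_upto n V' ?d. (\<Sum>k\<in>monos_upto n V ?d. F k * ps_monopow n g k m) * ps_monopow n h m w)"
    using ps_subst_eq[OF h, of w ?d] ps_subst_eq[OF g, of _ ?d]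
    by (simp add: monos_upto_def)
  also have "\<dots> = (\<Sum>k\<in>monos_upto n V ?d. \<Sum>m\<in>monos_upto n V' ?d. F k * (ps_monopow n g k m * ps_monopow n h m w))"
    by (subst sum.swap) (simp add: sum_distrib_right mult.assoc)
  also have "\<dots> = (\<Sum>k\<in>monos_upto n V ?d. F k * ps_subst n V' h (ps_monopow n g k) w)"
    using ps_subst_eq[OF h, of w ?d] by (simp add: sum_distrib_left)
  also have "\<dots> = (\<Sum>k\<in>monos_upto n V ?d. F k * ps_monopow n (\<lambda>v. ps_subst n V' h (g v)) k w)"
  proof (intro sum.cong refl)
    fix k assume "k \<in> monos_upto n V ?d"
    then have k: "valid_mono n k" "supp k \<subseteq> V" by (simp_all add: monos_upto_def)
    have "ps_subst n V' h (ps_monopow n g k) = ps_monopow n (\<lambda>v. ps_subst n V' h (g v)) k"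
      by (rule ps_hom_monopow[OF ps_hom_subst[OF h] k(1)]) (use subst_okD(2)[OF g] k(2) in blast)
    then show "F k * ps_subst n V' h (ps_monopow n g k) w
        = F k * ps_monopow n (\<lambda>v. ps_subst n V' h (g v)) k w" by simp
  qed
  also have "\<dots> = ps_subst n V (\<lambda>v. ps_subst n V' h (g v)) F w"
    by (simp add: ps_subst_def monos_upto_def)
  finally show "ps_subst n V' h (ps_subst n V g F) w = ps_subst n V (\<lambda>v. ps_subst n V' h (g v)) F w" .
qed

lemma ps_conj_mult: "ps_conj (ps_mult n F G) = ps_mult n (ps_conj F) (ps_conj G)"
  by (rule ext) (simp add: ps_mult_alt ps_conj_def mono_sign_eq)

lemma ps_hom_conj: "ps_hom n ps_conj"
  unfolding ps_hom_def
  by (simp add: ps_conj_mult) (simp add: ps_conj_def ps_one_def ps_add_def fun_eq_iff)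

lemma ps_conj_conj [simp]: "ps_conj (ps_conj F) = F"
  by (simp add: ps_conj_def)

lemma ps_conj_subst:
  assumes "subst_ok n V g"
  shows "ps_conj (ps_subst n V g F) = ps_subst n V (\<lambda>v. ps_conj (g v)) (ps_conj F)"
proof (rule ext)
  fix w
  have "ps_conj (ps_monopow n g m) = ps_monopow n (\<lambda>v. ps_conj (g v)) m"
    if "valid_mono n m" "supp m \<subseteq> V" for m
    using that subst_okD(2)[OF assms] by (intro ps_hom_monopow ps_hom_conj) blast+
  then have "cnj (ps_monopow n g m w) = ps_monopow n (\<lambda>v. ps_conj (g v)) m w"
    if "valid_mono n m" "supp m \<subseteq> V" for m
    using that unfolding ps_conj_def by metis
  then show "ps_conj (ps_subst n V g F) w = ps_subst n V (\<lambda>v. ps_conj (g v)) (ps_conj F) w"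
    by (simp add: ps_conj_def ps_subst_def cong: conj_cong)
qed

subsection \<open>Determinants over the even subring\<close>

text \<open>Determinants require a commutative ring. The even elements are central in
  \<open>sps\<close> and form one.\<close>

typedef evn = "{x :: sps. sps_homog False x}"
  morphisms of_evn Abs_evn
  by (rule exI[of _ 0]) simp

setup_lifting type_definition_evn

instantiation evn :: comm_ring_1
begin

lift_definition zero_evn :: evn is 0 by simp
lift_definition one_evn :: evn is 1 by simp
lift_definition plus_evn :: "evn \<Rightarrow> evn \<Rightarrow> evn" is "(+)" by (rule sps_homog_add)
lift_definition minus_evn :: "evn \<Rightarrow> evn \<Rightarrow> evn" is "(-)" by (rule sps_homog_diff)
lift_definition uminus_evn :: "evn \<Rightarrow> evn" is uminus by (rule sps_homog_uminus)
lift_definition times_evn :: "evn \<Rightarrow> evn \<Rightarrow> evn" is "(*)" using sps_homog_mult[of False _ False] by simp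

instance
proof
  fix a b c :: evn
  show "a + b + c = a + (b + c)" by transfer (rule add.assoc)
  show "a + b = b + a" by transfer (rule add.commute)
  show "0 + a = a" by transfer simp
  show "- a + a = 0" by transfer simp
  show "a - b = a + - b" by transfer simp
  show "a * b * c = a * (b * c)" by transfer (rule mult.assoc)
  show "a * b = b * a" by transfer (rule sps_even_comm)
  show "1 * a = a" by transfer simp
  show "(a + b) * c = a * c + b * c" by transfer (rule distrib_right)
  show "(0 :: evn) \<noteq> 1" by transfer simp
qed

end

interpretation of_evn: ring_hom of_evn
  by unfold_locales (simp_all add: zero_evn.rep_eq one_evn.rep_eq plus_evn.rep_eq times_evn.rep_eq)

lemma of_evn_homog [simp]: "sps_homog False (of_evn x)"
  using of_evn by simp

text \<open>Not the projection to the even component: it inverts \<open>of_evn\<close>, and every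
  element that is not even goes to the default 0.\<close>

definition even_part :: "sps \<Rightarrow> evn" where
  "even_part x = Abs_evn (if sps_homog False x then x else 0)"

lemma of_evn_even_part: "sps_homog False x \<Longrightarrow> of_evn (even_part x) = x"
  by (simp add: even_part_def Abs_evn_inverse)

lemma even_part_of_evn [simp]: "even_part (of_evn x) = x"
  by (simp add: even_part_def of_evn_inverse)

definition homog_mat :: "bool \<Rightarrow> sps mat \<Rightarrow> bool" where
  "homog_mat p A \<longleftrightarrow> (\<forall>i<dim_row A. \<forall>j<dim_col A. sps_homog p (A $$ (i, j)))"

lemma homog_mat_mult:
  assumes "A \<in> carrier_mat nr k" "B \<in> carrier_mat k nc" "homog_mat p A" "homog_mat q B"
  shows "homog_mat (p \<noteq> q) (A * B)"
  unfolding homog_mat_def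
proof (intro allI impI)
  fix i j assume ij: "i < dim_row (A * B)" "j < dim_col (A * B)"
  then have "(A * B) $$ (i, j) = (\<Sum>l = 0..<k. A $$ (i, l) * B $$ (l, j))"
    using assms(1,2) by (simp add: scalar_prod_def)
  also have "sps_homog (p \<noteq> q) \<dots>"
    by (intro sps_homog_sum sps_homog_mult) (use assms ij in \<open>simp_all add: homog_mat_def\<close>)
  finally show "sps_homog (p \<noteq> q) ((A * B) $$ (i, j))" .
qed

lemma homog_mat_mult_even:
  assumes "A \<in> carrier_mat nr k" "B \<in> carrier_mat k nc" "homog_mat p A" "homog_mat p B"
  shows "homog_mat False (A * B)"
  using homog_mat_mult[OF assms] by simp

lemma homog_mat_one [simp]: "homog_mat False (1\<^sub>m k)"
  by (simp add: homog_mat_def)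

lemma homog_mat_diff:
  "A \<in> carrier_mat nr nc \<Longrightarrow> B \<in> carrier_mat nr nc \<Longrightarrow> homog_mat p A \<Longrightarrow> homog_mat p B \<Longrightarrow> homog_mat p (A - B)"
  by (simp add: homog_mat_def sps_homog_diff)

lemma homog_mat_one_diff:
  "A \<in> carrier_mat k k \<Longrightarrow> homog_mat False A \<Longrightarrow> homog_mat False (1\<^sub>m k - A)"
  by (rule homog_mat_diff[where nr = k and nc = k]) simp_all

lemma homog_mat_of_evn [simp]: "homog_mat False (map_mat of_evn A)"
  by (simp add: homog_mat_def)

lemma even_mat_lift:
  assumes "homog_mat False A"
  shows "A = map_mat of_evn (map_mat even_part A)"
  by (rule eq_matI) (use assms in \<open>simp_all add: homog_mat_def of_evn_even_part\<close>)

definition edet :: "sps mat \<Rightarrow> evn" where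
  "edet A = det (map_mat even_part A)"

lemma edet_of_evn: "edet (map_mat of_evn A) = det A"
proof -
  have "map_mat even_part (map_mat of_evn A) = A" by (rule eq_matI) simp_all
  then show ?thesis by (simp add: edet_def)
qed

lemma edet_one [simp]: "edet (1\<^sub>m k) = 1"
  using edet_of_evn[of "1\<^sub>m k"] by (simp add: of_evn.mat_hom_one)

lemma edet_mult:
  assumes "A \<in> carrier_mat k k" "B \<in> carrier_mat k k" "homog_mat False A" "homog_mat False B"
  shows "edet (A * B) = edet A * edet B"
proof -
  let ?A = "map_mat even_part A" and ?B = "map_mat even_part B"
  have c: "?A \<in> carrier_mat k k" "?B \<in> carrier_mat k k" using assms by simp_all
  have "A * B = map_mat of_evn (?A * ?B)"
    using of_evn.mat_hom_mult[OF c] even_mat_lift[OF assms(3)] even_mat_lift[OF assms(4)] by simp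
  then show ?thesis using det_mult[OF c] by (simp add: edet_of_evn) (simp add: edet_def)
qed

text \<open>The inverse is \<open>x\<close> times the adjugate; it is computed over
  \<open>evn\<close>, hence automatically even.\<close>

lemma edet_unit_inverse:
  assumes "A \<in> carrier_mat k k" "homog_mat False A" "edet A * x = 1"
  obtains B where "B \<in> carrier_mat k k" "homog_mat False B" "A * B = 1\<^sub>m k" "B * A = 1\<^sub>m k"
proof -
  let ?A = "map_mat even_part A"
  let ?B = "x \<cdot>\<^sub>m adj_mat ?A"
  have c: "?A \<in> carrier_mat k k" using assms by simp
  note adj = adj_mat[OF c]
  have d: "x * det ?A = 1" using assms(3) by (simp add: edet_def mult.commute)
  have "x \<cdot>\<^sub>m (det ?A \<cdot>\<^sub>m 1\<^sub>m k) = 1\<^sub>m k"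
    by (rule eq_matI) (use d in auto)
  then have "?A * ?B = 1\<^sub>m k" "?B * ?A = 1\<^sub>m k"
    using adj by (simp_all add: mult_smult_distrib[OF c adj(1)] mult_smult_assoc_mat[OF adj(1) c])
  moreover have "?B \<in> carrier_mat k k" using adj by simp
  ultimately have "map_mat of_evn ?A * map_mat of_evn ?B = 1\<^sub>m k" "map_mat of_evn ?B * map_mat of_evn ?A = 1\<^sub>m k"
    using of_evn.mat_hom_mult[OF c, of ?B] of_evn.mat_hom_mult[OF _ c, of ?B] of_evn.mat_hom_one[of k]
    by metis+
  then show ?thesis
    using that[of "map_mat of_evn ?B"] even_mat_lift[OF assms(2)] adj(1) by simp
qed

text \<open>A permutation with nonzero term in the Leibniz sum must fix every index other than
  \<open>a\<close>, and by injectivity it then fixes \<open>a\<close> too.\<close>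

lemma det_one_row:
  fixes A :: "'a :: comm_ring_1 mat"
  assumes A: "A \<in> carrier_mat k k" and a: "a < k"
    and one: "\<And>i j. i < k \<Longrightarrow> j < k \<Longrightarrow> i \<noteq> a \<Longrightarrow> A $$ (i, j) = (if i = j then 1 else 0)"
  shows "det A = A $$ (a, a)"
proof -
  let ?t = "\<lambda>p. of_int (sign p) * (\<Prod>i = 0..<k. A $$ (i, p i))"
  have "det A = (\<Sum>p | p permutes {0..<k}. ?t p)"
    by (rule det_def'[OF A])
  also have "\<dots> = (\<Sum>p\<in>{id}. ?t p)"
  proof (rule sum.mono_neutral_right)
    show "finite {p. p permutes {0..<k}}" by (simp add: finite_permutations)
    show "{id} \<subseteq> {p. p permutes {0..<k}}" by (simp add: permutes_id)
    show "\<forall>p\<in>{p. p permutes {0..<k}} - {id}. ?t p = 0"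
    proof
      fix p assume "p \<in> {p. p permutes {0..<k}} - {id}"
      then have p: "p permutes {0..<k}" "p \<noteq> id" by auto
      have "\<exists>i<k. i \<noteq> a \<and> p i \<noteq> i"
      proof (rule ccontr)
        assume "\<not> ?thesis"
        then have fx: "p i = i" if "i \<noteq> a" for i
          using that permutes_not_in[OF p(1), of i] by (cases "i < k") auto
        have "p a = a"
        proof (rule ccontr)
          assume "p a \<noteq> a"
          then have "p (p a) = p a" by (rule fx)
          then show False using permutes_inj[OF p(1)] \<open>p a \<noteq> a\<close> by (meson injD)
        qed
        then have "p i = i" for i using fx by (cases "i = a") simp_all
        then have "p = id" by (simp add: fun_eq_iff)
        with p(2) show False ..
      qed
      then obtain i where i: "i < k" "i \<noteq> a" "p i \<noteq> i" by blast
      moreover have "p i < k" using permutes_in_image[OF p(1), of i] i(1) by simp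
      ultimately have "A $$ (i, p i) = 0" using one[of i "p i"] by simp
      then have "(\<Prod>i = 0..<k. A $$ (i, p i)) = 0"
        using i(1) by (intro prod_zero) auto
      then show "?t p = 0" by simp
    qed
  qed
  also have "\<dots> = (\<Prod>i = 0..<k. A $$ (i, i))" by simp
  also have "\<dots> = A $$ (a, a) * (\<Prod>i\<in>{0..<k} - {a}. A $$ (i, i))"
    using a by (intro prod.remove) auto
  also have "(\<Prod>i\<in>{0..<k} - {a}. A $$ (i, i)) = 1"
    by (intro prod.neutral) (auto simp: one)
  finally show ?thesis by simp
qed

lemma det_one_col:
  fixes A :: "'a :: comm_ring_1 mat"
  assumes A: "A \<in> carrier_mat k k" and a: "a < k"
    and one: "\<And>i j. i < k \<Longrightarrow> j < k \<Longrightarrow> j \<noteq> a \<Longrightarrow> A $$ (i, j) = (if i = j then 1 else 0)"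
  shows "det A = A $$ (a, a)"
proof -
  have "det (transpose_mat A) = transpose_mat A $$ (a, a)"
    by (rule det_one_row[where k = k]) (use A a one in auto)
  then show ?thesis using det_transpose[OF A] A a by simp
qed

lemma even_part_zero [simp]: "even_part 0 = 0" and even_part_one [simp]: "even_part 1 = 1"
  using even_part_of_evn[of 0] even_part_of_evn[of 1] by simp_all

text \<open>\<open>1 - U V\<close> differs from the identity only in row \<open>a\<close>, and
  \<open>1 - V U\<close> only in column \<open>b\<close>, so with \<open>v = V $$ (b, a)\<close> the
  determinants are \<open>1 - u v\<close> and \<open>1 - v u = 1 + u v\<close>. Their product is 1
  because \<open>u v\<close> squares to zero.\<close>

lemma edet_single_entry:
  assumes V: "V \<in> carrier_mat m n" "homog_mat True V" and ab: "a < n" "b < m" and u: "sps_homog True u"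
  defines "U \<equiv> mat n m (\<lambda>(i, k). if i = a \<and> k = b then u else 0)"
  shows "edet (1\<^sub>m n - U * V) * edet (1\<^sub>m m - V * U) = 1"
proof -
  let ?v = "V $$ (b, a)"
  have v: "sps_homog True ?v" using V ab by (simp add: homog_mat_def)
  have uv: "(U * V) $$ (i, j) = (if i = a then u * V $$ (b, j) else 0)" if "i < n" "j < n" for i j
  proof -
    have "(U * V) $$ (i, j) = (\<Sum>k = 0..<m. (if i = a \<and> k = b then u else 0) * V $$ (k, j))"
      using that V by (simp add: U_def scalar_prod_def)
    also have "\<dots> = (\<Sum>k = 0..<m. if k = b then (if i = a then u * V $$ (b, j) else 0) else 0)"
      by (intro sum.cong) auto
    finally show ?thesis using ab by simp
  qed
  have vu: "(V * U) $$ (i, j) = (if j = b then V $$ (i, a) * u else 0)" if "i < m" "j < m" for i j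
  proof -
    have "(V * U) $$ (i, j) = (\<Sum>k = 0..<n. V $$ (i, k) * (if k = a \<and> j = b then u else 0))"
      using that V by (simp add: U_def scalar_prod_def)
    also have "\<dots> = (\<Sum>k = 0..<n. if k = a then (if j = b then V $$ (i, a) * u else 0) else 0)"
      by (intro sum.cong) auto
    finally show ?thesis using ab by simp
  qed
  have U: "U \<in> carrier_mat n m" by (simp add: U_def)
  have UV: "U * V \<in> carrier_mat n n" and VU: "V * U \<in> carrier_mat m m" using U V(1) by simp_all
  let ?A = "map_mat even_part (1\<^sub>m n - U * V)" and ?B = "map_mat even_part (1\<^sub>m m - V * U)"
  have A: "?A \<in> carrier_mat n n" and B: "?B \<in> carrier_mat m m"
    using minus_carrier_mat[OF UV] minus_carrier_mat[OF VU] by simp_all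
  have Aij: "?A $$ (i, j) = even_part ((if i = j then 1 else 0) - (if i = a then u * V $$ (b, j) else 0))"
    if "i < n" "j < n" for i j
    using that carrier_matD[OF U] carrier_matD[OF V(1)] uv[OF that] by (simp del: index_mult_mat(1))
  have Bij: "?B $$ (i, j) = even_part ((if i = j then 1 else 0) - (if j = b then V $$ (i, a) * u else 0))"
    if "i < m" "j < m" for i j
    using that carrier_matD[OF U] carrier_matD[OF V(1)] vu[OF that] by (simp del: index_mult_mat(1))
  have "det ?A = ?A $$ (a, a)"
    by (rule det_one_row[OF A ab(1)]) (simp only: Aij, simp)
  moreover have "det ?B = ?B $$ (b, b)"
    by (rule det_one_col[OF B ab(2)]) (simp only: Bij, simp)
  ultimately have e: "edet (1\<^sub>m n - U * V) = even_part (1 - u * ?v)" "edet (1\<^sub>m m - V * U) = even_part (1 - ?v * u)"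
    unfolding edet_def using Aij[OF ab(1) ab(1)] Bij[OF ab(2) ab(2)] by simp_all
  have h: "sps_homog False (u * ?v)" "sps_homog False (?v * u)"
    using sps_homog_mult[OF u v] sps_homog_mult[OF v u] by simp_all
  have "(u * ?v) * (u * ?v) = u * (?v * u) * ?v" by (simp add: mult.assoc)
  also have "\<dots> = - ((u * u) * ?v * ?v)" using sps_odd_anticomm[OF v u] by (simp add: mult.assoc)
  also have "u * u = 0" using sps_odd_square[OF u] .
  finally have z: "(u * ?v) * (u * ?v) = 0" by simp
  have "of_evn (even_part (1 - u * ?v) * even_part (1 - ?v * u)) = (1 - u * ?v) * (1 - ?v * u)"
    using h by (simp add: of_evn.hom_mult of_evn_even_part sps_homog_diff)
  also have "\<dots> = of_evn 1" using z sps_odd_anticomm[OF v u] by (simp add: algebra_simps)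
  finally show ?thesis unfolding e using of_evn_inject by blast
qed

text \<open>Writing \<open>U = U1 + U2\<close>, the product for \<open>(U, V)\<close> is the product for \<open>(U1, V)\<close>
  times that for \<open>(U2, V (1 - U1 V)\<^sup>-\<^sup>1)\<close>, which reduces the claim to a single nonzero entry.\<close>
lemma edet_odd_sylvester:
  assumes "U \<in> carrier_mat n m" "V \<in> carrier_mat m n" "homog_mat True U" "homog_mat True V"
  shows "edet (1\<^sub>m n - U * V) * edet (1\<^sub>m m - V * U) = 1"
proof -
  \<comment> \<open>Induction over a set \<open>S\<close> of positions outside which
    \<open>U\<close> vanishes. Only \<open>U\<close> has to vary: the changed right factor
    \<open>W\<close> meets just the single-entry case, which holds for every odd matrix.\<close>
  have "edet (1\<^sub>m n - U * V) * edet (1\<^sub>m m - V * U) = 1"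
    if "finite S" "S \<subseteq> {..<n} \<times> {..<m}" "U \<in> carrier_mat n m" "V \<in> carrier_mat m n"
      "homog_mat True U" "homog_mat True V" "\<And>i k. i < n \<Longrightarrow> k < m \<Longrightarrow> (i, k) \<notin> S \<Longrightarrow> U $$ (i, k) = 0"
    for S U V
    using that
  proof (induction S arbitrary: U rule: finite_induct)
    case empty
    then have "U = 0\<^sub>m n m" by (intro eq_matI) auto
    then have "1\<^sub>m n - U * V = 1\<^sub>m n" "1\<^sub>m m - V * U = 1\<^sub>m m"
      using empty.prems(3) by (auto intro!: eq_matI)
    then show ?case by simp
  next
    case (insert x S)
    obtain a b where x: "x = (a, b)" by (cases x)
    then have ab: "a < n" "b < m" using insert.prems(1) by auto
    define u where "u = U $$ (a, b)"
    define U1 where "U1 = mat n m (\<lambda>(i, k). if i = a \<and> k = b then 0 else U $$ (i, k))"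
    define U2 where "U2 = mat n m (\<lambda>(i, k). if i = a \<and> k = b then u else 0)"
    note U = insert.prems(2) and V = insert.prems(3) and oU = insert.prems(4) and oV = insert.prems(5)
    have U1: "U1 \<in> carrier_mat n m" and U2: "U2 \<in> carrier_mat n m" by (simp_all add: U1_def U2_def)
    have u: "sps_homog True u" using oU U ab by (simp add: homog_mat_def u_def)
    have oU1: "homog_mat True U1" using oU U by (simp add: homog_mat_def U1_def)
    have oU2: "homog_mat True U2" using u by (simp add: homog_mat_def U2_def)
    have U12: "U = U1 + U2" using U by (intro eq_matI) (auto simp: U1_def U2_def u_def)
    have IH: "edet (1\<^sub>m n - U1 * V) * edet (1\<^sub>m m - V * U1) = 1"
    proof (rule insert.IH)
      show "S \<subseteq> {..<n} \<times> {..<m}" using insert.prems(1) by simp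
      show "U1 $$ (i, k) = 0" if "i < n" "k < m" "(i, k) \<notin> S" for i k
        using insert.prems(6)[of i k] that x by (auto simp: U1_def)
    qed fact+
    let ?M = "1\<^sub>m n - U1 * V" and ?N = "1\<^sub>m m - V * U1"
    have UV: "U1 * V \<in> carrier_mat n n" "U2 * V \<in> carrier_mat n n"
        "V * U1 \<in> carrier_mat m m" "V * U2 \<in> carrier_mat m m"
      using U1 U2 V by simp_all
    have M: "?M \<in> carrier_mat n n" "homog_mat False ?M" and N: "?N \<in> carrier_mat m m" "homog_mat False ?N"
      by (intro homog_mat_one_diff minus_carrier_mat UV
          homog_mat_mult_even[OF U1 V oU1 oV] homog_mat_mult_even[OF V U1 oV oU1])+
    \<comment> \<open>The induction hypothesis itself exhibits the determinant of \<open>?M\<close>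
      as a unit.\<close>
    from edet_unit_inverse[OF M IH] obtain G
      where G: "G \<in> carrier_mat n n" "homog_mat False G" "?M * G = 1\<^sub>m n" "G * ?M = 1\<^sub>m n" by blast
    define W where "W = V * G"
    have W: "W \<in> carrier_mat m n" using V G by (simp add: W_def)
    have oW: "homog_mat True W" using homog_mat_mult[OF V G(1) oV G(2)] by (simp add: W_def)
    have WM: "W * ?M = V" using V G M by (simp add: W_def)
    have GM: "G - U1 * V * G = 1\<^sub>m n"
      using G(3) minus_mult_distrib_mat[OF one_carrier_mat UV(1) G(1)] G(1) by simp
    \<comment> \<open>Push-through: from \<open>V * ?M = ?N * V\<close> it follows that
      \<open>W = V * G\<close> also satisfies \<open>?N * W = V\<close>. Hence the same
      \<open>W\<close> serves both factorisations below.\<close>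
    have "?N * W = W - V * U1 * W"
      using minus_mult_distrib_mat[OF one_carrier_mat UV(3) W] W by simp
    also have "V * U1 * W = V * (U1 * V * G)"
      unfolding W_def using assoc_mult_mat[OF V U1, of "V * G" n] assoc_mult_mat[OF U1 V G(1)] V G(1) by simp
    also have "W - V * (U1 * V * G) = V * (G - U1 * V * G)"
      unfolding W_def using mult_minus_distrib_mat[OF V G(1), of "U1 * V * G"] UV(1) G(1) by simp
    finally have NW: "?N * W = V" using GM V by simp
    have U2W: "U2 * W \<in> carrier_mat n n" "W * U2 \<in> carrier_mat m m" using U2 W by simp_all
    have "1\<^sub>m n - U * V = ?M - U2 * V"
      unfolding U12 add_mult_distrib_mat[OF U1 U2 V]
      by (rule minus_add_minus_mat[OF one_carrier_mat UV(1,2)])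
    also have "U2 * V = U2 * W * ?M" using WM U2 W M by (simp del: index_minus_mat)
    also have "?M - U2 * W * ?M = (1\<^sub>m n - U2 * W) * ?M"
      using minus_mult_distrib_mat[OF one_carrier_mat U2W(1) M(1)] left_mult_one_mat[OF M(1)] by simp
    finally have 1: "1\<^sub>m n - U * V = (1\<^sub>m n - U2 * W) * ?M" .
    have "1\<^sub>m m - V * U = ?N - V * U2"
      unfolding U12 mult_add_distrib_mat[OF V U1 U2]
      by (rule minus_add_minus_mat[OF one_carrier_mat UV(3,4)])
    also have "V * U2 = ?N * (W * U2)" using NW assoc_mult_mat[OF N(1) W U2] by simp
    also have "?N - ?N * (W * U2) = ?N * (1\<^sub>m m - W * U2)"
      using mult_minus_distrib_mat[OF N(1) one_carrier_mat U2W(2)] right_mult_one_mat[OF N(1)] by simp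
    finally have 2: "1\<^sub>m m - V * U = ?N * (1\<^sub>m m - W * U2)" .
    have h: "homog_mat False (1\<^sub>m n - U2 * W)" "homog_mat False (1\<^sub>m m - W * U2)"
      by (intro homog_mat_one_diff minus_carrier_mat U2W
          homog_mat_mult_even[OF U2 W oU2 oW] homog_mat_mult_even[OF W U2 oW oU2])+
    have "edet (1\<^sub>m n - U2 * W) * edet (1\<^sub>m m - W * U2) = 1"
      unfolding U2_def by (rule edet_single_entry[OF W oW ab u])
    moreover have "edet (1\<^sub>m n - U * V) = edet (1\<^sub>m n - U2 * W) * edet ?M"
      unfolding 1 by (intro edet_mult[where k = n] minus_carrier_mat U2W M h UV)
    moreover have "edet (1\<^sub>m m - V * U) = edet ?N * edet (1\<^sub>m m - W * U2)"
      unfolding 2 by (intro edet_mult[where k = m] minus_carrier_mat U2W N h UV)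
    ultimately show ?case using IH by (simp add: algebra_simps)
  qed
  from this[of "{..<n} \<times> {..<m}" U V] show ?thesis using assms by simp
qed

subsection \<open>Inverse matrices\<close>

lemma matrix_inverse_unique:
  fixes M Z Z' :: "'i \<Rightarrow> 'i \<Rightarrow> 'a :: ring_1"
  assumes "finite K" "i \<in> K" "j \<in> K"
    and ZM: "\<And>i j. i \<in> K \<Longrightarrow> j \<in> K \<Longrightarrow> (\<Sum>k\<in>K. Z i k * M k j) = (if i = j then 1 else 0)"
    and MZ: "\<And>i j. i \<in> K \<Longrightarrow> j \<in> K \<Longrightarrow> (\<Sum>k\<in>K. M i k * Z' k j) = (if i = j then 1 else 0)"
  shows "Z i j = Z' i j"
proof -
  have "Z i j = (\<Sum>k\<in>K. if k = j then Z i k else 0)" using assms(1,3) by simp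
  also have "\<dots> = (\<Sum>k\<in>K. Z i k * (\<Sum>l\<in>K. M k l * Z' l j))"
    by (intro sum.cong refl) (simp add: MZ assms(3))
  also have "\<dots> = (\<Sum>k\<in>K. \<Sum>l\<in>K. Z i k * M k l * Z' l j)"
    by (simp add: sum_distrib_left mult.assoc)
  also have "\<dots> = (\<Sum>l\<in>K. \<Sum>k\<in>K. Z i k * M k l * Z' l j)"
    by (rule sum.swap)
  also have "\<dots> = (\<Sum>l\<in>K. (\<Sum>k\<in>K. Z i k * M k l) * Z' l j)"
    by (simp add: sum_distrib_right)
  also have "\<dots> = (\<Sum>l\<in>K. if i = l then Z' l j else 0)"
    by (intro sum.cong refl) (simp add: ZM assms(2))
  also have "\<dots> = Z' i j" using assms(1,2) by simp
  finally show ?thesis .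
qed

text \<open>The predicate inside the definite description of \<open>mat_inv_on\<close>. Vanishing
  outside \<open>K\<close> makes the inverse unique as a function on all indices.\<close>

definition is_inv :: "nat \<Rightarrow> nat set \<Rightarrow> psmat \<Rightarrow> psmat \<Rightarrow> bool" where
  "is_inv n K M Z \<longleftrightarrow> (\<forall>i j. ps_wf n (Z i j)) \<and>
      (\<forall>i j. (i \<notin> K \<or> j \<notin> K) \<longrightarrow> Z i j = ps_zero) \<and>
      (\<forall>i\<in>K. \<forall>j\<in>K. mat_mult_on n K M Z i j = mat_id_on K i j) \<and>
      (\<forall>i\<in>K. \<forall>j\<in>K. mat_mult_on n K Z M i j = mat_id_on K i j)"

lemma is_invD:
  assumes "is_inv n K M Z"
  shows "ps_wf n (Z i j)" "i \<notin> K \<or> j \<notin> K \<Longrightarrow> Z i j = ps_zero"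
    "i \<in> K \<Longrightarrow> j \<in> K \<Longrightarrow> mat_mult_on n K M Z i j = mat_id_on K i j"
    "i \<in> K \<Longrightarrow> j \<in> K \<Longrightarrow> mat_mult_on n K Z M i j = mat_id_on K i j"
  using assms unfolding is_inv_def by blast+

lemma mat_mult_on_wf [simp]: "ps_wf n (mat_mult_on n K P Q i j)"
  by (simp add: mat_mult_on_def)

lemma emb_mat_mult_on:
  assumes "\<And>i j. ps_wf n (P i j)" "\<And>i j. ps_wf n (Q i j)"
  shows "emb n (mat_mult_on n K P Q i j) = (\<Sum>k\<in>K. emb n (P i k) * emb n (Q k j))"
  by (simp add: mat_mult_on_def emb_sum emb_mult assms)

lemma mat_id_on_in: "i \<in> K \<Longrightarrow> j \<in> K \<Longrightarrow> mat_id_on K i j = (if i = j then ps_one else ps_zero)"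
  by (simp add: mat_id_on_def)

lemma is_inv_emb:
  assumes "is_inv n K M Z" "\<And>i j. ps_wf n (M i j)" "i \<in> K" "j \<in> K"
  shows "(\<Sum>k\<in>K. emb n (M i k) * emb n (Z k j)) = (if i = j then 1 else 0)"
    "(\<Sum>k\<in>K. emb n (Z i k) * emb n (M k j)) = (if i = j then 1 else 0)"
proof -
  have "\<And>i j. ps_wf n (Z i j)" using is_invD(1)[OF assms(1)] .
  note e = emb_mat_mult_on[of n M Z K i j, OF assms(2) this] emb_mat_mult_on[of n Z M K i j, OF this assms(2)]
  show "(\<Sum>k\<in>K. emb n (M i k) * emb n (Z k j)) = (if i = j then 1 else 0)"
    "(\<Sum>k\<in>K. emb n (Z i k) * emb n (M k j)) = (if i = j then 1 else 0)"
    unfolding e[symmetric] is_invD(3,4)[OF assms(1,3,4)] mat_id_on_in[OF assms(3,4)] by simp_all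
qed

lemma is_invI:
  assumes wf: "\<And>i j. ps_wf n (M i j)" "\<And>i j. ps_wf n (Z i j)"
    and "\<And>i j. i \<notin> K \<or> j \<notin> K \<Longrightarrow> Z i j = ps_zero"
    and "\<And>i j. i \<in> K \<Longrightarrow> j \<in> K \<Longrightarrow> (\<Sum>k\<in>K. emb n (M i k) * emb n (Z k j)) = (if i = j then 1 else 0)"
    and "\<And>i j. i \<in> K \<Longrightarrow> j \<in> K \<Longrightarrow> (\<Sum>k\<in>K. emb n (Z i k) * emb n (M k j)) = (if i = j then 1 else 0)"
  shows "is_inv n K M Z"
proof -
  have "mat_mult_on n K M Z i j = mat_id_on K i j" "mat_mult_on n K Z M i j = mat_id_on K i j"
    if "i \<in> K" "j \<in> K" for i j
    using assms(4,5)[OF that]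
    by (auto intro!: emb_inj[where n = n] simp: emb_mat_mult_on[of n M Z, OF wf] emb_mat_mult_on[of n Z M, OF wf(2,1)] mat_id_on_in[OF that])
  then show ?thesis unfolding is_inv_def using assms(2,3) by blast
qed

lemma is_inv_unique:
  assumes "finite K" "\<And>i j. ps_wf n (M i j)" "is_inv n K M Z" "is_inv n K M Z'"
  shows "Z = Z'"
proof -
  have "Z i j = Z' i j" for i j
  proof (cases "i \<in> K \<and> j \<in> K")
    case True
    then have "emb n (Z i j) = emb n (Z' i j)"
      using assms(1) is_inv_emb(2)[OF assms(3,2)] is_inv_emb(1)[OF assms(4,2)]
      by (intro matrix_inverse_unique[of K _ _ "\<lambda>i j. emb n (Z i j)" "\<lambda>i j. emb n (M i j)"]) auto
    then show ?thesis using is_invD(1)[OF assms(3)] is_invD(1)[OF assms(4)] by (intro emb_inj[where n = n])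
  next
    case False
    then show ?thesis using is_invD(2)[OF assms(3)] is_invD(2)[OF assms(4)] by metis
  qed
  then show ?thesis by (intro ext) simp
qed

lemma mat_inv_on_eq:
  assumes "finite K" "\<And>i j. ps_wf n (M i j)" "is_inv n K M Z"
  shows "mat_inv_on n K M = Z"
  unfolding mat_inv_on_def is_inv_def[symmetric]
  using assms is_inv_unique by (intro the_equality) blast+

text \<open>Being inverse is expressed by sums, products, 0 and 1 alone, so every ring homomorphism
  preserves it, antilinear ones included.\<close>

lemma is_inv_hom:
  assumes hom: "ps_hom n \<phi>" and "finite K" and wf: "\<And>i j. ps_wf n (M i j)" and inv: "is_inv n K M Z"
  shows "is_inv n K (\<lambda>i j. \<phi> (M i j)) (\<lambda>i j. \<phi> (Z i j))"
proof -
  have mm: "\<phi> (mat_mult_on n K P Q i j) = mat_mult_on n K (\<lambda>i j. \<phi> (P i j)) (\<lambda>i j. \<phi> (Q i j)) i j"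
    if "\<And>i j. ps_wf n (P i j)" "\<And>i j. ps_wf n (Q i j)" for P Q i j
    using that by (simp add: mat_mult_on_def ps_hom_sum[OF hom \<open>finite K\<close>] ps_homD(4)[OF hom])
  have id: "\<phi> (mat_id_on K i j) = mat_id_on K i j" for i j
    by (simp add: mat_id_on_def ps_homD(2)[OF hom] ps_hom_zero[OF hom])
  have wfZ: "\<And>i j. ps_wf n (Z i j)" using is_invD(1)[OF inv] .
  show ?thesis
    unfolding is_inv_def
  proof (intro conjI allI ballI impI)
    fix i j
    show "ps_wf n (\<phi> (Z i j))" using is_invD(1)[OF inv] by (rule ps_homD(1)[OF hom])
    show "\<phi> (Z i j) = ps_zero" if "i \<notin> K \<or> j \<notin> K"
      using is_invD(2)[OF inv that] ps_hom_zero[OF hom] by simp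
    show "mat_mult_on n K (\<lambda>i j. \<phi> (M i j)) (\<lambda>i j. \<phi> (Z i j)) i j = mat_id_on K i j" if "i \<in> K" "j \<in> K"
      using mm[of M Z i j, OF wf wfZ] is_invD(3)[OF inv that] id by simp
    show "mat_mult_on n K (\<lambda>i j. \<phi> (Z i j)) (\<lambda>i j. \<phi> (M i j)) i j = mat_id_on K i j" if "i \<in> K" "j \<in> K"
      using mm[of Z M i j, OF wfZ wf] is_invD(4)[OF inv that] id by simp
  qed
qed

lemma mat_mult_on_cong:
  "(\<And>k. k \<in> K \<Longrightarrow> P i k = P' i k) \<Longrightarrow> (\<And>k. k \<in> K \<Longrightarrow> Q k j = Q' k j) \<Longrightarrow>
    mat_mult_on n K P Q i j = mat_mult_on n K P' Q' i j"
  by (simp add: mat_mult_on_def ps_sum_def)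

lemma is_inv_cong:
  assumes "\<And>i j. i \<in> K \<Longrightarrow> j \<in> K \<Longrightarrow> M i j = M' i j"
  shows "is_inv n K M Z \<longleftrightarrow> is_inv n K M' Z"
proof -
  have "mat_mult_on n K M Z i j = mat_mult_on n K M' Z i j" "mat_mult_on n K Z M i j = mat_mult_on n K Z M' i j"
    if "i \<in> K" "j \<in> K" for i j
    using that assms by (auto intro!: mat_mult_on_cong)
  then show ?thesis unfolding is_inv_def by simp
qed

lemma ord_ge_sub: "ord_ge k F \<Longrightarrow> ord_ge k G \<Longrightarrow> ord_ge k (ps_sub F G)"
  by (simp add: ord_ge_def ps_sub_def)

lemma ord_ge_sum: "(\<And>i. i \<in> K \<Longrightarrow> ord_ge k (f i)) \<Longrightarrow> ord_ge k (ps_sum K f)"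
  by (simp add: ord_ge_def ps_sum_def)

lemma ps_mult_sub_right: "ps_mult n H (ps_sub F G) = ps_sub (ps_mult n H F) (ps_mult n H G)"
  by (rule ext) (simp add: ps_mult_alt ps_sub_def right_diff_distrib sum_subtractf)

text \<open>A solution of \<open>Z = 1 - X Z\<close> is the coefficientwise limit of the iteration, because \<open>X\<close> raises
  the order.\<close>
lemma right_inverse_exists:
  fixes M :: psmat
  assumes fin: "finite K" and wf: "\<And>i j. ps_wf n (M i j)"
    and const: "\<And>i j. i \<in> K \<Longrightarrow> j \<in> K \<Longrightarrow> M i j (\<lambda>v. 0) = (if i = j then 1 else 0)"
  obtains Z where "\<And>i j. ps_wf n (Z i j)" "\<And>i j. i \<notin> K \<or> j \<notin> K \<Longrightarrow> Z i j = ps_zero"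
    "\<And>i j. i \<in> K \<Longrightarrow> j \<in> K \<Longrightarrow> Z i j (\<lambda>v. 0) = (if i = j then 1 else 0)"
    "\<And>i j. i \<in> K \<Longrightarrow> j \<in> K \<Longrightarrow> (\<Sum>k\<in>K. emb n (M i k) * emb n (Z k j)) = (if i = j then 1 else 0)"
proof -
  define X where "X i j = ps_sub (M i j) (if i = j then ps_one else ps_zero)" for i j
  define Zt where "Zt = rec_nat (mat_id_on K) (\<lambda>t Z i j. if i \<in> K \<and> j \<in> K
      then ps_sub (mat_id_on K i j) (ps_sum K (\<lambda>k. ps_mult n (X i k) (Z k j))) else ps_zero)"
  have Zt0: "Zt 0 = mat_id_on K" by (simp add: Zt_def)
  have ZtS: "Zt (Suc t) i j = (if i \<in> K \<and> j \<in> K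
      then ps_sub (mat_id_on K i j) (ps_sum K (\<lambda>k. ps_mult n (X i k) (Zt t k j))) else ps_zero)" for t i j
    by (simp add: Zt_def)
  have wfI: "ps_wf n (mat_id_on K i j)" for i j by (simp add: mat_id_on_def)
  have wfX: "ps_wf n (X i j)" for i j using wf by (simp add: X_def)
  have oX: "ord_ge 1 (X i j)" if "i \<in> K" "j \<in> K" for i j
    using const[OF that] by (intro ord_ge_1I[OF wfX]) (simp add: X_def ps_sub_def ps_one_def ps_zero_def)
  have wfZt: "ps_wf n (Zt t i j)" for t i j
    by (cases t) (simp_all add: Zt0 ZtS wfI)
  \<comment> \<open>Each pass multiplies the previous difference by entries of \<open>X\<close>,
    which have no constant term, and so gains one degree.\<close>
  have step: "ord_ge (Suc t) (ps_sub (Zt (Suc t) i j) (Zt t i j))" for t i j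
  proof (induction t arbitrary: i j)
    case 0
    have "ord_ge 1 (ps_mult n (X i k) (Zt 0 k j))" if "i \<in> K" "k \<in> K" for k
      using ord_ge_mult[OF oX[OF that] ord_ge_0, of n "Zt 0 k j"] by simp
    then have "ord_ge 1 (ps_sum K (\<lambda>k. ps_mult n (X i k) (Zt 0 k j)))" if "i \<in> K"
      using that by (intro ord_ge_sum)
    then show ?case
      by (cases "i \<in> K \<and> j \<in> K") (auto simp: ord_ge_def ps_sub_def ZtS Zt0 mat_id_on_def ps_zero_def)
  next
    case (Suc t)
    show ?case
    proof (cases "i \<in> K \<and> j \<in> K")
      case True
      have eq: "ps_sub (Zt (Suc (Suc t)) i j) (Zt (Suc t) i j)
          = ps_sub ps_zero (ps_sum K (\<lambda>k. ps_mult n (X i k) (ps_sub (Zt (Suc t) k j) (Zt t k j))))"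
        using True by (subst (1 2) ZtS, unfold ps_mult_sub_right) (simp add: ps_sub_def ps_sum_def ps_zero_def sum_subtractf)
      have "ord_ge (1 + Suc t) (ps_mult n (X i k) (ps_sub (Zt (Suc t) k j) (Zt t k j)))" if "k \<in> K" for k
        using True that by (intro ord_ge_mult oX Suc) auto
      then show ?thesis unfolding eq
        by (intro ord_ge_sub ord_ge_sum) (simp_all add: ord_ge_def ps_zero_def)
    next
      case False
      then show ?thesis by (auto simp: ord_ge_def ps_sub_def ZtS ps_zero_def)
    qed
  qed
  \<comment> \<open>The coefficient at \<open>w\<close> is final from iterate
    \<open>mono_deg w\<close> on, so the limit can be taken by diagonal evaluation.\<close>
  define Z where "Z i j w = Zt (mono_deg w) i j w" for i j w
  have stable: "Zt t i j w = Z i j w" if "mono_deg w \<le> t" for t i j w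
    using that
  proof (induction t rule: dec_induct)
    case base
    then show ?case by (simp add: Z_def)
  next
    case (step t)
    have "Zt (Suc t) i j w = Zt t i j w"
      using \<open>ord_ge (Suc t) (ps_sub (Zt (Suc t) i j) (Zt t i j))\<close> step.hyps
      by (simp add: ord_ge_def ps_sub_def)
    then show ?case using step by simp
  qed
  have wfZ: "ps_wf n (Z i j)" for i j using wfZt by (simp add: ps_wf_def Z_def)
  have out: "Z i j = ps_zero" if "i \<notin> K \<or> j \<notin> K" for i j
  proof
    fix w
    have "Zt t i j = ps_zero" for t using that by (cases t) (auto simp: Zt0 ZtS mat_id_on_def)
    then show "Z i j w = ps_zero w" by (simp add: Z_def)
  qed
  have eq: "Z i j = ps_sub (mat_id_on K i j) (ps_sum K (\<lambda>k. ps_mult n (X i k) (Z k j)))"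
    if ij: "i \<in> K" "j \<in> K" for i j
  proof
    fix w
    let ?d = "mono_deg w"
    have "ps_mult n (X i k) (Zt ?d k j) w = ps_mult n (X i k) (Z k j) w" if "k \<in> K" for k
    proof -
      have "ord_ge (Suc ?d) (ps_sub (Zt ?d k j) (Z k j))"
        using stable by (simp add: ord_ge_def ps_sub_def)
      then have "ord_ge (1 + Suc ?d) (ps_mult n (X i k) (ps_sub (Zt ?d k j) (Z k j)))"
        using ij that by (intro ord_ge_mult oX)
      then show ?thesis unfolding ps_mult_sub_right by (simp add: ord_ge_def ps_sub_def)
    qed
    moreover have "Z i j w = Zt (Suc ?d) i j w" using stable[of w "Suc ?d" i j] by simp
    ultimately show "Z i j w = ps_sub (mat_id_on K i j) (ps_sum K (\<lambda>k. ps_mult n (X i k) (Z k j))) w"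
      using ij by (simp add: ZtS ps_sub_def ps_sum_def)
  qed
  show ?thesis
  proof (rule that[of Z])
    show "Z i j (\<lambda>v. 0) = (if i = j then 1 else 0)" if "i \<in> K" "j \<in> K" for i j
      using that by (simp add: Z_def Zt0 mat_id_on_def ps_one_def ps_zero_def)
    show "(\<Sum>k\<in>K. emb n (M i k) * emb n (Z k j)) = (if i = j then 1 else 0)" if ij: "i \<in> K" "j \<in> K" for i j
    proof -
      have X: "emb n (X i k) = emb n (M i k) - (if i = k then 1 else 0)" for k
        using wf by (simp add: X_def emb_sub)
      have "emb n (Z i j) = (if i = j then 1 else 0) - (\<Sum>k\<in>K. emb n (X i k) * emb n (Z k j))"
        by (subst eq[OF ij]) (simp add: emb_sub emb_sum emb_mult wfI wfX wfZ mat_id_on_in[OF ij])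
      also have "(\<Sum>k\<in>K. emb n (X i k) * emb n (Z k j))
          = (\<Sum>k\<in>K. emb n (M i k) * emb n (Z k j)) - (\<Sum>k\<in>K. if i = k then emb n (Z k j) else 0)"
        unfolding X left_diff_distrib sum_subtractf by (simp add: if_distrib[of "\<lambda>x. x * _"] cong: if_cong)
      also have "(\<Sum>k\<in>K. if i = k then emb n (Z k j) else 0) = emb n (Z i j)"
        using fin ij by simp
      finally show ?thesis by (simp add: algebra_simps)
    qed
  qed (use wfZ out in auto)
qed

text \<open>The iteration yields right inverses only. But the right inverse \<open>Z\<close> also
  has identity constant terms and so a right inverse \<open>L\<close> of its own; then
  \<open>M = M (Z L) = (M Z) L = L\<close>, and \<open>Z\<close> is a left inverse as well.\<close>

lemma is_inv_mat_inv_on: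
  fixes M :: psmat
  assumes fin: "finite K" and wf: "\<And>i j. ps_wf n (M i j)"
    and const: "\<And>i j. i \<in> K \<Longrightarrow> j \<in> K \<Longrightarrow> M i j (\<lambda>v. 0) = (if i = j then 1 else 0)"
  shows "is_inv n K M (mat_inv_on n K M)"
    and "i \<in> K \<Longrightarrow> j \<in> K \<Longrightarrow> mat_inv_on n K M i j (\<lambda>v. 0) = (if i = j then 1 else 0)"
proof -
  obtain Z where Z: "\<And>i j. ps_wf n (Z i j)" "\<And>i j. i \<notin> K \<or> j \<notin> K \<Longrightarrow> Z i j = ps_zero"
    "\<And>i j. i \<in> K \<Longrightarrow> j \<in> K \<Longrightarrow> Z i j (\<lambda>v. 0) = (if i = j then 1 else 0)"
    "\<And>i j. i \<in> K \<Longrightarrow> j \<in> K \<Longrightarrow> (\<Sum>k\<in>K. emb n (M i k) * emb n (Z k j)) = (if i = j then 1 else 0)"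
    by (rule right_inverse_exists[of K n M, OF fin wf const]) blast+
  obtain L where L:
    "\<And>i j. i \<in> K \<Longrightarrow> j \<in> K \<Longrightarrow> (\<Sum>k\<in>K. emb n (Z i k) * emb n (L k j)) = (if i = j then 1 else 0)"
    by (rule right_inverse_exists[of K n Z, OF fin Z(1,3)]) blast+
  have MeqL: "emb n (M i j) = emb n (L i j)" if "i \<in> K" "j \<in> K" for i j
    by (rule matrix_inverse_unique[OF fin that, of "\<lambda>i j. emb n (M i j)" "\<lambda>i j. emb n (Z i j)" "\<lambda>i j. emb n (L i j)"])
       (use Z(4) L in blast)+
  have ZM: "(\<Sum>k\<in>K. emb n (Z i k) * emb n (M k j)) = (if i = j then 1 else 0)" if "i \<in> K" "j \<in> K" for i j
    using L[OF that] MeqL that by simp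
  have inv: "is_inv n K M Z"
    by (rule is_invI[OF wf Z(1) Z(2) Z(4) ZM])
  then have "mat_inv_on n K M = Z" by (rule mat_inv_on_eq[OF fin wf])
  then show "is_inv n K M (mat_inv_on n K M)"
    and "i \<in> K \<Longrightarrow> j \<in> K \<Longrightarrow> mat_inv_on n K M i j (\<lambda>v. 0) = (if i = j then 1 else 0)"
    using inv Z(3) by simp_all
qed

text \<open>The parity automorphism. Homogeneous series are its eigenvectors for 1 and -1, which
  turns questions of parity into questions about a homomorphism.\<close>

definition ps_par :: "nat \<Rightarrow> ps \<Rightarrow> ps" where
  "ps_par n F = (\<lambda>m. if mono_odd n m then - F m else F m)"

lemma ps_hom_par: "ps_hom n (ps_par n)"
proof -
  have "ps_par n (ps_mult n F G) = ps_mult n (ps_par n F) (ps_par n G)" for F G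
  proof
    fix w
    show "ps_par n (ps_mult n F G) w = ps_mult n (ps_par n F) (ps_par n G) w"
    proof (cases "valid_mono n w")
      case True
      have "mono_odd n w \<longleftrightarrow> mono_odd n (fst x) \<noteq> mono_odd n (snd x)" if "x \<in> splits w" for x
        using that True mono_odd_add[of n "fst x" "snd x"] splits_iff[of "fst x" "snd x" w] by simp
      then show ?thesis using True
        by (cases "mono_odd n w") (auto simp: ps_par_def ps_mult_alt sum_negf[symmetric] intro!: sum.cong)
    qed (simp add: ps_par_def ps_mult_def)
  qed
  moreover have "ps_par n ps_one = ps_one"
    by (rule ext) (simp add: ps_par_def ps_one_def mono_odd_def)
  moreover have "ps_par n (ps_add F G) = ps_add (ps_par n F) (ps_par n G)" for F G
    by (rule ext) (simp add: ps_par_def ps_add_def)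
  moreover have "ps_wf n (ps_par n F)" if "ps_wf n F" for F
    using that by (simp add: ps_par_def ps_wf_def)
  ultimately show ?thesis unfolding ps_hom_def by blast
qed

lemma ps_par_homog: "ps_homog n p F \<Longrightarrow> ps_par n F = ps_smult (if p then -1 else 1) F"
  by (rule ext) (auto simp: ps_par_def ps_smult_def ps_homog_zeroD)

lemma ps_homog_parI:
  assumes "ps_par n F = ps_smult (if p then -1 else 1) F"
  shows "ps_homog n p F"
proof (rule ps_homogI)
  fix m assume "mono_odd n m \<noteq> p"
  then show "F m = 0" using fun_cong[OF assms, of m] by (cases p) (auto simp: ps_par_def ps_smult_def)
qed

lemma ps_sum_smult: "ps_sum K (\<lambda>k. ps_smult c (f k)) = ps_smult c (ps_sum K f)"
  by (simp add: ps_sum_def ps_smult_def sum_distrib_left)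

text \<open>On \<open>K\<close> the parity automorphism sends \<open>M\<close> to
  \<open>P M P\<close>, where \<open>P\<close> is the diagonal matrix of the signs \<open>s\<close>.
  With \<open>Z'\<close> the image of \<open>Z\<close>, \<open>P Z' P\<close> is again an inverse of
  \<open>M\<close>; uniqueness gives \<open>Z = P Z' P\<close>, which is the claimed parity.\<close>

lemma is_inv_homog:
  fixes od :: "nat \<Rightarrow> bool"
  assumes "finite K" and wf: "\<And>i j. ps_wf n (M i j)" and inv: "is_inv n K M Z"
    and homog: "\<And>i j. i \<in> K \<Longrightarrow> j \<in> K \<Longrightarrow> ps_homog n (od i \<noteq> od j) (M i j)"
  shows "ps_homog n (od i \<noteq> od j) (Z i j)"
proof -
  define s :: "nat \<Rightarrow> complex" where "s i = (if od i then -1 else 1)" for i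
  have ss: "s i * s i = 1" for i by (simp add: s_def)
  define M' where "M' i j = ps_par n (M i j)" for i j
  define Z' where "Z' i j = ps_par n (Z i j)" for i j
  have inv': "is_inv n K M' Z'"
    unfolding M'_def Z'_def by (rule is_inv_hom[OF ps_hom_par assms(1) wf inv])
  have M: "M i j = ps_smult (s i * s j) (M' i j)" if "i \<in> K" "j \<in> K" for i j
    using ps_par_homog[OF homog[OF that]] by (simp add: M'_def s_def ps_smult_smult)
  define Y where "Y i j = ps_smult (s i * s j) (Z' i j)" for i j
  have c: "s i * s k * (s k * s j) = s i * s j" "s k * s j * (s i * s k) = s i * s j" for i j k
    by (simp_all add: s_def)
  have "is_inv n K M Y"
    unfolding is_inv_def
  proof (intro conjI allI ballI impI)
    fix i j
    show "ps_wf n (Y i j)" using is_invD(1)[OF inv'] by (simp add: Y_def)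
    show "Y i j = ps_zero" if "i \<notin> K \<or> j \<notin> K"
      using is_invD(2)[OF inv' that] by (simp add: Y_def ps_smult_def ps_zero_def)
    have id: "ps_smult (s i * s j) (mat_id_on K i j) = mat_id_on K i j"
    proof -
      have "ps_smult (s i * s j) ps_zero = ps_zero" by (simp add: ps_smult_def ps_zero_def)
      then show ?thesis by (simp add: mat_id_on_def ss)
    qed
    show "mat_mult_on n K M Y i j = mat_id_on K i j" if ij: "i \<in> K" "j \<in> K"
    proof -
      have "mat_mult_on n K M Y i j = mat_mult_on n K (\<lambda>i j. ps_smult (s i * s j) (M' i j)) Y i j"
        by (rule mat_mult_on_cong) (use M ij in auto)
      also have "\<dots> = ps_smult (s i * s j) (mat_mult_on n K M' Z' i j)"
        by (simp add: mat_mult_on_def Y_def ps_mult_smult_left ps_mult_smult_right ps_smult_smult c ps_sum_smult)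
      finally show ?thesis using is_invD(3)[OF inv' ij] id by simp
    qed
    show "mat_mult_on n K Y M i j = mat_id_on K i j" if ij: "i \<in> K" "j \<in> K"
    proof -
      have "mat_mult_on n K Y M i j = mat_mult_on n K Y (\<lambda>i j. ps_smult (s i * s j) (M' i j)) i j"
        by (rule mat_mult_on_cong) (use M ij in auto)
      also have "\<dots> = ps_smult (s i * s j) (mat_mult_on n K Z' M' i j)"
        by (simp add: mat_mult_on_def Y_def ps_mult_smult_left ps_mult_smult_right ps_smult_smult c ps_sum_smult)
      finally show ?thesis using is_invD(4)[OF inv' ij] id by simp
    qed
  qed
  then have "Z = Y" using is_inv_unique[OF assms(1) wf inv] by blast
  then have Z: "Z i j = ps_smult (s i * s j) (ps_par n (Z i j))"
    by (metis Y_def Z'_def)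
  have "s i * s j * (s i * s j) = 1" by (simp add: s_def)
  then have "ps_smult (s i * s j) (Z i j) = ps_par n (Z i j)"
    by (subst Z) (simp add: ps_smult_smult)
  then show ?thesis
    by (intro ps_homog_parI) (simp add: s_def split: if_splits)
qed

subsection \<open>The block identity behind the Berezinian of the inverse\<close>

lemma mat_minus_eq_add:
  fixes X Y U :: "'a :: ab_group_add mat"
  assumes "X \<in> carrier_mat k l" "Y \<in> carrier_mat k l" "U \<in> carrier_mat k l" "X + Y = 0\<^sub>m k l"
  shows "U - X = U + Y"
proof (rule eq_matI)
  fix i j assume "i < dim_row (U + Y)" "j < dim_col (U + Y)"
  then have ij: "i < k" "j < l" using assms by simp_all
  then have "(X + Y) $$ (i, j) = 0" unfolding assms(4) by simp
  then have "X $$ (i, j) + Y $$ (i, j) = 0" using assms(1,2) ij by simp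
  then have "- X $$ (i, j) = Y $$ (i, j)" by (simp add: minus_unique)
  then have "U $$ (i, j) - X $$ (i, j) = U $$ (i, j) + Y $$ (i, j)" by (metis diff_conv_add_uminus)
  then show "(U - X) $$ (i, j) = (U + Y) $$ (i, j)" using assms ij by simp
qed (use assms in simp_all)

text \<open>Read \<open>(A, B; C, D)\<close> as \<open>Y\<close>, \<open>(P, Q; R, T)\<close> as its
  inverse \<open>Z\<close>, and \<open>t\<close>, \<open>d\<close> as the inverses of
  \<open>T\<close>, \<open>D\<close>; the claim is \<open>sdet Z * sdet Y = 1\<close>. The Schur
  complement \<open>a = P - Q t R\<close> inverts \<open>A\<close>, and
  \<open>t = D - C a B\<close>. Hence \<open>a (A - B d C) = 1 - (a B)(d C)\<close> and
  \<open>d t = 1 - (d C)(a B)\<close>, and the odd Sylvester identity applies to \<open>a B\<close>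
  and \<open>d C\<close>.\<close>

lemma edet_berezinian_blocks:
  assumes A: "A \<in> carrier_mat n n" and B: "B \<in> carrier_mat n m" and C: "C \<in> carrier_mat m n" and D: "D \<in> carrier_mat m m"
    and P: "P \<in> carrier_mat n n" and Q: "Q \<in> carrier_mat n m" and R: "R \<in> carrier_mat m n" and T: "T \<in> carrier_mat m m"
    and t: "t \<in> carrier_mat m m" and d: "d \<in> carrier_mat m m"
    and eA: "homog_mat False A" and oB: "homog_mat True B" and oC: "homog_mat True C" and eD: "homog_mat False D"
    and eP: "homog_mat False P" and oQ: "homog_mat True Q" and oR: "homog_mat True R"
    and et: "homog_mat False t" and ed: "homog_mat False d"
    and YZ: "A * P + B * R = 1\<^sub>m n" "A * Q + B * T = 0\<^sub>m n m" "C * Q + D * T = 1\<^sub>m m"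
    and ZY: "P * A + Q * C = 1\<^sub>m n" "R * A + T * C = 0\<^sub>m m n"
    and Tt: "T * t = 1\<^sub>m m" "t * T = 1\<^sub>m m" and Dd: "d * D = 1\<^sub>m m"
  shows "edet (P - Q * (t * R)) * edet t * (edet (A - B * (d * C)) * edet d) = 1"
proof -
  define a where "a = P - Q * (t * R)"
  have tR: "t * R \<in> carrier_mat m n" and QtR: "Q * (t * R) \<in> carrier_mat n n" using t R Q by simp_all
  have a: "a \<in> carrier_mat n n" unfolding a_def using QtR by (rule minus_carrier_mat)
  have Aa: "A * a = 1\<^sub>m n"
  proof -
    have "(A * Q + B * T) * (t * R) = A * Q * (t * R) + B * T * (t * R)"
      using A Q B T tR by (intro add_mult_distrib_mat[where nr = n and n = m and nc = n]) simp_all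
    also have "A * Q * (t * R) = A * (Q * (t * R))" by (rule assoc_mult_mat[OF A Q tR])
    also have "B * T * (t * R) = B * (T * (t * R))" by (rule assoc_mult_mat[OF B T tR])
    also have "T * (t * R) = R" using assoc_mult_mat[OF T t R] Tt(1) R by simp
    finally have "A * (Q * (t * R)) + B * R = 0\<^sub>m n n" using YZ(2) left_mult_zero_mat[OF tR] by simp
    then have "A * P - A * (Q * (t * R)) = A * P + B * R"
      using A P QtR B R by (intro mat_minus_eq_add[where k = n and l = n]) simp_all
    then show ?thesis unfolding a_def using mult_minus_distrib_mat[OF A P QtR] YZ(1) by simp
  qed
  have aA: "a * A = 1\<^sub>m n"
  proof -
    have Qt: "Q * t \<in> carrier_mat n m" using Q t by simp
    have "(Q * t) * (R * A + T * C) = Q * t * (R * A) + Q * t * (T * C)"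
      using Qt R A T C by (intro mult_add_distrib_mat[where nr = n and n = m and nc = n]) simp_all
    also have "Q * t * (R * A) = Q * (t * R) * A"
      using assoc_mult_mat[OF Qt R A] assoc_mult_mat[OF Q t R] by simp
    also have "Q * t * (T * C) = Q * C"
      using assoc_mult_mat[OF Qt T C] assoc_mult_mat[OF Q t T] Tt(2) Q by simp
    finally have "Q * (t * R) * A + Q * C = 0\<^sub>m n n" using ZY(2) right_mult_zero_mat[OF Qt] by simp
    then have "P * A - Q * (t * R) * A = P * A + Q * C"
      using A P QtR Q C by (intro mat_minus_eq_add[where k = n and l = n]) simp_all
    then show ?thesis unfolding a_def using minus_mult_distrib_mat[OF P QtR A] ZY(1) by simp
  qed
  have aB: "a * B \<in> carrier_mat n m" and CaB: "C * (a * B) \<in> carrier_mat m m"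
    and BT: "B * T \<in> carrier_mat n m" and dC: "d * C \<in> carrier_mat m n" and BdC: "B * (d * C) \<in> carrier_mat n n"
    using a B C T d by simp_all
  have DCaB: "D - C * (a * B) \<in> carrier_mat m m" using CaB by (rule minus_carrier_mat)
  \<comment> \<open>Multiplying \<open>A Q + B T = 0\<close> by \<open>C a\<close> gives
    \<open>C Q = - C a B T\<close>. With \<open>C Q + D T = 1\<close> this makes
    \<open>D - C a B\<close> a left inverse of \<open>T\<close>, hence equal to
    \<open>t\<close>.\<close>
  have tD: "t = D - C * (a * B)"
  proof -
    have AQ: "A * Q \<in> carrier_mat n m" using A Q by simp
    have aBT: "a * (B * T) \<in> carrier_mat n m" using a BT by simp
    have "a * (A * Q + B * T) = a * (A * Q) + a * (B * T)"
      by (rule mult_add_distrib_mat[OF a AQ BT])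
    also have "a * (A * Q) = Q" using assoc_mult_mat[OF a A Q] aA Q by simp
    finally have "Q + a * (B * T) = 0\<^sub>m n m" using YZ(2) right_mult_zero_mat[OF a] by simp
    then have "C * (Q + a * (B * T)) = 0\<^sub>m m m" using right_mult_zero_mat[OF C] by simp
    then have "C * Q + C * (a * (B * T)) = 0\<^sub>m m m" using mult_add_distrib_mat[OF C Q aBT] by simp
    moreover have "C * Q + C * (a * (B * T)) = C * (a * (B * T)) + C * Q"
      using C Q aBT by (intro comm_add_mat[where nr = m and nc = m]) simp_all
    ultimately have "D * T - C * (a * (B * T)) = D * T + C * Q"
      using C Q aBT D T by (intro mat_minus_eq_add[where k = m and l = m]) simp_all
    also have "\<dots> = C * Q + D * T" using C Q D T by (intro comm_add_mat[where nr = m and nc = m]) simp_all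
    also have "C * (a * (B * T)) = C * (a * B) * T"
      using assoc_mult_mat[OF C aB T] assoc_mult_mat[OF a B T] by simp
    finally have 1: "(D - C * (a * B)) * T = 1\<^sub>m m"
      using minus_mult_distrib_mat[OF D CaB T] YZ(3) by simp
    have "D - C * (a * B) = (D - C * (a * B)) * (T * t)"
      unfolding Tt(1) using right_mult_one_mat[OF DCaB] by simp
    also have "\<dots> = t" using assoc_mult_mat[OF DCaB T t] 1 t by simp
    finally show ?thesis ..
  qed
  have ea: "homog_mat False a"
  proof -
    have "homog_mat True (t * R)" using homog_mat_mult[OF t R et oR] by simp
    then show ?thesis
      unfolding a_def by (intro homog_mat_diff[OF P QtR] eP homog_mat_mult_even[OF Q tR oQ])
  qed
  have oaB: "homog_mat True (a * B)" using homog_mat_mult[OF a B ea oB] by simp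
  have odC: "homog_mat True (d * C)" using homog_mat_mult[OF d C ed oC] by simp
  have eABdC: "homog_mat False (A - B * (d * C))"
    by (intro homog_mat_diff[OF A BdC] eA homog_mat_mult_even[OF B dC oB odC])
  have "a * (A - B * (d * C)) = a * A - a * (B * (d * C))"
    by (rule mult_minus_distrib_mat[OF a A BdC])
  also have "a * (B * (d * C)) = (a * B) * (d * C)" using assoc_mult_mat[OF a B dC] by simp
  finally have 1: "a * (A - B * (d * C)) = 1\<^sub>m n - (a * B) * (d * C)" using aA by simp
  have "d * t = d * D - d * (C * (a * B))"
    unfolding tD by (rule mult_minus_distrib_mat[OF d D CaB])
  also have "d * (C * (a * B)) = (d * C) * (a * B)" using assoc_mult_mat[OF d C aB] by simp
  finally have 2: "d * t = 1\<^sub>m m - (d * C) * (a * B)" using Dd by simp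
  have "edet a * edet (A - B * (d * C)) = edet (1\<^sub>m n - (a * B) * (d * C))"
    unfolding 1[symmetric] by (rule edet_mult[OF a minus_carrier_mat[OF BdC] ea eABdC, symmetric])
  moreover have "edet d * edet t = edet (1\<^sub>m m - (d * C) * (a * B))"
    unfolding 2[symmetric] by (rule edet_mult[OF d t ed et, symmetric])
  moreover have "edet (1\<^sub>m n - (a * B) * (d * C)) * edet (1\<^sub>m m - (d * C) * (a * B)) = 1"
    by (rule edet_odd_sylvester[OF aB dC oaB odC])
  ultimately have "(edet a * edet (A - B * (d * C))) * (edet d * edet t) = 1" by simp
  then show ?thesis unfolding a_def[symmetric] by (simp add: mult_ac)
qed

subsection \<open>Determinants of power series matrices\<close>

text \<open>Bridge from functions with indices starting at 1 to matrices with indices starting at 0.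
  The offsets will be 0 for the even and \<open>n\<close> for the odd indices.\<close>

definition blk :: "(nat \<Rightarrow> nat \<Rightarrow> 'a) \<Rightarrow> nat \<Rightarrow> nat \<Rightarrow> nat \<Rightarrow> nat \<Rightarrow> 'a mat" where
  "blk f c k c' k' = mat k k' (\<lambda>(i, j). f (Suc c + i) (Suc c' + j))"

lemma blk_carrier [simp]: "blk f c k c' k' \<in> carrier_mat k k'"
  by (simp add: blk_def)

lemma blk_cong:
  assumes "\<And>i j. i \<in> {Suc c..c + k} \<Longrightarrow> j \<in> {Suc c'..c' + k'} \<Longrightarrow> f i j = g i j"
  shows "blk f c k c' k' = blk g c k c' k'"
  by (rule eq_matI) (use assms in \<open>simp_all add: blk_def\<close>)

lemma blk_mult:
  fixes f g :: "nat \<Rightarrow> nat \<Rightarrow> 'a :: ring_1"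
  shows "blk f c k c' l * blk g c' l c'' r = blk (\<lambda>i j. \<Sum>x\<in>{Suc c'..c' + l}. f i x * g x j) c k c'' r"
proof (rule eq_matI)
  fix i j assume "i < dim_row (blk (\<lambda>i j. \<Sum>x\<in>{Suc c'..c' + l}. f i x * g x j) c k c'' r)"
    "j < dim_col (blk (\<lambda>i j. \<Sum>x\<in>{Suc c'..c' + l}. f i x * g x j) c k c'' r)"
  then have ij: "i < k" "j < r" by (simp_all add: blk_def)
  have "(\<Sum>x = 0..<l. f (Suc c + i) (Suc c' + x) * g (Suc c' + x) (Suc c'' + j))
      = (\<Sum>x\<in>{Suc c'..c' + l}. f (Suc c + i) x * g x (Suc c'' + j))"
    by (rule sum.reindex_bij_witness[where i = "\<lambda>x. x - Suc c'" and j = "\<lambda>x. Suc c' + x"]) auto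
  then show "(blk f c k c' l * blk g c' l c'' r) $$ (i, j)
      = blk (\<lambda>i j. \<Sum>x\<in>{Suc c'..c' + l}. f i x * g x j) c k c'' r $$ (i, j)"
    using ij by (simp add: blk_def scalar_prod_def)
qed (simp_all add: blk_def)

lemma blk_add: "blk f c k c' l + blk g c k c' l = blk (\<lambda>i j. f i j + g i j) c k c' l"
  by (rule eq_matI) (simp_all add: blk_def)

lemma blk_diff: "blk f c k c' l - blk g c k c' l = blk (\<lambda>i j. f i j - g i j) c k c' l"
  by (rule eq_matI) (simp_all add: blk_def)

lemma blk_one: "blk (\<lambda>i j. if i = j then 1 else 0) c k c k = 1\<^sub>m k"
  by (rule eq_matI) (simp_all add: blk_def)

lemma blk_zero:
  assumes "{Suc c..c + k} \<inter> {Suc c'..c' + k'} = {}"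
  shows "blk (\<lambda>i j. if i = j then 1 else 0) c k c' k' = 0\<^sub>m k k'"
proof (rule eq_matI)
  fix i j assume ij: "i < dim_row (0\<^sub>m k k' :: 'a mat)" "j < dim_col (0\<^sub>m k k' :: 'a mat)"
  have "Suc c + i \<in> {Suc c..c + k}" "Suc c' + j \<in> {Suc c'..c' + k'}" using ij by simp_all
  then have "Suc c + i \<noteq> Suc c' + j" using assms by (metis IntI empty_iff)
  then show "blk (\<lambda>i j. if i = j then 1 else 0) c k c' k' $$ (i, j) = (0\<^sub>m k k' :: 'a mat) $$ (i, j)"
    using ij by (simp add: blk_def)
qed (simp_all add: blk_def)

lemma homog_mat_blk:
  assumes "\<And>i j. i \<in> {Suc c..c + k} \<Longrightarrow> j \<in> {Suc c'..c' + k'} \<Longrightarrow> sps_homog p (f i j)"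
  shows "homog_mat p (blk f c k c' k')"
  using assms by (simp add: homog_mat_def blk_def)

lemma edet_transpose:
  assumes "A \<in> carrier_mat k k"
  shows "edet (transpose_mat A) = edet A"
proof -
  have "map_mat even_part (transpose_mat A) = transpose_mat (map_mat even_part A)"
    by (rule eq_matI) simp_all
  then show ?thesis unfolding edet_def using det_transpose[of "map_mat even_part A" k] assms by simp
qed

lemma emb_foldr_even:
  assumes "\<And>i. i \<in> set L \<Longrightarrow> ps_wf n (f i)" "\<And>i. i \<in> set L \<Longrightarrow> ps_homog n False (f i)"
  shows "emb n (foldr (\<lambda>i acc. ps_mult n (f i) acc) L ps_one) = of_evn (prod_list (map (\<lambda>i. even_part (emb n (f i))) L))"
    and "ps_wf n (foldr (\<lambda>i acc. ps_mult n (f i) acc) L ps_one)"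
proof -
  show wf: "ps_wf n (foldr (\<lambda>i acc. ps_mult n (f i) acc) L ps_one)" for L by (cases L) simp_all
  show "emb n (foldr (\<lambda>i acc. ps_mult n (f i) acc) L ps_one) = of_evn (prod_list (map (\<lambda>i. even_part (emb n (f i))) L))"
    using assms by (induction L) (simp_all add: emb_mult wf of_evn.hom_mult of_evn_even_part emb_homog)
qed

text \<open>Matches the Leibniz sum of \<open>det_on\<close> with a determinant over
  \<open>evn\<close>: conjugation by the index shift is a bijection between the permutations of the
  two index sets and preserves signs.\<close>

lemma emb_det_on:
  assumes wf: "\<And>i j. ps_wf n (M i j)"
    and even: "\<And>i j. i \<in> {Suc c..c + k} \<Longrightarrow> j \<in> {Suc c..c + k} \<Longrightarrow> ps_homog n False (M i j)"
  shows "emb n (det_on n {Suc c..c + k} M) = of_evn (edet (blk (\<lambda>i j. emb n (M i j)) c k c k))"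
proof -
  let ?K = "{Suc c..c + k}" and ?A = "{0..<k}" and ?f = "\<lambda>i. Suc c + i" and ?g = "\<lambda>i. i - Suc c"
  have bij: "bij_betw ?f ?A ?K" and bij': "bij_betw ?g ?K ?A"
    by (rule bij_betw_byWitness[where f' = ?g], auto, rule bij_betw_byWitness[where f' = ?f], auto)
  let ?e = "\<lambda>i j. even_part (emb n (M i j))"
  let ?F = "\<lambda>p. foldr (\<lambda>i acc. ps_mult n (M i (p i)) acc) (sorted_list_of_set ?K) ps_one"
  have F: "ps_wf n (?F p)" "emb n (ps_smult (of_int (sign p)) (?F p)) = of_evn (of_int (sign p) * (\<Prod>i\<in>?K. ?e i (p i)))"
    if p: "p permutes ?K" for p
  proof -
    have "ps_homog n False (M i (p i))" if "i \<in> set (sorted_list_of_set ?K)" for i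
      using that permutes_in_image[OF p, of i] by (intro even) auto
    note 1 = emb_foldr_even[of "sorted_list_of_set ?K" n "\<lambda>i. M i (p i)", OF wf this]
    show "ps_wf n (?F p)" using 1(2) .
    have "emb n (?F p) = of_evn (\<Prod>i\<in>?K. ?e i (p i))"
      using 1(1) prod.distinct_set_conv_list[of "sorted_list_of_set ?K" "\<lambda>i. ?e i (p i)"] by simp
    then show "emb n (ps_smult (of_int (sign p)) (?F p)) = of_evn (of_int (sign p) * (\<Prod>i\<in>?K. ?e i (p i)))"
      using emb_neg[OF \<open>ps_wf n (?F p)\<close>]
      by (cases p rule: sign_cases) (simp_all add: of_evn.hom_uminus)
  qed
  have "emb n (det_on n ?K M) = (\<Sum>p | p permutes ?K. emb n (ps_smult (of_int (sign p)) (?F p)))"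
    unfolding det_on_def by (rule emb_sum) (use F(1) in auto)
  also have "\<dots> = (\<Sum>p | p permutes ?K. of_evn (of_int (sign p) * (\<Prod>i\<in>?K. ?e i (p i))))"
    by (intro sum.cong refl) (use F(2) in auto)
  also have "\<dots> = (\<Sum>q | q permutes ?A. of_evn (of_int (sign q) * (\<Prod>i\<in>?A. ?e (?f i) (?f (q i)))))"
  proof (rule sum.reindex_bij_witness[where i = "map_permutation ?A ?f" and j = "map_permutation ?K ?g"])
    fix p assume "p \<in> {p. p permutes ?K}"
    then have p: "p permutes ?K" by simp
    show "map_permutation ?A ?f (map_permutation ?K ?g p) = p"
      by (rule map_permutation_compose_inv[OF bij' p]) auto
    show q: "map_permutation ?K ?g p \<in> {q. q permutes ?A}"
      using map_permutation_permutes[OF bij' p] by simp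
    have s: "sign (map_permutation ?K ?g p) = sign p"
      using bij' p by (intro sign_map_permutation) (auto simp: bij_betw_def)
    have "(\<Prod>i\<in>?A. ?e (?f i) (?f (map_permutation ?K ?g p i))) = (\<Prod>i\<in>?K. ?e i (p i))"
    proof (rule prod.reindex_bij_witness[where i = ?g and j = ?f])
      fix i assume i: "i \<in> ?A"
      then have fi: "?f i \<in> ?K" by auto
      have "map_permutation ?K ?g p i = map_permutation ?K ?g p (?g (?f i))" by simp
      also have "\<dots> = ?g (p (?f i))"
        by (rule map_permutation_apply) (use bij' fi in \<open>auto simp: bij_betw_def\<close>)
      finally have "?f (map_permutation ?K ?g p i) = p (?f i)"
        using permutes_in_image[OF p, of "?f i"] fi by simp
      then show "?e (?f i) (p (?f i)) = ?e (?f i) (?f (map_permutation ?K ?g p i))" by simp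
    qed auto
    then show "of_evn (of_int (sign (map_permutation ?K ?g p)) * (\<Prod>i\<in>?A. ?e (?f i) (?f (map_permutation ?K ?g p i))))
        = of_evn (of_int (sign p) * (\<Prod>i\<in>?K. ?e i (p i)))" using s by simp
  next
    fix q assume "q \<in> {q. q permutes ?A}"
    then have q: "q permutes ?A" by simp
    show "map_permutation ?K ?g (map_permutation ?A ?f q) = q"
      by (rule map_permutation_compose_inv[OF bij q]) auto
    show "map_permutation ?A ?f q \<in> {p. p permutes ?K}"
      using map_permutation_permutes[OF bij q] by simp
  qed
  also have "\<dots> = of_evn (\<Sum>q | q permutes ?A. of_int (sign q) * (\<Prod>i\<in>?A. ?e (?f i) (?f (q i))))"
    by (simp only: of_evn.hom_sum)
  also have "(\<Sum>q | q permutes ?A. of_int (sign q) * (\<Prod>i\<in>?A. ?e (?f i) (?f (q i))))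
      = edet (blk (\<lambda>i j. emb n (M i j)) c k c k)"
  proof -
    have "q i < k" if "q permutes ?A" "i < k" for q i using permutes_in_image[OF that(1), of i] that(2) by simp
    then have "(\<Prod>i\<in>?A. map_mat even_part (blk (\<lambda>i j. emb n (M i j)) c k c k) $$ (i, q i)) = (\<Prod>i\<in>?A. ?e (?f i) (?f (q i)))"
      if "q permutes ?A" for q using that by (intro prod.cong refl) (simp add: blk_def)
    moreover have "edet (blk (\<lambda>i j. emb n (M i j)) c k c k) = (\<Sum>q | q permutes ?A. of_int (sign q)
        * (\<Prod>i\<in>?A. map_mat even_part (blk (\<lambda>i j. emb n (M i j)) c k c k) $$ (i, q i)))"
      unfolding edet_def by (rule det_def') simp
    ultimately show ?thesis by simp
  qed
  finally show ?thesis .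
qed

subsection \<open>The superdeterminant of the inverse\<close>

lemma foldr_ps_mult_wf [simp]: "ps_wf n (foldr (\<lambda>i acc. ps_mult n (f i) acc) L ps_one)"
  by (cases L) simp_all

lemma det_on_wf [simp]: "ps_wf n (det_on n K M)"
  by (simp add: det_on_def)

lemma ps_hom_foldr:
  assumes "ps_hom n \<phi>" "\<And>i. ps_wf n (f i)"
  shows "\<phi> (foldr (\<lambda>i acc. ps_mult n (f i) acc) L ps_one) = foldr (\<lambda>i acc. ps_mult n (\<phi> (f i)) acc) L ps_one"
  by (induction L) (simp_all add: ps_homD[OF assms(1)] assms(2))

text \<open>The scalars of the Leibniz sum are signs, so additivity of the homomorphism is
  enough.\<close>

lemma ps_hom_det_on:
  assumes hom: "ps_hom n \<phi>" and "finite K" and wf: "\<And>i j. ps_wf n (M i j)"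
  shows "\<phi> (det_on n K M) = det_on n K (\<lambda>i j. \<phi> (M i j))"
proof -
  have "\<phi> (ps_smult (of_int (sign p)) F) = ps_smult (of_int (sign p)) (\<phi> F)" if "ps_wf n F" for p :: "nat \<Rightarrow> nat" and F
    using ps_hom_neg[OF hom that] by (cases p rule: sign_cases) simp_all
  then have "\<phi> (ps_smult (of_int (sign p)) (foldr (\<lambda>i acc. ps_mult n (M i (p i)) acc) L ps_one))
      = ps_smult (of_int (sign p)) (foldr (\<lambda>i acc. ps_mult n (\<phi> (M i (p i))) acc) L ps_one)" for p L
    using ps_hom_foldr[of n \<phi> "\<lambda>i. M i (p i)", OF hom wf] by simp
  then show ?thesis
    unfolding det_on_def
    by (subst ps_hom_sum[OF hom finite_permutations[OF assms(2)]]) simp_all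
qed

lemma ps_hom_mat_mult_on:
  assumes hom: "ps_hom n \<phi>" and "finite K" and "\<And>i j. ps_wf n (P i j)" "\<And>i j. ps_wf n (Q i j)"
  shows "\<phi> (mat_mult_on n K P Q i j) = mat_mult_on n K (\<lambda>i j. \<phi> (P i j)) (\<lambda>i j. \<phi> (Q i j)) i j"
  using assms(3,4) by (simp add: mat_mult_on_def ps_hom_sum[OF hom assms(2)] ps_homD(4)[OF hom])

lemma mat_mult_on_homog:
  fixes od :: "nat \<Rightarrow> bool"
  assumes "\<And>k. k \<in> K \<Longrightarrow> ps_homog n (od i \<noteq> od k) (P i k)" "\<And>k. k \<in> K \<Longrightarrow> ps_homog n (od k \<noteq> od j) (Q k j)"
  shows "ps_homog n (od i \<noteq> od j) (mat_mult_on n K P Q i j)"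
  unfolding mat_mult_on_def
proof (rule ps_homog_sum)
  fix k assume k: "k \<in> K"
  have "ps_homog n ((od i \<noteq> od k) \<noteq> (od k \<noteq> od j)) (ps_mult n (P i k) (Q k j))"
    using assms[OF k] by (rule ps_homog_mult)
  moreover have "((od i \<noteq> od k) \<noteq> (od k \<noteq> od j)) = (od i \<noteq> od j)" by blast
  ultimately show "ps_homog n (od i \<noteq> od j) (ps_mult n (P i k) (Q k j))" by (simp only:)
qed

lemma ps_inv_eq:
  assumes "ps_wf n F" "ps_wf n G" "ps_mult n F G = ps_one" "ps_mult n G F = ps_one"
  shows "ps_inv n F = G"
  unfolding ps_inv_def
proof (rule the_equality)
  fix H assume H: "ps_wf n H \<and> ps_mult n F H = ps_one"
  then have "H = ps_mult n (ps_mult n G F) H" using assms(4) by (simp add: ps_mult_one_left)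
  also have "\<dots> = ps_mult n G (ps_mult n F H)" by (rule ps_mult_assoc)
  also have "\<dots> = G" using H assms(2) by (simp add: ps_mult_one_right)
  finally show "H = G" .
qed (use assms in simp)

lemma Ymat_wf [simp]: "ps_wf n (Ymat n k i j)"
  by (simp add: Ymat_def)

lemma ps_var_const [simp]: "ps_var v (\<lambda>u. 0) = 0"
  by (auto simp: ps_var_def fun_eq_iff)

lemma Ymat_const: "Ymat n k i j (\<lambda>v. 0) = (if i = j then 1 else 0)"
  by (simp add: Ymat_def ps_add_def) (simp add: ps_one_def ps_zero_def)

lemma Ymat_homog: "ps_homog n (idx_odd n i \<noteq> idx_odd n j) (Ymat n k i j)"
proof -
  have "ps_homog n (idx_odd n i \<noteq> idx_odd n j) (ps_var (k, i, j))"
    using ps_homog_var[of n "(k, i, j)"] by (simp add: var_odd_def)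
  moreover have "ps_homog n (idx_odd n i \<noteq> idx_odd n j) (if i = j then ps_one else ps_zero)" by simp
  ultimately show ?thesis unfolding Ymat_def by (rule ps_homog_closed(1)[rotated])
qed

definition Yinv :: "nat \<Rightarrow> nat \<Rightarrow> nat \<Rightarrow> psmat" where
  "Yinv n m k = mat_inv_on n {1..n+m} (Ymat n k)"

lemma is_inv_Yinv: "is_inv n {1..n+m} (Ymat n k) (Yinv n m k)"
  unfolding Yinv_def by (rule is_inv_mat_inv_on) (simp_all add: Ymat_const)

lemma Yinv_wf [simp]: "ps_wf n (Yinv n m k i j)"
  using is_inv_Yinv by (rule is_invD(1))

lemma Yinv_const:
  "i \<in> {1..n+m} \<Longrightarrow> j \<in> {1..n+m} \<Longrightarrow> Yinv n m k i j (\<lambda>v. 0) = (if i = j then 1 else 0)"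
  unfolding Yinv_def by (rule is_inv_mat_inv_on(2)) (simp_all add: Ymat_const)

lemma Yinv_homog: "ps_homog n (idx_odd n i \<noteq> idx_odd n j) (Yinv n m k i j)"
  by (rule is_inv_homog[OF _ _ is_inv_Yinv]) (simp_all only: finite_atLeastAtMost Ymat_wf Ymat_homog)

text \<open>The factor \<open>(-1)^((|i|+|j|)|j|)\<close>: its exponent is odd exactly when
  \<open>i\<close> is even and \<open>j\<close> is odd.\<close>

definition eps :: "nat \<Rightarrow> nat \<Rightarrow> nat \<Rightarrow> complex" where
  "eps n i j = (if \<not> idx_odd n i \<and> idx_odd n j then -1 else 1)"

text \<open>The image of \<open>Y\<close> is the supertranspose of its inverse
  \<open>(P, Q; R, T)\<close>, with blocks \<open>P^T\<close>, \<open>-R^T\<close>,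
  \<open>Q^T\<close>, \<open>T^T\<close>. Its Schur complement and the inverse of its odd block are
  the transposes of \<open>P - Q t R\<close> and \<open>t\<close>, and determinants ignore
  transposition; so \<open>edet_berezinian_blocks\<close> applies. Keeping the homomorphism abstract
  admits the antilinear \<open>sigma\<close>.\<close>

lemma sdet_hom_inverse:
  fixes n m :: nat
  defines "Y \<equiv> Ymat n 0"
  assumes hom: "ps_hom n \<phi>"
    and \<phi>Y: "\<And>i j. i \<in> {1..n+m} \<Longrightarrow> j \<in> {1..n+m} \<Longrightarrow> \<phi> (Y i j) = ps_smult (eps n i j) (Yinv n m 0 j i)"
  shows "ps_mult n (\<phi> (sdet n m Y)) (sdet n m Y) = ps_one" "ps_wf n (sdet n m Y)"
proof -
  define z where "z = Yinv n m 0"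
  define d where "d = mat_inv_on n {n+1..n+m} Y"
  define t where "t = mat_inv_on n {n+1..n+m} z"
  let ?Ev = "{Suc 0..0+n}" and ?Od = "{Suc n..n+m}" and ?K = "{1..n+m}"
  have K1: "{n+1..n+m} = ?Od" by simp
  have K0: "{1..n} = ?Ev" by simp
  have sub: "i \<in> ?Ev \<Longrightarrow> i \<in> ?K" "i \<in> ?Od \<Longrightarrow> i \<in> ?K" for i by auto
  have od0: "i \<in> ?Ev \<Longrightarrow> idx_odd n i = False" and od1: "i \<in> ?Od \<Longrightarrow> idx_odd n i = True" for i
    by (auto simp: idx_odd_def)
  have wfY [simp]: "ps_wf n (Y i j)" and wfz [simp]: "ps_wf n (z i j)" for i j by (simp_all add: Y_def z_def)
  have invz: "is_inv n ?K Y z" unfolding Y_def z_def by (rule is_inv_Yinv)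
  have invd: "is_inv n ?Od Y d" unfolding d_def K1 Y_def by (rule is_inv_mat_inv_on) (simp_all add: Ymat_const)
  have invt: "is_inv n ?Od z t" unfolding t_def K1
  proof (rule is_inv_mat_inv_on)
    show "z i j (\<lambda>v. 0) = (if i = j then 1 else 0)" if "i \<in> ?Od" "j \<in> ?Od" for i j
      unfolding z_def by (rule Yinv_const) (use that in simp_all)
  qed simp_all
  have wfd [simp]: "ps_wf n (d i j)" and wft [simp]: "ps_wf n (t i j)" for i j
    using is_invD(1)[OF invd] is_invD(1)[OF invt] by blast+
  have hY: "ps_homog n (idx_odd n i \<noteq> idx_odd n j) (Y i j)" and hz: "ps_homog n (idx_odd n i \<noteq> idx_odd n j) (z i j)" for i j
    unfolding Y_def z_def by (rule Ymat_homog Yinv_homog)+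
  have hd: "ps_homog n (idx_odd n i \<noteq> idx_odd n j) (d i j)" for i j
    by (rule is_inv_homog[OF _ _ invd]) (simp_all only: finite_atLeastAtMost wfY hY)
  have ht: "ps_homog n (idx_odd n i \<noteq> idx_odd n j) (t i j)" for i j
    by (rule is_inv_homog[OF _ _ invt]) (simp_all only: finite_atLeastAtMost wfz hz)
  define y' where "y' i j = emb n (Y i j)" for i j
  define z' where "z' i j = emb n (z i j)" for i j
  define d' where "d' i j = emb n (d i j)" for i j
  define t' where "t' i j = emb n (t i j)" for i j
  have hy': "sps_homog (idx_odd n i \<noteq> idx_odd n j) (y' i j)" for i j
    unfolding y'_def by (rule emb_homog[OF wfY hY])
  have hz': "sps_homog (idx_odd n i \<noteq> idx_odd n j) (z' i j)" for i j
    unfolding z'_def by (rule emb_homog[OF wfz hz])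
  have hd': "sps_homog (idx_odd n i \<noteq> idx_odd n j) (d' i j)" for i j
    unfolding d'_def by (rule emb_homog[OF wfd hd])
  have ht': "sps_homog (idx_odd n i \<noteq> idx_odd n j) (t' i j)" for i j
    unfolding t'_def by (rule emb_homog[OF wft ht])
  let ?A = "blk y' 0 n 0 n" and ?B = "blk y' 0 n n m" and ?C = "blk y' n m 0 n" and ?D = "blk y' n m n m"
  let ?P = "blk z' 0 n 0 n" and ?Q = "blk z' 0 n n m" and ?R = "blk z' n m 0 n" and ?T = "blk z' n m n m"
  let ?d = "blk d' n m n m" and ?t = "blk t' n m n m"
  have hm: "homog_mat False (blk f 0 n 0 n)" "homog_mat True (blk f 0 n n m)"
      "homog_mat True (blk f n m 0 n)" "homog_mat False (blk f n m n m)"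
    if "\<And>i j. sps_homog (idx_odd n i \<noteq> idx_odd n j) (f i j)" for f
    by (rule homog_mat_blk, use that od0 od1 in metis)+
  have spl: "(\<Sum>x\<in>?Ev. f x) + (\<Sum>x\<in>?Od. f x) = (\<Sum>x\<in>?K. f x)" for f :: "nat \<Rightarrow> sps"
    using sum.ub_add_nat[of 1 n f m] by simp
  have yz: "(\<Sum>x\<in>?K. y' i x * z' x j) = (if i = j then 1 else 0)"
    and zy: "(\<Sum>x\<in>?K. z' i x * y' x j) = (if i = j then 1 else 0)" if "i \<in> ?K" "j \<in> ?K" for i j
    using is_inv_emb[OF invz wfY that] unfolding y'_def z'_def .
  have blocks: "blk f c k 0 n * blk g 0 n c'' r + blk f c k n m * blk g n m c'' r = blk (\<lambda>i j. if i = j then 1 else 0) c k c'' r"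
    if "\<And>i j. i \<in> ?K \<Longrightarrow> j \<in> ?K \<Longrightarrow> (\<Sum>x\<in>?K. f i x * g x j) = (if i = j then 1 else 0)"
      "{Suc c..c + k} \<subseteq> ?K" "{Suc c''..c'' + r} \<subseteq> ?K" for f g :: "nat \<Rightarrow> nat \<Rightarrow> sps" and c k c'' r
    unfolding blk_mult blk_add spl by (rule blk_cong) (use that in blast)
  have one: "blk f n m n m * blk g n m n m = 1\<^sub>m m"
    if "\<And>i j. i \<in> ?Od \<Longrightarrow> j \<in> ?Od \<Longrightarrow> (\<Sum>x\<in>?Od. f i x * g x j) = (if i = j then 1 else 0)"
    for f g :: "nat \<Rightarrow> nat \<Rightarrow> sps"
    unfolding blk_mult blk_one[of n m, symmetric] by (rule blk_cong) (use that in blast)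
  have dD: "?d * ?D = 1\<^sub>m m" and Dd: "?D * ?d = 1\<^sub>m m"
    by (rule one, unfold y'_def d'_def, rule is_inv_emb[OF invd wfY]; assumption)+
  have tT: "?t * ?T = 1\<^sub>m m" and Tt: "?T * ?t = 1\<^sub>m m"
    by (rule one, unfold z'_def t'_def, rule is_inv_emb[OF invt wfz]; assumption)+
  have Ksub: "{Suc 0..0 + n} \<subseteq> ?K" "{Suc n..n + m} \<subseteq> ?K" by auto
  have dis: "{Suc 0..0 + n} \<inter> {Suc n..n + m} = {}" "{Suc n..n + m} \<inter> {Suc 0..0 + n} = {}" by auto
  have main: "edet (?P - ?Q * (?t * ?R)) * edet ?t * (edet (?A - ?B * (?d * ?C)) * edet ?d) = 1"
  proof (rule edet_berezinian_blocks[of ?A n ?B m ?C ?D ?P ?Q ?R ?T ?t ?d])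
    show "?A * ?P + ?B * ?R = 1\<^sub>m n"
      using blocks[of y' z' 0 n 0 n, OF yz Ksub(1) Ksub(1)] by (simp only: blk_one)
    show "?A * ?Q + ?B * ?T = 0\<^sub>m n m"
      using blocks[of y' z' 0 n n m, OF yz Ksub(1) Ksub(2)] by (simp only: blk_zero[OF dis(1)])
    show "?C * ?Q + ?D * ?T = 1\<^sub>m m"
      using blocks[of y' z' n m n m, OF yz Ksub(2) Ksub(2)] by (simp only: blk_one)
    show "?P * ?A + ?Q * ?C = 1\<^sub>m n"
      using blocks[of z' y' 0 n 0 n, OF zy Ksub(1) Ksub(1)] by (simp only: blk_one)
    show "?R * ?A + ?T * ?C = 0\<^sub>m m n"
      using blocks[of z' y' n m 0 n, OF zy Ksub(2) Ksub(1)] by (simp only: blk_zero[OF dis(2)])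
  qed (intro blk_carrier hm[OF hy'] hm[OF hz'] hm[OF hd'] hm[OF ht'] Tt tT dD)+

  let ?S = "schur n m Y"
  have S: "?S i j = ps_sub (Y i j) (mat_mult_on n ?Od (mat_mult_on n ?Od Y d) Y i j)" for i j
    by (simp add: schur_def d_def)
  have hS: "ps_homog n False (?S i j)" if "i \<in> ?Ev" "j \<in> ?Ev" for i j
  proof -
    have "ps_homog n (idx_odd n i \<noteq> idx_odd n j) (?S i j)"
      unfolding S by (intro ps_homog_closed hY mat_mult_on_homog hd)
    then show ?thesis using od0[OF that(1)] od0[OF that(2)] by simp
  qed
  have wfS [simp]: "ps_wf n (?S i j)" for i j unfolding S by simp
  have eS: "emb n (?S i j) = y' i j - (\<Sum>k\<in>?Od. (\<Sum>l\<in>?Od. y' i l * d' l k) * y' k j)" for i j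
    unfolding S by (simp add: emb_sub emb_mat_mult_on y'_def d'_def)
  have "blk (\<lambda>i j. emb n (?S i j)) 0 n 0 n = ?A - (?B * ?d) * ?C"
    unfolding eS blk_mult blk_diff ..
  also have "(?B * ?d) * ?C = ?B * (?d * ?C)"
    by (rule assoc_mult_mat) (rule blk_carrier)+
  finally have det0: "emb n (det_on n ?Ev ?S) = of_evn (edet (?A - ?B * (?d * ?C)))"
    using emb_det_on[of n ?S 0 n, OF wfS hS] by simp
  have h1: "ps_homog n False (f i j)" if "\<And>i j. ps_homog n (idx_odd n i \<noteq> idx_odd n j) (f i j)" "i \<in> ?Od" "j \<in> ?Od"
    for f :: psmat and i j
    using that(1)[of i j] od1[OF that(2)] od1[OF that(3)] by simp
  have detd: "emb n (det_on n ?Od d) = of_evn (edet ?d)"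
    unfolding d'_def by (rule emb_det_on[of n d n m, OF wfd h1[of d, OF hd]])
  have detD: "emb n (det_on n ?Od Y) = of_evn (edet ?D)"
    unfolding y'_def by (rule emb_det_on[of n Y n m, OF wfY h1[of Y, OF hY]])
  \<comment> \<open>Used to resolve the definite description in \<open>ps_inv\<close>: the inverse
    of the odd determinant is the determinant of the inverse block.\<close>
  have "edet ?D * edet ?d = 1"
    using edet_mult[of ?D m ?d, OF blk_carrier blk_carrier hm(4)[OF hy'] hm(4)[OF hd']] Dd by simp
  then have "emb n (ps_mult n (det_on n ?Od Y) (det_on n ?Od d)) = 1" "emb n (ps_mult n (det_on n ?Od d) (det_on n ?Od Y)) = 1"
    by (simp_all add: emb_mult detd detD of_evn.hom_mult[symmetric] mult.commute)
  then have "ps_mult n (det_on n ?Od Y) (det_on n ?Od d) = ps_one" "ps_mult n (det_on n ?Od d) (det_on n ?Od Y) = ps_one"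
    by (auto intro!: emb_inj[where n = n])
  then have pinv: "ps_inv n (det_on n ?Od Y) = det_on n ?Od d"
    by (intro ps_inv_eq) simp_all
  have sdet: "sdet n m Y = ps_mult n (det_on n ?Ev ?S) (det_on n ?Od d)"
    unfolding sdet_def K0 K1 pinv ..
  then show "ps_wf n (sdet n m Y)" by simp

  have \<phi>wf [simp]: "ps_wf n F \<Longrightarrow> ps_wf n (\<phi> F)" for F by (rule ps_homD(1)[OF hom])
  have \<phi>z: "\<phi> (Y i j) = ps_smult (eps n i j) (z j i)" if "i \<in> ?K" "j \<in> ?K" for i j
    using \<phi>Y[OF that] by (simp add: z_def)
  have e11: "emb n (\<phi> (Y i j)) = z' j i" if "i \<in> ?Od" "j \<in> ?Od" for i j
    using \<phi>z[OF sub(2)[OF that(1)] sub(2)[OF that(2)]] od1[OF that(1)] by (simp add: eps_def z'_def)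
  have e00: "emb n (\<phi> (Y i j)) = z' j i" if "i \<in> ?Ev" "j \<in> ?Ev" for i j
    using \<phi>z[OF sub(1)[OF that(1)] sub(1)[OF that(2)]] od0[OF that(2)] by (simp add: eps_def z'_def)
  have e01: "emb n (\<phi> (Y i j)) = - z' j i" if "i \<in> ?Ev" "j \<in> ?Od" for i j
    using \<phi>z[OF sub(1)[OF that(1)] sub(2)[OF that(2)]] od0[OF that(1)] od1[OF that(2)]
    by (simp add: eps_def z'_def emb_neg)
  have e10: "emb n (\<phi> (Y i j)) = z' j i" if "i \<in> ?Od" "j \<in> ?Ev" for i j
    using \<phi>z[OF sub(2)[OF that(1)] sub(1)[OF that(2)]] od1[OF that(1)] by (simp add: eps_def z'_def)
  have tcomm: "t' i j * x = x * t' i j" if "i \<in> ?Od" "j \<in> ?Od" for i j x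
    using ht'[of i j] od1[OF that(1)] od1[OF that(2)] by (intro sps_even_comm) simp
  \<comment> \<open>Over a noncommutative ring the transpose of an inverse need not invert the
    transpose; here it does, since the entries of \<open>t\<close> are even and hence
    central.\<close>
  have "is_inv n ?Od (\<lambda>i j. \<phi> (Y i j)) (\<lambda>i j. t j i)"
  proof (rule is_invI)
    show "t j i = ps_zero" if "i \<notin> ?Od \<or> j \<notin> ?Od" for i j
      using is_invD(2)[OF invt, of j i] that by blast
    have tz: "(\<Sum>k\<in>?Od. t' i k * z' k j) = (if i = j then 1 else 0)" "(\<Sum>k\<in>?Od. z' i k * t' k j) = (if i = j then 1 else 0)"
      if "i \<in> ?Od" "j \<in> ?Od" for i j
      using is_inv_emb[OF invt wfz that] unfolding t'_def z'_def by blast+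
    fix i j assume ij: "i \<in> ?Od" "j \<in> ?Od"
    have "(\<Sum>k\<in>?Od. emb n (\<phi> (Y i k)) * emb n (t j k)) = (\<Sum>k\<in>?Od. t' j k * z' k i)"
      by (rule sum.cong[OF refl]) (simp only: e11[OF ij(1)] tcomm[OF ij(2)] t'_def[symmetric])
    then show "(\<Sum>k\<in>?Od. emb n (\<phi> (Y i k)) * emb n (t j k)) = (if i = j then 1 else 0)"
      using tz(1)[OF ij(2,1)] by auto
    have "(\<Sum>k\<in>?Od. emb n (t k i) * emb n (\<phi> (Y k j))) = (\<Sum>k\<in>?Od. z' j k * t' k i)"
      by (rule sum.cong[OF refl]) (simp only: e11[OF _ ij(2)] tcomm[OF _ ij(1)] t'_def[symmetric])
    then show "(\<Sum>k\<in>?Od. emb n (t k i) * emb n (\<phi> (Y k j))) = (if i = j then 1 else 0)"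
      using tz(2)[OF ij(2,1)] by auto
  qed simp_all
  moreover have "is_inv n ?Od (\<lambda>i j. \<phi> (Y i j)) (\<lambda>i j. \<phi> (d i j))"
    by (rule is_inv_hom[OF hom _ wfY invd]) simp
  ultimately have \<phi>d: "(\<lambda>i j. \<phi> (d i j)) = (\<lambda>i j. t j i)"
    by (intro is_inv_unique[of ?Od n "\<lambda>i j. \<phi> (Y i j)"]) simp_all
  have "\<phi> (?S i j) = ps_sub (\<phi> (Y i j)) (mat_mult_on n ?Od (mat_mult_on n ?Od (\<lambda>i j. \<phi> (Y i j)) (\<lambda>i j. t j i)) (\<lambda>i j. \<phi> (Y i j)) i j)" for i j
    unfolding S by (simp add: ps_hom_sub[OF hom] ps_hom_mat_mult_on[OF hom] \<phi>d[symmetric])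
  then have e\<phi>S: "emb n (\<phi> (?S i j)) = emb n (\<phi> (Y i j)) - (\<Sum>k\<in>?Od. (\<Sum>l\<in>?Od. emb n (\<phi> (Y i l)) * t' k l) * emb n (\<phi> (Y k j)))" for i j
    by (simp add: emb_sub emb_mat_mult_on t'_def)
  have e\<phi>S': "emb n (\<phi> (?S i j)) = z' j i - (\<Sum>k\<in>?Od. z' j k * (\<Sum>l\<in>?Od. t' k l * z' l i))" if ij: "i \<in> ?Ev" "j \<in> ?Ev" for i j
  proof -
    have "(\<Sum>l\<in>?Od. emb n (\<phi> (Y i l)) * t' k l) * emb n (\<phi> (Y k j)) = z' j k * (\<Sum>l\<in>?Od. t' k l * z' l i)"
      if k: "k \<in> ?Od" for k
    proof -
      \<comment> \<open>The minus sign of the upper right block of the supertranspose cancels the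
        sign of exchanging two odd entries.\<close>
      have "emb n (\<phi> (Y i l)) * t' k l * z' j k = z' j k * (t' k l * z' l i)" if l: "l \<in> ?Od" for l
      proof -
        have "sps_homog True (t' k l * z' l i)"
          using sps_homog_mult[OF ht'[of k l] hz'[of l i]] od1[OF k] od1[OF l] od0[OF ij(1)] by simp
        moreover have "sps_homog True (z' j k)" using hz'[of j k] od1[OF k] od0[OF ij(2)] by simp
        ultimately have "z' j k * (t' k l * z' l i) = - (t' k l * z' l i * z' j k)"
          by (intro sps_odd_anticomm)
        then show ?thesis using e01[OF ij(1) l] tcomm[OF k l, of "z' l i"] by simp
      qed
      then show ?thesis using e10[OF k ij(2)] by (simp add: sum_distrib_left sum_distrib_right)
    qed
    then show ?thesis unfolding e\<phi>S e00[OF ij] by simp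
  qed
  have "blk (\<lambda>i j. emb n (\<phi> (?S i j))) 0 n 0 n = transpose_mat (?P - ?Q * (?t * ?R))"
    unfolding blk_mult blk_diff
  proof (rule eq_matI)
    fix i j
    let ?a = "blk (\<lambda>i j. z' i j - (\<Sum>x\<in>?Od. z' i x * (\<Sum>xa\<in>?Od. t' x xa * z' xa j))) 0 n 0 n"
    assume "i < dim_row (transpose_mat ?a)" "j < dim_col (transpose_mat ?a)"
    then have ij: "i < n" "j < n" by (simp_all add: blk_def)
    then show "blk (\<lambda>i j. emb n (\<phi> (?S i j))) 0 n 0 n $$ (i, j) = transpose_mat ?a $$ (i, j)"
      using e\<phi>S'[of "Suc i" "Suc j"] by (simp add: blk_def)
  qed (simp_all add: blk_def)
  moreover have "?P - ?Q * (?t * ?R) \<in> carrier_mat n n" unfolding blk_mult blk_diff by (rule blk_carrier)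
  ultimately have "edet (blk (\<lambda>i j. emb n (\<phi> (?S i j))) 0 n 0 n) = edet (?P - ?Q * (?t * ?R))"
    by (simp only: edet_transpose)
  moreover have "emb n (\<phi> (det_on n ?Ev ?S)) = of_evn (edet (blk (\<lambda>i j. emb n (\<phi> (?S i j))) 0 n 0 n))"
  proof -
    have "ps_homog n False (\<phi> (?S i j))" if "i \<in> ?Ev" "j \<in> ?Ev" for i j
    proof -
      have h: "ps_homog n (idx_odd n i \<noteq> idx_odd n j) (\<phi> (Y i j))" if "i \<in> ?K" "j \<in> ?K" for i j
        unfolding \<phi>z[OF that] using hz[of j i] by (intro ps_homog_closed(3)) (simp add: eq_commute)
      have h': "ps_homog n (idx_odd n i \<noteq> idx_odd n j) (t j i)" for i j
        using ht[of j i] by (simp add: eq_commute)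
      have "ps_homog n (idx_odd n i \<noteq> idx_odd n j) (\<phi> (?S i j))"
        unfolding \<open>\<And>i j. \<phi> (?S i j) = _\<close>
        by (intro ps_homog_closed(2) h mat_mult_on_homog h' sub that) assumption+
      then show ?thesis using od0[OF that(1)] od0[OF that(2)] by simp
    qed
    then show ?thesis
      using emb_det_on[of n "\<lambda>i j. \<phi> (?S i j)" 0 n] by (simp add: ps_hom_det_on[OF hom])
  qed
  ultimately have 1: "emb n (\<phi> (det_on n ?Ev ?S)) = of_evn (edet (?P - ?Q * (?t * ?R)))" by simp
  have 2: "emb n (\<phi> (det_on n ?Od d)) = of_evn (edet ?t)"
  proof -
    have "ps_homog n False (t j i)" if "i \<in> ?Od" "j \<in> ?Od" for i j
      using h1[of t, OF ht that(2,1)] .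
    then have "emb n (det_on n ?Od (\<lambda>i j. t j i)) = of_evn (edet (blk (\<lambda>i j. t' j i) n m n m))"
      unfolding t'_def by (intro emb_det_on[of n "\<lambda>i j. t j i" n m]) simp_all
    moreover have "blk (\<lambda>i j. t' j i) n m n m = transpose_mat ?t"
      by (rule eq_matI) (simp_all add: blk_def)
    ultimately show ?thesis
      by (simp add: ps_hom_det_on[OF hom] \<phi>d edet_transpose[of ?t m])
  qed
  have "emb n (ps_mult n (\<phi> (sdet n m Y)) (sdet n m Y)) = emb n ps_one"
    unfolding sdet using main
    by (simp add: ps_homD(4)[OF hom] emb_mult 1[unfolded add_0] 2 det0[unfolded add_0] detd of_evn.hom_mult[symmetric])
  then show "ps_mult n (\<phi> (sdet n m Y)) (sdet n m Y) = ps_one"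
    by (rule emb_inj[rotated 2]) simp_all
qed

subsection \<open>Monomial expansion\<close>

definition mono_ps :: "mono \<Rightarrow> ps" where
  "mono_ps m = (\<lambda>w. if w = m then 1 else 0)"

lemma mono_ps_mult:
  assumes "valid_mono n (\<lambda>v. a v + b v)"
  shows "ps_mult n (mono_ps a) (mono_ps b) = ps_smult (mono_sign n a b) (mono_ps (\<lambda>v. a v + b v))"
proof
  fix w
  show "ps_mult n (mono_ps a) (mono_ps b) w = ps_smult (mono_sign n a b) (mono_ps (\<lambda>v. a v + b v)) w"
  proof (cases "valid_mono n w")
    case True
    have fin: "finite (splits w)" using True by (simp add: finite_splits valid_mono_def)
    have "ps_mult n (mono_ps a) (mono_ps b) w = (\<Sum>x\<in>splits w. if x = (a, b) then mono_sign n a b else 0)"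
      unfolding ps_mult_alt using True by (auto simp: mono_ps_def prod_eq_iff intro!: sum.cong)
    also have "\<dots> = (if (a, b) \<in> splits w then mono_sign n a b else 0)" using fin by simp
    finally show ?thesis by (simp add: splits_iff ps_smult_def mono_ps_def)
  next
    case False
    then have "w \<noteq> (\<lambda>v. a v + b v)" using assms by blast
    then show ?thesis using False by (simp add: ps_mult_def ps_smult_def mono_ps_def)
  qed
qed

lemma subst_ok_var: "finite V \<Longrightarrow> subst_ok n V ps_var"
  by (simp add: subst_ok_def ps_homog_var)

text \<open>The basis element of \<open>m\<close> really is the ordered product of generators. Any
  generator that occurs may be split off, not only the first: the same reordering sign arises on
  both sides and cancels.\<close>

lemma monopow_var:
  assumes "finite V" "valid_mono n m" "supp m \<subseteq> V"
  shows "ps_monopow n ps_var m = mono_ps m"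
  using assms(2,3)
proof (induction "mono_deg m" arbitrary: m rule: less_induct)
  case less
  show ?case
  proof (cases "m = (\<lambda>v. 0)")
    case True
    then show ?thesis by (simp add: mono_ps_def ps_one_def)
  next
    case False
    then obtain v where v: "m v \<noteq> 0" by (auto simp: fun_eq_iff)
    let ?e = "\<lambda>u. if u = v then 1 else 0 :: nat"
    define r where "r = (\<lambda>u. m u - ?e u)"
    have m: "m = (\<lambda>u. ?e u + r u)" using v by (auto simp: r_def fun_eq_iff)
    have val: "valid_mono n ?e" "valid_mono n r" using less.prems(1) unfolding m by (rule valid_mono_addD)+
    have "mono_deg m = mono_deg ?e + mono_deg r"
      unfolding m using val by (intro mono_deg_add) (simp_all add: valid_mono_def)
    moreover have "mono_deg ?e = 1" by (simp add: mono_deg_def supp_single)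
    ultimately have deg: "mono_deg r < mono_deg m" by simp
    have sub: "supp ?e \<subseteq> V" "supp r \<subseteq> V" using less.prems(2) unfolding m supp_add by simp_all
    have e: "ps_monopow n ps_var ?e = mono_ps ?e"
      by (simp add: ps_monopow_list supp_single ps_mult_one_right mono_ps_def ps_var_def[symmetric])
    have r: "ps_monopow n ps_var r = mono_ps r" by (rule less.hyps[OF deg val(2) sub(2)])
    have vm: "valid_mono n (\<lambda>u. ?e u + r u)" using less.prems(1) m by simp
    have "ps_smult (mono_sign n ?e r) (ps_monopow n ps_var m) = ps_mult n (mono_ps ?e) (mono_ps r)"
      using monopow_mult[OF subst_ok_var[OF assms(1)] val sub] vm e r m by simp
    also have "\<dots> = ps_smult (mono_sign n ?e r) (mono_ps m)"
      using mono_ps_mult[OF vm] m by simp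
    finally have "mono_sign n ?e r * ps_monopow n ps_var m w = mono_sign n ?e r * mono_ps m w" for w
      unfolding ps_smult_def by meson
    moreover have "mono_sign n ?e r \<noteq> 0" by (simp add: mono_sign_def)
    ultimately show ?thesis by (intro ext) simp
  qed
qed

text \<open>Multiplying each odd generator by -1 induces the parity automorphism. Both involution
  laws thereby reduce to a comparison on generators.\<close>

lemma ps_subst_parity:
  assumes fin: "finite V" and F: "ps_on n V F" and homog: "ps_homog n p F"
  shows "ps_subst n V (\<lambda>v. ps_smult (if var_odd n v then -1 else 1) (ps_var v)) F
       = ps_smult (if p then -1 else 1) F"
proof
  fix w
  let ?s = "if mono_odd n w then -1 else 1 :: complex"
  have mp: "ps_monopow n (\<lambda>v. ps_smult (if var_odd n v then -1 else 1) (ps_var v)) m w = ?s * (if w = m then 1 else 0)"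
    if "valid_mono n m" "supp m \<subseteq> V" for m
  proof -
    have "ps_monopow n (\<lambda>v. ps_smult (if var_odd n v then -1 else 1) (ps_var v)) m = ps_monopow n (\<lambda>v. ps_par n (ps_var v)) m"
      by (rule ps_monopow_cong[OF that(1)]) (simp add: ps_par_homog[OF ps_homog_var])
    also have "\<dots> = ps_par n (mono_ps m)"
      using ps_hom_monopow[OF ps_hom_par that(1), of ps_var] monopow_var[OF fin that] by simp
    finally show ?thesis by (simp add: ps_par_def mono_ps_def)
  qed
  have "ps_subst n V (\<lambda>v. ps_smult (if var_odd n v then -1 else 1) (ps_var v)) F w
      = (\<Sum>m\<in>monos_upto n V (mono_deg w). if w = m then ?s * F m else 0)"
    unfolding ps_subst_def monos_upto_def by (intro sum.cong refl) (simp add: mp)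
  also have "\<dots> = (if w \<in> monos_upto n V (mono_deg w) then ?s * F w else 0)"
    using finite_monos_upto[OF fin] by simp
  also have "\<dots> = ?s * F w"
    using F by (auto simp: ps_on_def ps_wf_def monos_upto_def)
  also have "\<dots> = ps_smult (if p then -1 else 1) F w"
    using homog by (cases "F w = 0") (auto simp: ps_smult_def ps_homog_def)
  finally show "ps_subst n V (\<lambda>v. ps_smult (if var_odd n v then -1 else 1) (ps_var v)) F w
      = ps_smult (if p then -1 else 1) F w" .
qed

subsection \<open>The structure maps on generators\<close>

definition gS :: "nat \<Rightarrow> nat \<Rightarrow> var \<Rightarrow> ps" where
  "gS n m = (\<lambda>(k, i, j). S_gen n m k i j)"

text \<open>The copy index is passed on, so that one map serves both the algebra and its tensor
  square.\<close>

definition gsig :: "nat \<Rightarrow> nat \<Rightarrow> var \<Rightarrow> ps" where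
  "gsig n m = (\<lambda>(k, i, j). sigma_gen n m k i j)"

definition gcop :: "nat \<Rightarrow> nat \<Rightarrow> var \<Rightarrow> ps" where
  "gcop n m = (\<lambda>(k, i, j). ps_add (ps_add (ps_var (0, i, j)) (ps_var (1, i, j)))
        (ps_sum {1..n+m} (\<lambda>l. ps_mult n (ps_var (0, i, l)) (ps_var (1, l, j)))))"

lemma structure_maps:
  "antipode n m = ps_subst n (Vs (n+m) 1) (gS n m)"
  "coprod n m = ps_subst n (Vs (n+m) 1) (gcop n m)"
  "sigma n m F = ps_subst n (Vs (n+m) 1) (gsig n m) (ps_conj F)"
  "sigma2 n m F = ps_subst n (Vs (n+m) 2) (gsig n m) (ps_conj F)"
  by (rule ext, simp add: antipode_def gS_def, rule ext, simp add: coprod_def gcop_def)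
     (simp_all add: sigma_def sigma2_def gsig_def)

lemma finite_Vs: "finite (Vs N c)"
  by (rule finite_subset[of _ "{..<c} \<times> {1..N} \<times> {1..N}"]) (auto simp: Vs_def)

lemma Vs_iff: "(k, i, j) \<in> Vs N c \<longleftrightarrow> k < c \<and> i \<in> {1..N} \<and> j \<in> {1..N}"
  by (simp add: Vs_def)

lemma Vs_cases:
  assumes "v \<in> Vs N c"
  obtains k i j where "v = (k, i, j)" "k < c" "i \<in> {1..N}" "j \<in> {1..N}"
  using assms by (cases v) (simp add: Vs_iff)

lemma S_gen_Yinv: "S_gen n m k i j = ps_sub (Yinv n m k i j) (if i = j then ps_one else ps_zero)"
  by (simp add: S_gen_def Yinv_def)

lemma sigma_gen_eps: "sigma_gen n m k i j = ps_smult (eps n i j) (S_gen n m k j i)"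
  by (simp add: sigma_gen_def eps_def)

lemma ps_homog_delta: "ps_homog n (idx_odd n i \<noteq> idx_odd n j) (if i = j then ps_one else ps_zero)"
  by simp

lemma S_gen_props:
  assumes "i \<in> {1..n+m}" "j \<in> {1..n+m}"
  shows "ps_wf n (S_gen n m k i j)" "S_gen n m k i j (\<lambda>v. 0) = 0"
    "ps_homog n (idx_odd n i \<noteq> idx_odd n j) (S_gen n m k i j)"
proof -
  show "ps_wf n (S_gen n m k i j)" by (simp add: S_gen_Yinv)
  show "S_gen n m k i j (\<lambda>v. 0) = 0"
    using Yinv_const[OF assms] by (simp add: S_gen_Yinv ps_sub_def) (simp add: ps_one_def ps_zero_def)
  show "ps_homog n (idx_odd n i \<noteq> idx_odd n j) (S_gen n m k i j)"
    unfolding S_gen_Yinv by (intro ps_homog_closed(2) Yinv_homog ps_homog_delta)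
qed

lemma subst_ok_gS: "subst_ok n (Vs (n+m) c) (gS n m)"
  unfolding subst_ok_def
proof (intro conjI ballI finite_Vs)
  fix v assume "v \<in> Vs (n+m) c"
  then obtain k i j where v: "v = (k, i, j)" "i \<in> {1..n+m}" "j \<in> {1..n+m}" by (rule Vs_cases)
  note S_gen_props[OF v(2,3), of k]
  then show "ps_wf n (gS n m v)" "gS n m v (\<lambda>u. 0) = 0" "ps_homog n (var_odd n v) (gS n m v)"
    by (simp_all add: v(1) gS_def var_odd_def)
qed

lemma subst_ok_gsig: "subst_ok n (Vs (n+m) c) (gsig n m)"
  unfolding subst_ok_def
proof (intro conjI ballI finite_Vs)
  fix v assume "v \<in> Vs (n+m) c"
  then obtain k i j where v: "v = (k, i, j)" "i \<in> {1..n+m}" "j \<in> {1..n+m}" by (rule Vs_cases)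
  note S = S_gen_props[OF v(3,2), of k]
  show "ps_wf n (gsig n m v)" "gsig n m v (\<lambda>u. 0) = 0"
    using S by (simp_all add: v(1) gsig_def sigma_gen_eps, simp add: ps_smult_def)
  have "ps_homog n (idx_odd n j \<noteq> idx_odd n i) (gsig n m v)"
    using ps_homog_closed(3)[OF S(3)] by (simp add: v(1) gsig_def sigma_gen_eps)
  then show "ps_homog n (var_odd n v) (gsig n m v)" by (simp add: v(1) var_odd_def eq_commute)
qed

text \<open>The matrix form \<open>\<Delta>(Y) = Y0 Y1\<close> of the coproduct, with copy 0 as left
  and copy 1 as right tensor factor; it comes from multiplying out
  \<open>(\<delta> + x)(\<delta> + x)\<close>.\<close>

lemma gcop_Ymat:
  assumes "i \<in> {1..n+m}" "j \<in> {1..n+m}"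
  shows "ps_add (if i = j then ps_one else ps_zero) (gcop n m (k, i, j)) = mat_mult_on n {1..n+m} (Ymat n 0) (Ymat n 1) i j"
proof -
  let ?K = "{1..n+m}"
  let ?x = "\<lambda>k i j. emb n (ps_var (k, i, j))" and ?d = "\<lambda>i j. if i = j then 1 else 0 :: sps"
  have y: "emb n (Ymat n k i j) = ?d i j + ?x k i j" for k i j
    by (simp add: Ymat_def emb_add)
  have "(\<Sum>l\<in>?K. emb n (Ymat n 0 i l) * emb n (Ymat n 1 l j))
      = (\<Sum>l\<in>?K. (if l = i then ?d l j + ?x 1 l j else 0) + ((if l = j then ?x 0 i l else 0) + ?x 0 i l * ?x 1 l j))"
    unfolding y by (intro sum.cong refl) (simp add: distrib_right distrib_left)
  also have "\<dots> = ?d i j + ?x 1 i j + (?x 0 i j + (\<Sum>l\<in>?K. ?x 0 i l * ?x 1 l j))"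
    unfolding sum.distrib using assms by simp
  finally have "emb n (mat_mult_on n ?K (Ymat n 0) (Ymat n 1) i j)
      = ?d i j + ?x 1 i j + (?x 0 i j + (\<Sum>l\<in>?K. ?x 0 i l * ?x 1 l j))"
    by (simp add: emb_mat_mult_on)
  moreover have "emb n (ps_add (if i = j then ps_one else ps_zero) (gcop n m (k, i, j)))
      = ?d i j + (?x 0 i j + ?x 1 i j + (\<Sum>l\<in>?K. ?x 0 i l * ?x 1 l j))"
    by (simp add: gcop_def emb_add emb_sum emb_mult)
  ultimately show ?thesis
    by (intro emb_inj[where n = n]) (simp_all add: gcop_def add_ac)
qed

lemma subst_ok_gcop: "subst_ok n (Vs (n+m) c) (gcop n m)"
  unfolding subst_ok_def
proof (intro conjI ballI finite_Vs)
  fix v assume "v \<in> Vs (n+m) c"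
  then obtain k i j where v: "v = (k, i, j)" "i \<in> {1..n+m}" "j \<in> {1..n+m}" by (rule Vs_cases)
  show "ps_wf n (gcop n m v)" by (simp add: v(1) gcop_def)
  show "gcop n m v (\<lambda>u. 0) = 0" by (simp add: v(1) gcop_def ps_add_def ps_sum_def ps_mult_const)
  have g: "gcop n m v = ps_sub (mat_mult_on n {1..n+m} (Ymat n 0) (Ymat n 1) i j) (if i = j then ps_one else ps_zero)"
    unfolding gcop_Ymat[OF v(2,3), of k, symmetric] v(1) by (simp add: ps_add_def ps_sub_def)
  have "ps_homog n (idx_odd n i \<noteq> idx_odd n j) (gcop n m v)"
    unfolding g by (intro ps_homog_closed(2) mat_mult_on_homog Ymat_homog ps_homog_delta)
  then show "ps_homog n (var_odd n v) (gcop n m v)" by (simp add: v(1) var_odd_def)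
qed

lemma ps_hom_Ymat:
  assumes "ps_hom n \<phi>"
  shows "\<phi> (Ymat n k i j) = ps_add (if i = j then ps_one else ps_zero) (\<phi> (ps_var (k, i, j)))"
  by (simp add: Ymat_def ps_homD[OF assms] ps_hom_zero[OF assms])

lemma ps_add_sub_cancel: "ps_add F (ps_sub G F) = G"
  by (simp add: ps_add_def ps_sub_def)

lemma ps_add_eq_iff: "ps_add F G = H \<longleftrightarrow> G = ps_sub H F"
  by (simp add: ps_add_def ps_sub_def fun_eq_iff eq_diff_eq add.commute)

lemma eps_diag [simp]: "eps n i i = 1"
  by (simp add: eps_def)

lemma eps_smult_delta: "ps_smult (eps n i j) (if j = i then ps_one else ps_zero) = (if i = j then ps_one else ps_zero)"
  by (auto simp: ps_smult_def ps_zero_def)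

lemma ps_smult_sub: "ps_smult c (ps_sub F G) = ps_sub (ps_smult c F) (ps_smult c G)"
  by (simp add: ps_smult_def ps_sub_def right_diff_distrib)

lemma gsig_Yinv: "gsig n m (k, i, j) = ps_sub (ps_smult (eps n i j) (Yinv n m k j i)) (if i = j then ps_one else ps_zero)"
  unfolding gsig_def by (simp add: sigma_gen_eps S_gen_Yinv ps_smult_sub eps_smult_delta)

lemma gS_Yinv: "gS n m (k, i, j) = ps_sub (Yinv n m k i j) (if i = j then ps_one else ps_zero)"
  unfolding gS_def by (simp add: S_gen_Yinv)

lemma subst_gsig_Ymat:
  assumes "k < c" "i \<in> {1..n+m}" "j \<in> {1..n+m}"
  shows "ps_subst n (Vs (n+m) c) (gsig n m) (Ymat n k i j) = ps_smult (eps n i j) (Yinv n m k j i)"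
  using assms
  by (simp only: ps_hom_Ymat[OF ps_hom_subst[OF subst_ok_gsig]] ps_subst_var[OF subst_ok_gsig] Vs_iff
      gsig_Yinv ps_add_sub_cancel simp_thms)

lemma subst_gS_Ymat:
  assumes "k < c" "i \<in> {1..n+m}" "j \<in> {1..n+m}"
  shows "ps_subst n (Vs (n+m) c) (gS n m) (Ymat n k i j) = Yinv n m k i j"
  using assms
  by (simp only: ps_hom_Ymat[OF ps_hom_subst[OF subst_ok_gS]] ps_subst_var[OF subst_ok_gS] Vs_iff
      gS_Yinv ps_add_sub_cancel simp_thms)

lemma subst_gcop_Ymat:
  assumes "k < c" "i \<in> {1..n+m}" "j \<in> {1..n+m}"
  shows "ps_subst n (Vs (n+m) c) (gcop n m) (Ymat n k i j) = mat_mult_on n {1..n+m} (Ymat n 0) (Ymat n 1) i j"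
proof -
  have "(k, i, j) \<in> Vs (n+m) c" using assms by (simp only: Vs_iff simp_thms)
  then show ?thesis
    by (simp only: ps_hom_Ymat[OF ps_hom_subst[OF subst_ok_gcop]] ps_subst_var[OF subst_ok_gcop] gcop_Ymat[OF assms(2,3)])
qed

text \<open>Image of the inverse without any expansion: the images of \<open>Y\<close> and its
  inverse are again inverse to each other, so an explicit inverse of the image of \<open>Y\<close>
  must be the answer.\<close>

lemma ps_hom_Yinv:
  assumes hom: "ps_hom n \<phi>" and X: "is_inv n {1..n+m} W X"
    and W: "\<And>i j. i \<in> {1..n+m} \<Longrightarrow> j \<in> {1..n+m} \<Longrightarrow> \<phi> (Ymat n k i j) = W i j"
  shows "\<phi> (Yinv n m k i j) = X i j"
proof -
  have "is_inv n {1..n+m} (\<lambda>i j. \<phi> (Ymat n k i j)) (\<lambda>i j. \<phi> (Yinv n m k i j))"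
    by (rule is_inv_hom[OF hom _ _ is_inv_Yinv]) simp_all
  moreover have "is_inv n {1..n+m} (\<lambda>i j. \<phi> (Ymat n k i j)) X"
    using X by (subst is_inv_cong[where M' = W]) (use W in auto)
  ultimately have "(\<lambda>i j. \<phi> (Yinv n m k i j)) = X"
    by (rule is_inv_unique[rotated 2]) (simp_all add: ps_homD(1)[OF hom])
  then show ?thesis by meson
qed

lemma ps_conj_Ymat: "ps_conj (Ymat n k i j) = Ymat n k i j"
  by (rule ext) (simp add: ps_conj_def Ymat_def ps_add_def ps_var_def ps_one_def ps_zero_def)

text \<open>Conjugation fixes \<open>Y\<close> and hence its inverse, so all coefficients are real.
  For this reason conjugation passes through the structure maps.\<close>

lemma ps_conj_Yinv: "ps_conj (Yinv n m k i j) = Yinv n m k i j"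
  by (rule ps_hom_Yinv[OF ps_hom_conj is_inv_Yinv]) (rule ps_conj_Ymat)

lemma ps_conj_delta: "ps_conj (if i = j then ps_one else ps_zero) = (if i = j then ps_one else ps_zero)"
  by (auto simp: ps_conj_def ps_one_def ps_zero_def fun_eq_iff)

lemma ps_conj_sub: "ps_conj (ps_sub F G) = ps_sub (ps_conj F) (ps_conj G)"
  by (simp add: ps_conj_def ps_sub_def)

lemma ps_conj_eps: "ps_conj (ps_smult (eps n i j) F) = ps_smult (eps n i j) (ps_conj F)"
  by (simp add: ps_conj_def ps_smult_def eps_def)

lemma ps_conj_gS: "ps_conj (gS n m v) = gS n m v"
  by (cases v) (simp only: gS_Yinv ps_conj_sub ps_conj_Yinv ps_conj_delta)

lemma ps_conj_gsig: "ps_conj (gsig n m v) = gsig n m v"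
  by (cases v) (simp only: gsig_Yinv ps_conj_sub ps_conj_eps ps_conj_Yinv ps_conj_delta)

lemma ps_conj_gcop:
  assumes "v \<in> Vs (n+m) c"
  shows "ps_conj (gcop n m v) = gcop n m v"
proof -
  obtain k i j where v: "v = (k, i, j)" "i \<in> {1..n+m}" "j \<in> {1..n+m}" using assms by (rule Vs_cases)
  have "gcop n m v = ps_sub (mat_mult_on n {1..n+m} (Ymat n 0) (Ymat n 1) i j) (if i = j then ps_one else ps_zero)"
    using gcop_Ymat[OF v(2,3), of k] unfolding ps_add_eq_iff v(1) .
  then show ?thesis
    by (simp only: ps_conj_sub ps_conj_delta ps_hom_mat_mult_on[OF ps_hom_conj finite_atLeastAtMost Ymat_wf Ymat_wf] ps_conj_Ymat)
qed

definition eps' :: "nat \<Rightarrow> nat \<Rightarrow> nat \<Rightarrow> sps" where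
  "eps' n i j = (if \<not> idx_odd n i \<and> idx_odd n j then -1 else 1)"

lemma emb_eps: "ps_wf n F \<Longrightarrow> emb n (ps_smult (eps n i j) F) = eps' n i j * emb n F"
  by (simp add: eps_def eps'_def emb_neg)

text \<open>One summand of the rule \<open>X^st Y^st = (Y X)^st\<close>. The signs
  \<open>eps'\<close> absorb the sign of exchanging the two entries, as the eight parity patterns
  confirm.\<close>

lemma supertranspose_mult:
  assumes "sps_homog (idx_odd n k \<noteq> idx_odd n i) x" "sps_homog (idx_odd n j \<noteq> idx_odd n k) y"
  shows "eps' n i k * x * (eps' n k j * y) = eps' n i j * (y * x)"
  using sps_swap[OF assms]
  by (cases "idx_odd n i"; cases "idx_odd n j"; cases "idx_odd n k") (simp_all add: eps'_def)

lemma supertranspose_sum: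
  assumes "\<And>k. k \<in> K \<Longrightarrow> sps_homog (idx_odd n k \<noteq> idx_odd n i) (p k i)"
    "\<And>k. k \<in> K \<Longrightarrow> sps_homog (idx_odd n j \<noteq> idx_odd n k) (q j k)"
  shows "(\<Sum>k\<in>K. eps' n i k * p k i * (eps' n k j * q j k)) = eps' n i j * (\<Sum>k\<in>K. q j k * p k i)"
  unfolding sum_distrib_left by (intro sum.cong refl supertranspose_mult assms)

text \<open>\<open>is_inv\<close> demands zeros outside \<open>K\<close>, where \<open>M\<close> is
  arbitrary; hence the truncation.\<close>

lemma is_inv_swap:
  assumes "is_inv n K M Z" "\<And>i j. ps_wf n (M i j)"
  shows "is_inv n K Z (\<lambda>i j. if i \<in> K \<and> j \<in> K then M i j else ps_zero)"
proof (rule is_invI)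
  fix i j assume ij: "i \<in> K" "j \<in> K"
  show "(\<Sum>k\<in>K. emb n (Z i k) * emb n (if k \<in> K \<and> j \<in> K then M k j else ps_zero)) = (if i = j then 1 else 0)"
    using is_inv_emb(2)[OF assms ij] ij by simp
  show "(\<Sum>k\<in>K. emb n (if i \<in> K \<and> k \<in> K then M i k else ps_zero) * emb n (Z k j)) = (if i = j then 1 else 0)"
    using is_inv_emb(1)[OF assms ij] ij by simp
qed (use is_invD(1)[OF assms(1)] assms(2) in auto)

text \<open>Supertransposing \<open>M Z = Z M = 1\<close> reverses the factors. The inverse of
  \<open>Z^st\<close> is \<open>M^st\<close> with the same sign convention, so applying
  \<open>sigma\<close> twice supertransposes twice.\<close>

lemma is_inv_supertranspose:
  assumes inv: "is_inv n K M Z" and wf: "\<And>i j. ps_wf n (M i j)"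
    and hM: "\<And>i j. ps_homog n (idx_odd n i \<noteq> idx_odd n j) (M i j)"
    and hZ: "\<And>i j. ps_homog n (idx_odd n i \<noteq> idx_odd n j) (Z i j)"
  shows "is_inv n K (\<lambda>i j. ps_smult (eps n i j) (Z j i))
    (\<lambda>i j. if i \<in> K \<and> j \<in> K then ps_smult (eps n i j) (M j i) else ps_zero)"
proof (rule is_invI)
  have wfZ: "ps_wf n (Z i j)" for i j using is_invD(1)[OF inv] .
  show "ps_wf n (ps_smult (eps n i j) (Z j i))" for i j using wfZ by simp
  show "ps_wf n (if i \<in> K \<and> j \<in> K then ps_smult (eps n i j) (M j i) else ps_zero)" for i j using wf by simp
  fix i j assume ij: "i \<in> K" "j \<in> K"
  have d: "eps' n i j * (if j = i then 1 else 0) = (if i = j then 1 else 0)" by (auto simp: eps'_def)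
  have "(\<Sum>k\<in>K. emb n (ps_smult (eps n i k) (Z k i)) * emb n (if k \<in> K \<and> j \<in> K then ps_smult (eps n k j) (M j k) else ps_zero))
      = (\<Sum>k\<in>K. eps' n i k * emb n (Z k i) * (eps' n k j * emb n (M j k)))"
    using ij by (intro sum.cong refl) (simp add: emb_eps wf wfZ)
  also have "\<dots> = eps' n i j * (\<Sum>k\<in>K. emb n (M j k) * emb n (Z k i))"
    by (rule supertranspose_sum[where p = "\<lambda>i j. emb n (Z i j)" and q = "\<lambda>i j. emb n (M i j)"])
       (rule emb_homog wf wfZ hM hZ)+
  also have "\<dots> = (if i = j then 1 else 0)" using is_inv_emb(1)[OF inv wf ij(2,1)] d by simp
  finally show "(\<Sum>k\<in>K. emb n (ps_smult (eps n i k) (Z k i)) * emb n (if k \<in> K \<and> j \<in> K then ps_smult (eps n k j) (M j k) else ps_zero))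
      = (if i = j then 1 else 0)" .
  have "(\<Sum>k\<in>K. emb n (if i \<in> K \<and> k \<in> K then ps_smult (eps n i k) (M k i) else ps_zero) * emb n (ps_smult (eps n k j) (Z j k)))
      = (\<Sum>k\<in>K. eps' n i k * emb n (M k i) * (eps' n k j * emb n (Z j k)))"
    using ij by (intro sum.cong refl) (simp add: emb_eps wf wfZ)
  also have "\<dots> = eps' n i j * (\<Sum>k\<in>K. emb n (Z j k) * emb n (M k i))"
    by (rule supertranspose_sum[where p = "\<lambda>i j. emb n (M i j)" and q = "\<lambda>i j. emb n (Z i j)"])
       (rule emb_homog wf wfZ hM hZ)+
  also have "\<dots> = (if i = j then 1 else 0)" using is_inv_emb(2)[OF inv wf ij(2,1)] d by simp
  finally show "(\<Sum>k\<in>K. emb n (if i \<in> K \<and> k \<in> K then ps_smult (eps n i k) (M k i) else ps_zero) * emb n (ps_smult (eps n k j) (Z j k)))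
      = (if i = j then 1 else 0)" .
qed auto

lemma matrix_product_inverse:
  fixes M N Z X :: "'i \<Rightarrow> 'i \<Rightarrow> 'a :: ring_1"
  assumes K: "finite K" "i \<in> K" "j \<in> K"
    and NX: "\<And>i j. i \<in> K \<Longrightarrow> j \<in> K \<Longrightarrow> (\<Sum>k\<in>K. N i k * X k j) = (if i = j then 1 else 0)"
    and MZ: "\<And>i j. i \<in> K \<Longrightarrow> j \<in> K \<Longrightarrow> (\<Sum>k\<in>K. M i k * Z k j) = (if i = j then 1 else 0)"
  shows "(\<Sum>k\<in>K. (\<Sum>l\<in>K. M i l * N l k) * (\<Sum>r\<in>K. X k r * Z r j)) = (if i = j then 1 else 0)"
proof -
  have "(\<Sum>k\<in>K. (\<Sum>l\<in>K. M i l * N l k) * (\<Sum>r\<in>K. X k r * Z r j))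
      = (\<Sum>k\<in>K. \<Sum>l\<in>K. \<Sum>r\<in>K. M i l * (N l k * X k r) * Z r j)"
    by (simp add: sum_product mult.assoc)
  also have "\<dots> = (\<Sum>l\<in>K. \<Sum>r\<in>K. \<Sum>k\<in>K. M i l * (N l k * X k r) * Z r j)"
    by (subst sum.swap) (intro sum.cong refl sum.swap)
  also have "\<dots> = (\<Sum>l\<in>K. \<Sum>r\<in>K. M i l * (\<Sum>k\<in>K. N l k * X k r) * Z r j)"
    by (simp add: sum_distrib_left sum_distrib_right)
  also have "\<dots> = (\<Sum>l\<in>K. \<Sum>r\<in>K. if l = r then M i l * Z r j else 0)"
    by (intro sum.cong refl) (simp add: NX)
  also have "\<dots> = (\<Sum>l\<in>K. M i l * Z l j)" using K(1) by simp
  finally show ?thesis using MZ[OF K(2,3)] by simp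
qed

lemma is_inv_product:
  assumes fin: "finite K" and M: "is_inv n K M Z" "\<And>i j. ps_wf n (M i j)" and N: "is_inv n K N X" "\<And>i j. ps_wf n (N i j)"
  shows "is_inv n K (mat_mult_on n K M N) (\<lambda>i j. if i \<in> K \<and> j \<in> K then mat_mult_on n K X Z i j else ps_zero)"
proof (rule is_invI)
  have wf: "ps_wf n (Z i j)" "ps_wf n (X i j)" for i j using is_invD(1)[OF M(1)] is_invD(1)[OF N(1)] by blast+
  fix i j assume ij: "i \<in> K" "j \<in> K"
  have 1: "emb n (mat_mult_on n K M N i j) = (\<Sum>l\<in>K. emb n (M i l) * emb n (N l j))" for i j
    by (simp add: emb_mat_mult_on M(2) N(2))
  have 2: "emb n (mat_mult_on n K X Z i j) = (\<Sum>l\<in>K. emb n (X i l) * emb n (Z l j))" for i j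
    by (simp add: emb_mat_mult_on wf)
  show "(\<Sum>k\<in>K. emb n (mat_mult_on n K M N i k) * emb n (if k \<in> K \<and> j \<in> K then mat_mult_on n K X Z k j else ps_zero)) = (if i = j then 1 else 0)"
    using matrix_product_inverse[OF fin ij is_inv_emb(1)[OF N] is_inv_emb(1)[OF M]] ij by (simp add: 1 2)
  show "(\<Sum>k\<in>K. emb n (if i \<in> K \<and> k \<in> K then mat_mult_on n K X Z i k else ps_zero) * emb n (mat_mult_on n K M N k j)) = (if i = j then 1 else 0)"
    using matrix_product_inverse[OF fin ij is_inv_emb(2)[OF M] is_inv_emb(2)[OF N]] ij by (simp add: 1 2)
qed auto

section \<open>Images of the inverse matrix under the structure maps\<close>

lemma subst_gsig_Yinv:
  assumes "k < c" "i \<in> {1..n+m}" "j \<in> {1..n+m}"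
  shows "ps_subst n (Vs (n+m) c) (gsig n m) (Yinv n m k i j) = ps_smult (eps n i j) (Ymat n k j i)"
proof -
  have "ps_subst n (Vs (n+m) c) (gsig n m) (Yinv n m k i j)
      = (if i \<in> {1..n+m} \<and> j \<in> {1..n+m} then ps_smult (eps n i j) (Ymat n k j i) else ps_zero)"
    by (rule ps_hom_Yinv[OF ps_hom_subst[OF subst_ok_gsig]
          is_inv_supertranspose[OF is_inv_Yinv Ymat_wf Ymat_homog Yinv_homog]])
       (rule subst_gsig_Ymat[OF assms(1)])
  then show ?thesis using assms by simp
qed

lemma subst_gS_Yinv:
  assumes "k < c" "i \<in> {1..n+m}" "j \<in> {1..n+m}"
  shows "ps_subst n (Vs (n+m) c) (gS n m) (Yinv n m k i j) = Ymat n k i j"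
proof -
  have "ps_subst n (Vs (n+m) c) (gS n m) (Yinv n m k i j)
      = (if i \<in> {1..n+m} \<and> j \<in> {1..n+m} then Ymat n k i j else ps_zero)"
    by (rule ps_hom_Yinv[OF ps_hom_subst[OF subst_ok_gS] is_inv_swap[OF is_inv_Yinv Ymat_wf]])
       (rule subst_gS_Ymat[OF assms(1)])
  then show ?thesis using assms by simp
qed

text \<open>Inverting \<open>Y0 Y1\<close> reverses the factors, which is why copy 1 stands on the
  left.\<close>

lemma subst_gcop_Yinv:
  assumes "k < c" "i \<in> {1..n+m}" "j \<in> {1..n+m}"
  shows "ps_subst n (Vs (n+m) c) (gcop n m) (Yinv n m k i j) = mat_mult_on n {1..n+m} (Yinv n m 1) (Yinv n m 0) i j"
proof -
  have "ps_subst n (Vs (n+m) c) (gcop n m) (Yinv n m k i j)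
      = (if i \<in> {1..n+m} \<and> j \<in> {1..n+m} then mat_mult_on n {1..n+m} (Yinv n m 1) (Yinv n m 0) i j else ps_zero)"
    by (rule ps_hom_Yinv[OF ps_hom_subst[OF subst_ok_gcop]
          is_inv_product[OF finite_atLeastAtMost is_inv_Yinv Ymat_wf is_inv_Yinv Ymat_wf]])
       (rule subst_gcop_Ymat[OF assms(1)])
  then show ?thesis using assms by simp
qed

lemma ps_hom_gsig:
  assumes "ps_hom n \<phi>"
  shows "\<phi> (gsig n m (k, i, j)) = ps_sub (ps_smult (eps n i j) (\<phi> (Yinv n m k j i))) (if i = j then ps_one else ps_zero)"
proof -
  have "\<phi> (ps_smult (eps n i j) (Yinv n m k j i)) = ps_smult (eps n i j) (\<phi> (Yinv n m k j i))"
    using ps_hom_neg[OF assms Yinv_wf] by (simp add: eps_def)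
  moreover have "\<phi> (if i = j then ps_one else ps_zero) = (if i = j then ps_one else ps_zero)"
    by (simp add: ps_homD[OF assms] ps_hom_zero[OF assms])
  ultimately show ?thesis by (simp add: gsig_Yinv ps_hom_sub[OF assms])
qed

lemma Ymat_minus_delta:
  assumes "i = j \<Longrightarrow> c = 1"
  shows "ps_sub (ps_smult c (Ymat n k i j)) (if i = j then ps_one else ps_zero) = ps_smult c (ps_var (k, i, j))"
  using assms by (cases "i = j") (simp_all add: Ymat_def ps_sub_def ps_add_def ps_smult_def ps_zero_def)

text \<open>The factor that two supertranspositions put on an entry, and so the source of
  \<open>(-1)^|x|\<close> in the involution laws.\<close>

lemma eps_eps: "eps n i j * eps n j i = (if var_odd n (k, i, j) then -1 else 1)"
  by (auto simp: eps_def var_odd_def)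

text \<open>With \<open>Z0\<close>, \<open>Z1\<close> the inverses in the two copies, both sides
  equal \<open>(Z1 Z0)^st - \<delta>\<close>: the left one as \<open>Z0^st Z1^st - \<delta>\<close>,
  the right one because the coproduct sends the inverse of \<open>Y\<close> to
  \<open>Z1 Z0\<close>.\<close>

lemma coprod_gsig:
  assumes "v \<in> Vs (n+m) 1"
  shows "ps_subst n (Vs (n+m) 2) (gsig n m) (gcop n m v) = ps_subst n (Vs (n+m) 1) (gcop n m) (gsig n m v)"
proof -
  obtain k i j where v: "v = (k, i, j)" "k < 1" and ij: "i \<in> {1..n+m}" "j \<in> {1..n+m}" using assms by (rule Vs_cases)
  let ?K = "{1..n+m}" and ?\<theta> = "ps_subst n (Vs (n+m) 2) (gsig n m)"
  let ?d = "if i = j then ps_one else ps_zero"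
  note \<theta> = ps_hom_subst[OF subst_ok_gsig, of n m 2]
  have "mat_mult_on n ?K (\<lambda>i j. ?\<theta> (Ymat n 0 i j)) (\<lambda>i j. ?\<theta> (Ymat n 1 i j)) i j
      = mat_mult_on n ?K (\<lambda>i j. ps_smult (eps n i j) (Yinv n m 0 j i)) (\<lambda>i j. ps_smult (eps n i j) (Yinv n m 1 j i)) i j"
    by (rule mat_mult_on_cong) (rule subst_gsig_Ymat; use ij in simp)+
  also have "\<dots> = ps_smult (eps n i j) (mat_mult_on n ?K (Yinv n m 1) (Yinv n m 0) j i)"
  proof (rule emb_inj[where n = n])
    have "(\<Sum>l\<in>?K. eps' n i l * emb n (Yinv n m 0 l i) * (eps' n l j * emb n (Yinv n m 1 j l)))
        = eps' n i j * (\<Sum>l\<in>?K. emb n (Yinv n m 1 j l) * emb n (Yinv n m 0 l i))"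
      by (rule supertranspose_sum[where p = "\<lambda>i j. emb n (Yinv n m 0 i j)" and q = "\<lambda>i j. emb n (Yinv n m 1 i j)"])
         (rule emb_homog Yinv_wf Yinv_homog)+
    then show "emb n (mat_mult_on n ?K (\<lambda>i j. ps_smult (eps n i j) (Yinv n m 0 j i)) (\<lambda>i j. ps_smult (eps n i j) (Yinv n m 1 j i)) i j)
        = emb n (ps_smult (eps n i j) (mat_mult_on n ?K (Yinv n m 1) (Yinv n m 0) j i))"
      by (simp add: emb_mat_mult_on emb_eps)
  qed simp_all
  finally have 1: "?\<theta> (mat_mult_on n ?K (Ymat n 0) (Ymat n 1) i j) = ps_smult (eps n i j) (mat_mult_on n ?K (Yinv n m 1) (Yinv n m 0) j i)"
    by (simp only: ps_hom_mat_mult_on[OF \<theta> finite_atLeastAtMost Ymat_wf Ymat_wf])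
  have g: "gcop n m v = ps_sub (mat_mult_on n ?K (Ymat n 0) (Ymat n 1) i j) ?d"
    using gcop_Ymat[OF ij, of k] unfolding ps_add_eq_iff v(1) .
  have "?\<theta> ?d = ?d" by (simp add: ps_homD[OF \<theta>] ps_hom_zero[OF \<theta>])
  moreover have "ps_wf n ?d" by simp
  ultimately have "?\<theta> (gcop n m v) = ps_sub (ps_smult (eps n i j) (mat_mult_on n ?K (Yinv n m 1) (Yinv n m 0) j i)) ?d"
    unfolding g by (simp only: ps_hom_sub[OF \<theta> mat_mult_on_wf] 1)
  also have "\<dots> = ps_subst n (Vs (n+m) 1) (gcop n m) (gsig n m v)"
    unfolding v(1) ps_hom_gsig[OF ps_hom_subst[OF subst_ok_gcop]] subst_gcop_Yinv[OF v(2) ij(2,1)] ..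
  finally show ?thesis .
qed

section \<open>The conditions on \<open>sigma\<close>, one by one\<close>

lemma ps_hom_sigma: "ps_hom n (sigma n m)"
proof -
  note h = ps_homD[OF ps_hom_subst[OF subst_ok_gsig, of n m 1]] and c = ps_homD[OF ps_hom_conj[of n]]
  show ?thesis unfolding ps_hom_def structure_maps using h c by simp
qed

text \<open>With \<open>s = sdet Y\<close> and \<open>u = sigma s\<close>, the relation
  \<open>u s = 1\<close> gives \<open>u - 1 = - u (s - 1)\<close>, so the generator of the ideal
  goes to a multiple of itself. This makes \<open>sigma\<close> well defined on the
  quotient.\<close>

lemma sigma_ideal:
  assumes "F \<in> hol_ideal n m"
  shows "sigma n m F \<in> hol_ideal n m"
proof -
  let ?s = "sdet n m (Ymat n 0)"
  obtain a where a: "F = ps_mult n a (sdet_rel n m 0)" "ps_wf n a" using assms unfolding hol_ideal_def by blast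
  have \<sigma>Y: "sigma n m (Ymat n 0 i j) = ps_smult (eps n i j) (Yinv n m 0 j i)" if "i \<in> {1..n+m}" "j \<in> {1..n+m}" for i j
    unfolding structure_maps ps_conj_Ymat by (rule subst_gsig_Ymat) (use that in simp_all)
  note s = sdet_hom_inverse[OF ps_hom_sigma \<sigma>Y]
  note hom = ps_homD[OF ps_hom_sigma[of n m]]
  let ?u = "sigma n m ?s" and ?b = "sigma n m a"
  have wf: "ps_wf n ?u" "ps_wf n ?b" using hom(1) s(2) a(2) by blast+
  have us: "emb n ?u * emb n ?s = 1" using arg_cong[OF s(1), of "emb n"] wf s(2) by (simp add: emb_mult)
  have "sigma n m F = ps_mult n ?b (ps_sub ?u ps_one)"
    using a s(2) by (simp add: sdet_rel_def hom ps_hom_sub[OF ps_hom_sigma])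
  also have "\<dots> = ps_mult n (ps_smult (-1) (ps_mult n ?b ?u)) (sdet_rel n m 0)"
  proof (rule emb_inj[where n = n])
    have "emb n ?b * (emb n ?u - 1) = - (emb n ?b * emb n ?u) * (emb n ?s - 1)"
      using us by (simp add: right_diff_distrib mult.assoc)
    then show "emb n (ps_mult n ?b (ps_sub ?u ps_one)) = emb n (ps_mult n (ps_smult (-1) (ps_mult n ?b ?u)) (sdet_rel n m 0))"
      using wf s(2) by (simp add: emb_mult emb_sub emb_neg sdet_rel_def)
  qed simp_all
  finally show ?thesis unfolding hol_ideal_def using ps_wf_closed(3)[OF ps_mult_wf] by blast
qed

lemma ps_mult_zero_left: "ps_mult n ps_zero G = ps_zero"
  by (rule ext) (simp add: ps_mult_alt ps_zero_def)

text \<open>The laws hold exactly, before passing to the quotient; the difference is then the zero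
  multiple of the relation.\<close>

lemma ps_sub_self_in_hol_ideal: "F = G \<Longrightarrow> ps_sub F G \<in> hol_ideal n m"
proof -
  assume "F = G"
  then have "ps_sub F G = ps_mult n ps_zero (sdet_rel n m 0)"
    unfolding ps_mult_zero_left by (simp add: ps_sub_def ps_zero_def)
  then show ?thesis unfolding hol_ideal_def using ps_wf_basic(1) by blast
qed

lemma ps_sub_self_in_tens_ideal: "F = G \<Longrightarrow> ps_sub F G \<in> tens_ideal n m"
proof -
  assume "F = G"
  then have "ps_sub F G = ps_add (ps_mult n ps_zero (sdet_rel n m 0)) (ps_mult n ps_zero (sdet_rel n m 1))"
    unfolding ps_mult_zero_left by (simp add: ps_sub_def ps_zero_def ps_add_def)
  then show ?thesis unfolding tens_ideal_def using ps_wf_basic(1) by blast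
qed

text \<open>The images of the generators have real coefficients. In the two involution laws
  \<open>sigma\<close> occurs twice, so the conjugations can be brought together and cancel.\<close>

lemma ps_conj_subst_gsig: "ps_conj (ps_subst n (Vs (n+m) c) (gsig n m) F) = ps_subst n (Vs (n+m) c) (gsig n m) (ps_conj F)"
  by (simp add: ps_conj_subst[OF subst_ok_gsig] ps_conj_gsig)

lemma ps_conj_subst_gS: "ps_conj (ps_subst n (Vs (n+m) c) (gS n m) F) = ps_subst n (Vs (n+m) c) (gS n m) (ps_conj F)"
  by (simp add: ps_conj_subst[OF subst_ok_gS] ps_conj_gS)

lemma ps_subst_parity_cong:
  assumes "\<And>k i j. k < 1 \<Longrightarrow> i \<in> {1..n+m} \<Longrightarrow> j \<in> {1..n+m} \<Longrightarrow> g (k, i, j) = ps_smult (eps n i j * eps n j i) (ps_var (k, i, j))"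
    and "F \<in> hol_elts n m" "ps_homog n p F"
  shows "ps_subst n (Vs (n+m) 1) g F = ps_smult (if p then -1 else 1) F"
proof -
  have "ps_subst n (Vs (n+m) 1) g F = ps_subst n (Vs (n+m) 1) (\<lambda>v. ps_smult (if var_odd n v then -1 else 1) (ps_var v)) F"
  proof (rule ps_subst_cong)
    fix v assume "v \<in> Vs (n+m) 1"
    then obtain k i j where v: "v = (k, i, j)" "k < 1" "i \<in> {1..n+m}" "j \<in> {1..n+m}" by (rule Vs_cases)
    show "g v = ps_smult (if var_odd n v then -1 else 1) (ps_var v)"
      unfolding v(1) assms(1)[OF v(2-4)] eps_eps[of n i j k] ..
  qed
  then show ?thesis using ps_subst_parity[OF finite_Vs _ assms(3)] assms(2) by (simp add: hol_elts_def)
qed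

lemma sigma_sigma:
  assumes "F \<in> hol_elts n m" "ps_homog n p F"
  shows "sigma n m (sigma n m F) = ps_smult (if p then -1 else 1) F"
proof -
  let ?\<sigma> = "ps_subst n (Vs (n+m) 1) (gsig n m)"
  have "sigma n m (sigma n m F) = ps_subst n (Vs (n+m) 1) (\<lambda>v. ?\<sigma> (gsig n m v)) F"
    unfolding structure_maps ps_conj_subst_gsig ps_conj_conj by (rule ps_subst_subst[OF subst_ok_gsig subst_ok_gsig])
  also have "\<dots> = ps_smult (if p then -1 else 1) F"
  proof (rule ps_subst_parity_cong[OF _ assms])
    fix k i j assume k: "k < (1 :: nat)" and ij: "i \<in> {1..n+m}" "j \<in> {1..n+m}"
    show "?\<sigma> (gsig n m (k, i, j)) = ps_smult (eps n i j * eps n j i) (ps_var (k, i, j))"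
      unfolding ps_hom_gsig[OF ps_hom_subst[OF subst_ok_gsig]] subst_gsig_Yinv[OF k ij(2,1)] ps_smult_smult
      by (rule Ymat_minus_delta) simp
  qed
  finally show ?thesis .
qed

lemma antipode_sigma_twice:
  assumes "F \<in> hol_elts n m" "ps_homog n p F"
  shows "antipode n m (sigma n m (antipode n m (sigma n m F))) = ps_smult (if p then -1 else 1) F"
proof -
  let ?V = "Vs (n+m) 1"
  \<comment> \<open>What \<open>sigma\<close> followed by the antipode does to generators, apart
    from conjugation: the antipode sends the inverse of \<open>Y\<close> back to \<open>Y\<close>,
    so only the signed transposition remains.\<close>
  define g where "g = (\<lambda>(k, i, j). ps_smult (eps n i j) (ps_var (k, j, i)))"
  have ok: "subst_ok n ?V g"
    unfolding subst_ok_def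
  proof (intro conjI ballI finite_Vs)
    fix v assume "v \<in> ?V"
    obtain k i j where v: "v = (k, i, j)" by (cases v)
    have "ps_homog n (var_odd n (k, j, i)) (g v)"
      unfolding g_def v by (simp add: ps_homog_closed(3)[OF ps_homog_var])
    moreover have "var_odd n (k, j, i) = var_odd n v" by (auto simp: var_odd_def v)
    ultimately show "ps_homog n (var_odd n v) (g v)" by simp
    show "ps_wf n (g v)" by (simp add: g_def v)
    show "g v (\<lambda>u. 0) = 0" by (simp add: g_def v ps_smult_def)
  qed
  have S\<sigma>: "ps_subst n ?V (gS n m) (ps_subst n ?V (gsig n m) H) = ps_subst n ?V g H" for H
    unfolding ps_subst_subst[OF subst_ok_gsig subst_ok_gS]
  proof (rule ps_subst_cong)
    fix v assume "v \<in> ?V"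
    then obtain k i j where v: "v = (k, i, j)" "k < 1" and ij: "i \<in> {1..n+m}" "j \<in> {1..n+m}" by (rule Vs_cases)
    have "ps_sub (ps_smult (eps n i j) (Ymat n k j i)) (if j = i then ps_one else ps_zero) = ps_smult (eps n i j) (ps_var (k, j, i))"
      by (rule Ymat_minus_delta) simp
    then show "ps_subst n ?V (gS n m) (gsig n m v) = g v"
      unfolding v(1) ps_hom_gsig[OF ps_hom_subst[OF subst_ok_gS]] subst_gS_Yinv[OF v(2) ij(2,1)] g_def
      by (simp add: eq_commute)
  qed
  have "antipode n m (sigma n m (antipode n m (sigma n m F))) = ps_subst n ?V g (ps_subst n ?V g F)"
    unfolding structure_maps ps_conj_subst_gS ps_conj_subst_gsig ps_conj_conj
    unfolding S\<sigma> ..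
  also have "\<dots> = ps_subst n ?V (\<lambda>v. ps_subst n ?V g (g v)) F"
    by (rule ps_subst_subst[OF ok ok])
  also have "\<dots> = ps_smult (if p then -1 else 1) F"
  proof (rule ps_subst_parity_cong[OF _ assms])
    fix k i j assume k: "k < (1 :: nat)" and ij: "i \<in> {1..n+m}" "j \<in> {1..n+m}"
    have "(k, j, i) \<in> ?V" using k ij by (simp only: Vs_iff simp_thms)
    then have "ps_subst n ?V g (ps_var (k, j, i)) = ps_smult (eps n j i) (ps_var (k, i, j))"
      using ps_subst_var[OF ok] by (simp add: g_def)
    then show "ps_subst n ?V g (g (k, i, j)) = ps_smult (eps n i j * eps n j i) (ps_var (k, i, j))"
      by (subst g_def) (simp add: ps_subst_smult ps_smult_smult)
  qed
  finally show ?thesis .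
qed

lemma sigma2_coprod: "sigma2 n m (coprod n m F) = coprod n m (sigma n m F)"
proof -
  let ?V = "Vs (n+m) 1"
  have "ps_conj (coprod n m F) = ps_subst n ?V (gcop n m) (ps_conj F)"
    unfolding structure_maps ps_conj_subst[OF subst_ok_gcop] by (rule ps_subst_cong) (rule ps_conj_gcop)
  then have "sigma2 n m (coprod n m F)
      = ps_subst n ?V (\<lambda>v. ps_subst n (Vs (n+m) 2) (gsig n m) (gcop n m v)) (ps_conj F)"
    unfolding structure_maps(4) by (simp add: ps_subst_subst[OF subst_ok_gcop subst_ok_gsig])
  also have "\<dots> = ps_subst n ?V (\<lambda>v. ps_subst n ?V (gcop n m) (gsig n m v)) (ps_conj F)"
    by (rule ps_subst_cong) (rule coprod_gsig)
  also have "\<dots> = coprod n m (sigma n m F)"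
    unfolding structure_maps by (rule ps_subst_subst[OF subst_ok_gsig subst_ok_gcop, symmetric])
  finally show ?thesis .
qed

lemma sigma_linear:
  "sigma n m (ps_add (ps_smult a F) (ps_smult b G))
    = ps_add (ps_smult (cnj a) (sigma n m F)) (ps_smult (cnj b) (sigma n m G))"
proof -
  have "ps_conj (ps_add (ps_smult a F) (ps_smult b G)) = ps_add (ps_smult (cnj a) (ps_conj F)) (ps_smult (cnj b) (ps_conj G))"
    by (simp add: ps_conj_def ps_add_def ps_smult_def)
  then show ?thesis unfolding structure_maps by (simp add: ps_subst_add ps_subst_smult)
qed

theorem theorem2p1:
  fixes n m :: nat
  shows
   "(\<forall>F\<in>hol_elts n m. F \<in> hol_ideal n m \<longrightarrow> sigma n m F \<in> hol_ideal n m)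
    \<and> (\<forall>F\<in>hol_elts n m.
         ps_sub (sigma2 n m (coprod n m F)) (coprod n m (sigma n m F)) \<in> tens_ideal n m)
    \<and> (\<forall>F\<in>hol_elts n m. counit (sigma n m F) = cnj (counit F))
    \<and> (\<forall>F\<in>hol_elts n m. \<forall>G\<in>hol_elts n m. \<forall>a b :: complex.
         ps_sub (sigma n m (ps_add (ps_smult a F) (ps_smult b G)))
                (ps_add (ps_smult (cnj a) (sigma n m F)) (ps_smult (cnj b) (sigma n m G)))
           \<in> hol_ideal n m)
    \<and> (\<forall>F\<in>hol_elts n m. \<forall>G\<in>hol_elts n m.
         ps_sub (sigma n m (ps_mult n F G)) (ps_mult n (sigma n m F) (sigma n m G))
           \<in> hol_ideal n m)
    \<and> (\<forall>F\<in>hol_elts n m. \<forall>p. ps_homog n p F \<longrightarrow>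
         ps_sub (antipode n m (sigma n m (antipode n m (sigma n m F))))
                (ps_smult (if p then -1 else 1) F) \<in> hol_ideal n m)
    \<and> (\<forall>F\<in>hol_elts n m. \<forall>p. ps_homog n p F \<longrightarrow>
         ps_sub (sigma n m (sigma n m F)) (ps_smult (if p then -1 else 1) F) \<in> hol_ideal n m)"
proof (intro conjI ballI allI impI)
  fix F G :: ps and p :: bool and a b :: complex
  assume F: "F \<in> hol_elts n m"
  show "sigma n m F \<in> hol_ideal n m" if "F \<in> hol_ideal n m"
    using that by (rule sigma_ideal)
  show "ps_sub (sigma2 n m (coprod n m F)) (coprod n m (sigma n m F)) \<in> tens_ideal n m"
    by (rule ps_sub_self_in_tens_ideal[OF sigma2_coprod])
  show "counit (sigma n m F) = cnj (counit F)"
    by (simp add: counit_def structure_maps ps_subst_const[OF finite_Vs] ps_conj_def)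
  show "ps_sub (antipode n m (sigma n m (antipode n m (sigma n m F)))) (ps_smult (if p then -1 else 1) F) \<in> hol_ideal n m"
    if "ps_homog n p F"
    by (rule ps_sub_self_in_hol_ideal[OF antipode_sigma_twice[OF F that]])
  show "ps_sub (sigma n m (sigma n m F)) (ps_smult (if p then -1 else 1) F) \<in> hol_ideal n m"
    if "ps_homog n p F"
    by (rule ps_sub_self_in_hol_ideal[OF sigma_sigma[OF F that]])
  show "ps_sub (sigma n m (ps_add (ps_smult a F) (ps_smult b G)))
      (ps_add (ps_smult (cnj a) (sigma n m F)) (ps_smult (cnj b) (sigma n m G))) \<in> hol_ideal n m"
    by (rule ps_sub_self_in_hol_ideal[OF sigma_linear])
  show "ps_sub (sigma n m (ps_mult n F G)) (ps_mult n (sigma n m F) (sigma n m G)) \<in> hol_ideal n m"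
    by (rule ps_sub_self_in_hol_ideal)
       (simp add: structure_maps ps_conj_mult ps_subst_mult[OF subst_ok_gsig])
qed

end
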